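(* Let $\Omega_1\subset\mathbb{R}^{N_1}$ and $\Omega_2\subset\mathbb{R}^{N_2}$ be regions satisfying (B1) and (B2), let $\Omega_p:=\Omega_1\times\Omega_2$ and $V:=H_0^1(\Omega_1)\otimes H^1(\Omega_2)$. Let $\{\lambda_{1j}\}_{j\in\mathbb{N}}$, $\{e_{1j}\}_{j\in\mathbb{N}}$ be the Dirichlet Laplacian eigenvalues and eigenfunctions on $\Omega_1$, let $\{\lambda_{2k}\}_{k\in\mathbb{N}}$, $\{f_{2k}\}_{k\in\mathbb{N}}$ be the Neumann Laplacian eigenvalues and eigenfunctions on $\Omega_2$, and put $u_{jk}:=e_{1j}\otimes f_{2k}$, $\mathcal{U}:=\{u_{jk}:j,k\in\mathbb{N}\}$. Then each $u_{jk}\in\mathcal{U}$ is a Dirichlet–Neumann Laplacian (DNL) eigenfunction on $\Omega_p$ corresponding to the eigenvalue $\lambda_{1j}+\lambda_{2k}$. Moreover $\mathcal{U}$ is an orthogonal family in $V$ with respect to the inner product $[u,v]_{\nabla,\Omega_p}:=\int_{\Omega_p}[\nabla_xu\cdot\nabla_xv+\nabla_yu\cdot\nabla_yv]\,dx\,dy$ and is an orthogonal family in $L^2(\Omega_p)$.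
   Context: A region is a nonempty, connected, open subset of $\mathbb{R}^N$. All function spaces are real. Condition (B1) on a region $\Omega\subset\mathbb{R}^N$: $\Omega$ is bounded and its boundary $\partial\Omega:=\overline{\Omega}\setminus\Omega$ is the union of a finite number of disjoint closed Lipschitz surfaces, each having finite surface area. Condition (B2): $\Omega$ satisfies (B1); the imbedding of $H^1(\Omega)$ into $L^p(\Omega)$ is compact for $1\le p<p_s$, where $p_s=2N/(N-2)$ if $N\ge3$ and $p_s=\infty$ if $N=2$ (Rellich theorem); and the trace map $\gamma:H^1(\Omega)\to L^2(\partial\Omega,d\sigma)$ is compact, $\sigma$ being $(N-1)$-dimensional Hausdorff measure ($L^2$-compact trace theorem). Tensor products: $(e\otimes f)(x,y):=e(x)f(y)$. For real separable Hilbert spaces $H_1\subset L^2(\Omega_1)$, $H_2\subset L^2(\Omega_2)$ with orthonormal bases $\{e_j\}$, $\{f_k\}$, the Hilbert tensor product $H_1\otimes H_2$ is the completion of the space of finite linear combinations $\sum\hat g_{jk}\,e_j\otimes f_k$ under $\langle g,h\rangle_\otimes:=\sum_{j,k}\hat g_{jk}\hat h_{jk}$; its elements are the functions $g(x,y)=\sum_{j,k}\hat g_{jk}e_j(x)f_k(y)$ with $\sum_{j,k}\hat g_{jk}^2<\infty$. In $V$, $H_0^1(\Omega_1)$ carries the inner product $\int_{\Omega_1}\nabla u\cdot\nabla v\,dx$ and $H^1(\Omega_2)$ carries the standard inner product $\int_{\Omega_2}(uv+\nabla u\cdot\nabla v)\,dy$. The Dirichlet (resp. Neumann) Laplacian eigenproblem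 on $\Omega$ is to find $(\lambda,u)\in\mathbb{R}\times X$, $u\ne0$, with $\int_\Omega\nabla u\cdot\nabla h\,dx=\lambda\int_\Omega u\,h\,dx$ for all $h\in X$, where $X=H_0^1(\Omega)$ (resp. $X=H^1(\Omega)$). Dirichlet eigendata on $\Omega_1$: all eigenvalues $\lambda_{1j}>0$ repeated according to multiplicity, $\lambda_{1j}\to\infty$, with eigenfunctions $e_{1j}$ forming an orthonormal basis of $L^2(\Omega_1)$ such that $\{\lambda_{1j}^{-1/2}e_{1j}\}$ is an orthonormal basis of $H_0^1(\Omega_1)$. Neumann eigendata on $\Omega_2$: all eigenvalues $\lambda_{2k}\ge0$ repeated according to multiplicity, increasing to $\infty$, with eigenfunctions $f_{2k}$ forming a maximal orthonormal set in $H^1(\Omega_2)$ for the standard inner product; then $\int_{\Omega_2}f_{2j}f_{2k}\,dy=\delta_{jk}/(1+\lambda_{2k})$. DNL eigenproblem on $\Omega_p$: find $(\lambda,u)\in\mathbb{R}\times V$, $u\neq0$, with $\int_{\Omega_p}\nabla u\cdot\nabla h\,dx\,dy=\lambda\int_{\Omega_p}u\,h\,dx\,dy$ for all $h\in V$. *)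

theory Defs
  imports "HOL-Analysis.Analysis"
begin

text \<open>
  Elements of function spaces are represented by functions on the whole Euclidean space; only
  their values on the region matter, and two representatives that agree almost everywhere on the
  region stand for the same element.
\<close>

section \<open>Lebesgue spaces and maps between function spaces\<close>

definition Lp :: "'a measure \<Rightarrow> real \<Rightarrow> ('a \<Rightarrow> real) set" where
  "Lp M p = {f \<in> borel_measurable M. integrable M (\<lambda>x. \<bar>f x\<bar> powr p)}"

definition Lp_norm :: "'a measure \<Rightarrow> real \<Rightarrow> ('a \<Rightarrow> real) \<Rightarrow> real" where
  "Lp_norm M p f = (\<integral>x. \<bar>f x\<bar> powr p \<partial>M) powr (1 / p)"

definition L2_inner :: "'a measure \<Rightarrow> ('a \<Rightarrow> real) \<Rightarrow> ('a \<Rightarrow> real) \<Rightarrow> real" where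
  "L2_inner M u v = (\<integral>x. u x * v x \<partial>M)"

definition compact_map ::
  "('a \<Rightarrow> real) set \<Rightarrow> (('a \<Rightarrow> real) \<Rightarrow> real) \<Rightarrow> ('b \<Rightarrow> real) set \<Rightarrow> (('b \<Rightarrow> real) \<Rightarrow> real) \<Rightarrow>
   (('a \<Rightarrow> real) \<Rightarrow> ('b \<Rightarrow> real)) \<Rightarrow> bool" where
  "compact_map X normX Y normY T \<longleftrightarrow>
     (\<forall>u\<in>X. T u \<in> Y) \<and>
     (\<forall>u::nat \<Rightarrow> 'a \<Rightarrow> real. (\<forall>n. u n \<in> X) \<and> (\<exists>C. \<forall>n. normX (u n) \<le> C) \<longrightarrow>
        (\<exists>r v. strict_mono (r::nat \<Rightarrow> nat) \<and> v \<in> Y \<and>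
           (\<lambda>n. normY (\<lambda>x. T (u (r n)) x - v x)) \<longlonglongrightarrow> 0))"

text \<open>The last clause is maximality: only the zero vector is orthogonal to all \<open>e j\<close>.\<close>

definition orthonormal_basis ::
  "('a \<Rightarrow> real) set \<Rightarrow> (('a \<Rightarrow> real) \<Rightarrow> ('a \<Rightarrow> real) \<Rightarrow> real) \<Rightarrow> (nat \<Rightarrow> 'a \<Rightarrow> real) \<Rightarrow> bool" where
  "orthonormal_basis H ip e \<longleftrightarrow>
     (\<forall>j. e j \<in> H) \<and>
     (\<forall>i j. ip (e i) (e j) = (if i = j then 1 else 0)) \<and>
     (\<forall>u\<in>H. (\<forall>j. ip u (e j) = 0) \<longrightarrow> ip u u = 0)"

definition orthogonal_family ::
  "('a \<Rightarrow> real) set \<Rightarrow> (('a \<Rightarrow> real) \<Rightarrow> ('a \<Rightarrow> real) \<Rightarrow> real) \<Rightarrow> ('i \<Rightarrow> 'a \<Rightarrow> real) \<Rightarrow> bool" where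
  "orthogonal_family X ip u \<longleftrightarrow>
     (\<forall>i. u i \<in> X) \<and> (\<forall>i j. i \<noteq> j \<longrightarrow> ip (u i) (u j) = 0)"

section \<open>Sobolev spaces\<close>

primrec Ck :: "nat \<Rightarrow> ('a::euclidean_space \<Rightarrow> real) \<Rightarrow> bool" where
  "Ck 0 f \<longleftrightarrow> continuous_on UNIV f"
| "Ck (Suc k) f \<longleftrightarrow>
     (\<forall>x. f differentiable (at x)) \<and> (\<forall>i\<in>Basis. Ck k (\<lambda>x. frechet_derivative f (at x) i))"

definition test_function :: "'a::euclidean_space set \<Rightarrow> ('a \<Rightarrow> real) \<Rightarrow> bool" where
  "test_function \<Omega> \<phi> \<longleftrightarrow>
     (\<forall>k. Ck k \<phi>) \<and> compact (closure {x. \<phi> x \<noteq> 0}) \<and> closure {x. \<phi> x \<noteq> 0} \<subseteq> \<Omega>"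

definition weak_gradient ::
  "'a::euclidean_space set \<Rightarrow> ('a \<Rightarrow> real) \<Rightarrow> ('a \<Rightarrow> 'a) \<Rightarrow> bool" where
  "weak_gradient \<Omega> u g \<longleftrightarrow>
     (\<forall>K. compact K \<and> K \<subseteq> \<Omega> \<longrightarrow> set_integrable lebesgue K u \<and> set_integrable lebesgue K g) \<and>
     (\<forall>\<phi>. test_function \<Omega> \<phi> \<longrightarrow> (\<forall>i\<in>Basis.
        (\<integral>x. u x * frechet_derivative \<phi> (at x) i \<partial>lebesgue_on \<Omega>) =
        - (\<integral>x. (g x \<bullet> i) * \<phi> x \<partial>lebesgue_on \<Omega>)))"

text \<open>A weak gradient is unique up to null sets, so the choice below is immaterial.\<close>

definition grad :: "'a::euclidean_space set \<Rightarrow> ('a \<Rightarrow> real) \<Rightarrow> 'a \<Rightarrow> 'a" where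
  "grad \<Omega> u = (SOME g. weak_gradient \<Omega> u g)"

definition H1 :: "'a::euclidean_space set \<Rightarrow> ('a \<Rightarrow> real) set" where
  "H1 \<Omega> = {u \<in> Lp (lebesgue_on \<Omega>) 2.
     \<exists>g. weak_gradient \<Omega> u g \<and> (\<forall>i\<in>Basis. (\<lambda>x. g x \<bullet> i) \<in> Lp (lebesgue_on \<Omega>) 2)}"

definition grad_inner ::
  "'a::euclidean_space set \<Rightarrow> ('a \<Rightarrow> real) \<Rightarrow> ('a \<Rightarrow> real) \<Rightarrow> real" where
  "grad_inner \<Omega> u v = (\<integral>x. grad \<Omega> u x \<bullet> grad \<Omega> v x \<partial>lebesgue_on \<Omega>)"

definition H1_inner ::
  "'a::euclidean_space set \<Rightarrow> ('a \<Rightarrow> real) \<Rightarrow> ('a \<Rightarrow> real) \<Rightarrow> real" where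
  "H1_inner \<Omega> u v = (\<integral>x. u x * v x + grad \<Omega> u x \<bullet> grad \<Omega> v x \<partial>lebesgue_on \<Omega>)"

definition H1_norm :: "'a::euclidean_space set \<Rightarrow> ('a \<Rightarrow> real) \<Rightarrow> real" where
  "H1_norm \<Omega> u = sqrt (H1_inner \<Omega> u u)"

definition H10 :: "'a::euclidean_space set \<Rightarrow> ('a \<Rightarrow> real) set" where
  "H10 \<Omega> = {u \<in> H1 \<Omega>. \<forall>\<epsilon>>0. \<exists>\<phi>. test_function \<Omega> \<phi> \<and> H1_norm \<Omega> (\<lambda>x. u x - \<phi> x) < \<epsilon>}"

section \<open>Hausdorff measure and the conditions on regions\<close>

text \<open>
  The normalisation makes the \<open>d\<close>-dimensional measure agree with Lebesgue measure on \<open>d\<close>-planes.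
  Boundedness of the covering sets is needed because \<open>diameter\<close> is meaningless otherwise, and the
  empty set is treated separately because \<open>0 ^ 0 = 1\<close>.
\<close>

definition hausdorff_outer :: "nat \<Rightarrow> 'a::euclidean_space set \<Rightarrow> ennreal" where
  "hausdorff_outer d A =
     (SUP \<delta>\<in>{0<..}.
        INF U\<in>{U :: nat \<Rightarrow> 'a set. A \<subseteq> (\<Union>i. U i) \<and> (\<forall>i. bounded (U i) \<and> diameter (U i) \<le> \<delta>)}.
          \<Sum>i. if U i = {} then 0
              else ennreal (unit_ball_vol (real d) * (diameter (U i) / 2) ^ d))"

text \<open>The \<open>\<sigma>\<close>-algebra consists of the Caratheodory-measurable sets.\<close>

definition hausdorff_measure :: "nat \<Rightarrow> 'a::euclidean_space measure" where
  "hausdorff_measure d =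
     measure_of UNIV (lambda_system UNIV (Pow UNIV) (hausdorff_outer d)) (hausdorff_outer d)"

definition boundary :: "'a::euclidean_space set \<Rightarrow> 'a set" where
  "boundary \<Omega> = closure \<Omega> - \<Omega>"

definition boundary_measure :: "'a::euclidean_space set \<Rightarrow> 'a measure" where
  "boundary_measure \<Omega> = restrict_space (hausdorff_measure (DIM('a) - 1)) (boundary \<Omega>)"

definition region :: "'a::euclidean_space set \<Rightarrow> bool" where
  "region \<Omega> \<longleftrightarrow> open \<Omega> \<and> connected \<Omega> \<and> \<Omega> \<noteq> {}"

text \<open>
  A closed Lipschitz surface is a compact connected set that, near each of its points and for some
  unit direction \<open>\<nu>\<close>, is the graph of a Lipschitz function over the hyperplane orthogonal to \<open>\<nu>\<close>.
\<close>

definition closed_lipschitz_surface :: "'a::euclidean_space set \<Rightarrow> bool" where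
  "closed_lipschitz_surface S \<longleftrightarrow>
     compact S \<and> connected S \<and> S \<noteq> {} \<and>
     (\<forall>x\<in>S. \<exists>\<nu> W g L. norm \<nu> = 1 \<and> open W \<and> x \<in> W \<and> L-lipschitz_on UNIV (g :: 'a \<Rightarrow> real) \<and>
        S \<inter> W = {z \<in> W. z \<bullet> \<nu> = g (z - (z \<bullet> \<nu>) *\<^sub>R \<nu>)})"

definition cond_B1 :: "'a::euclidean_space set \<Rightarrow> bool" where
  "cond_B1 \<Omega> \<longleftrightarrow>
     bounded \<Omega> \<and>
     (\<exists>\<S>. finite \<S> \<and> pairwise disjnt \<S> \<and> \<Union>\<S> = boundary \<Omega> \<and>
        (\<forall>S\<in>\<S>. closed_lipschitz_surface S \<and> hausdorff_outer (DIM('a) - 1) S < \<infinity>))"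

definition sobolev_exponent :: "nat \<Rightarrow> ereal" where
  "sobolev_exponent N = (if 3 \<le> N then ereal (2 * real N / (real N - 2)) else \<infinity>)"

text \<open>
  A trace map is a bounded linear extension to \<open>H1\<close> of the restriction to the boundary of functions
  that are Lipschitz continuous on the closure of the region.
\<close>

definition trace_map :: "'a::euclidean_space set \<Rightarrow> (('a \<Rightarrow> real) \<Rightarrow> ('a \<Rightarrow> real)) \<Rightarrow> bool" where
  "trace_map \<Omega> \<gamma> \<longleftrightarrow>
     (\<forall>u\<in>H1 \<Omega>. \<gamma> u \<in> Lp (boundary_measure \<Omega>) 2) \<and>
     (\<forall>u\<in>H1 \<Omega>. \<forall>v\<in>H1 \<Omega>. \<forall>a b.
        AE x in boundary_measure \<Omega>. \<gamma> (\<lambda>x. a * u x + b * v x) x = a * \<gamma> u x + b * \<gamma> v x) \<and>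
     (\<exists>C. \<forall>u\<in>H1 \<Omega>. Lp_norm (boundary_measure \<Omega>) 2 (\<gamma> u) \<le> C * H1_norm \<Omega> u) \<and>
     (\<forall>u\<in>H1 \<Omega>. (\<exists>L. L-lipschitz_on (closure \<Omega>) u) \<longrightarrow>
        (AE x in boundary_measure \<Omega>. \<gamma> u x = u x))"

definition cond_B2 :: "'a::euclidean_space set \<Rightarrow> bool" where
  "cond_B2 \<Omega> \<longleftrightarrow>
     cond_B1 \<Omega> \<and>
     (\<forall>p. 1 \<le> p \<and> ereal p < sobolev_exponent DIM('a) \<longrightarrow>
        compact_map (H1 \<Omega>) (H1_norm \<Omega>) (Lp (lebesgue_on \<Omega>) p) (Lp_norm (lebesgue_on \<Omega>) p)
          (\<lambda>u. u)) \<and>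
     (\<exists>\<gamma>. trace_map \<Omega> \<gamma> \<and>
        compact_map (H1 \<Omega>) (H1_norm \<Omega>)
          (Lp (boundary_measure \<Omega>) 2) (Lp_norm (boundary_measure \<Omega>) 2) \<gamma>)"

section \<open>Tensor products\<close>

definition tensor :: "('a \<Rightarrow> real) \<Rightarrow> ('b \<Rightarrow> real) \<Rightarrow> 'a \<times> 'b \<Rightarrow> real" (infixr \<open>\<otimes>\<^sub>f\<close> 70) where
  "(e \<otimes>\<^sub>f f) = (\<lambda>(x, y). e x * f y)"

text \<open>
  The Hilbert tensor product of two infinite-dimensional separable Hilbert spaces
  \<open>Ha \<subseteq> L\<^sup>2(A)\<close>, \<open>Hb \<subseteq> L\<^sup>2(B)\<close> (with continuous inclusions), realised as a space of functions on
  \<open>A \<times> B\<close>: the functions with an expansion \<open>\<Sum>c\<^sub>j\<^sub>k e\<^sub>j \<otimes> f\<^sub>k\<close>, convergent in \<open>L\<^sup>2(A \<times> B)\<close>, with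
  square-summable coefficients.  The space does not depend on the pair of orthonormal bases, so
  quantifying the bases existentially or universally gives the same space.
\<close>

definition hilbert_tensor ::
  "'a::euclidean_space set \<Rightarrow> ('a \<Rightarrow> real) set \<Rightarrow> (('a \<Rightarrow> real) \<Rightarrow> ('a \<Rightarrow> real) \<Rightarrow> real) \<Rightarrow>
   'b::euclidean_space set \<Rightarrow> ('b \<Rightarrow> real) set \<Rightarrow> (('b \<Rightarrow> real) \<Rightarrow> ('b \<Rightarrow> real) \<Rightarrow> real) \<Rightarrow>
   ('a \<times> 'b \<Rightarrow> real) set" where
  "hilbert_tensor A Ha ipa B Hb ipb =
     {g \<in> Lp (lebesgue_on (A \<times> B)) 2.
        \<exists>e f c. orthonormal_basis Ha ipa e \<and> orthonormal_basis Hb ipb f \<and>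
          (\<lambda>jk :: nat \<times> nat. (c jk)\<^sup>2) summable_on UNIV \<and>
          ((\<lambda>F. Lp_norm (lebesgue_on (A \<times> B)) 2
              (\<lambda>z. g z - (\<Sum>(j, k)\<in>F. c (j, k) * (e j \<otimes>\<^sub>f f k) z))) \<longlongrightarrow> 0)
            (finite_subsets_at_top UNIV)}"

definition V_space ::
  "'a::euclidean_space set \<Rightarrow> 'b::euclidean_space set \<Rightarrow> ('a \<times> 'b \<Rightarrow> real) set" where
  "V_space \<Omega>1 \<Omega>2 =
     hilbert_tensor \<Omega>1 (H10 \<Omega>1) (grad_inner \<Omega>1) \<Omega>2 (H1 \<Omega>2) (H1_inner \<Omega>2)"

text \<open>
  On a product, the two components of the gradient are the partial gradients
  \<open>\<nabla>\<^sub>x\<close> and \<open>\<nabla>\<^sub>y\<close>.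
\<close>

definition product_grad_inner ::
  "'a::euclidean_space set \<Rightarrow> 'b::euclidean_space set \<Rightarrow>
   ('a \<times> 'b \<Rightarrow> real) \<Rightarrow> ('a \<times> 'b \<Rightarrow> real) \<Rightarrow> real" where
  "product_grad_inner \<Omega>1 \<Omega>2 u v =
     (\<integral>z. fst (grad (\<Omega>1 \<times> \<Omega>2) u z) \<bullet> fst (grad (\<Omega>1 \<times> \<Omega>2) v z) +
          snd (grad (\<Omega>1 \<times> \<Omega>2) u z) \<bullet> snd (grad (\<Omega>1 \<times> \<Omega>2) v z) \<partial>lebesgue_on (\<Omega>1 \<times> \<Omega>2))"

section \<open>Laplacian eigenproblems\<close>

definition laplacian_eigenpair ::
  "'a::euclidean_space set \<Rightarrow> ('a \<Rightarrow> real) set \<Rightarrow> real \<Rightarrow> ('a \<Rightarrow> real) \<Rightarrow> bool" where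
  "laplacian_eigenpair \<Omega> X lam u \<longleftrightarrow>
     u \<in> X \<and> \<not> (AE x in lebesgue_on \<Omega>. u x = 0) \<and>
     (\<forall>h\<in>X. (\<integral>x. grad \<Omega> u x \<bullet> grad \<Omega> h x \<partial>lebesgue_on \<Omega>) =
        lam * (\<integral>x. u x * h x \<partial>lebesgue_on \<Omega>))"

text \<open>
  The sequences list all eigenvalues, repeated according to multiplicity: every eigenfunction for
  an eigenvalue is a linear combination of those listed eigenfunctions (finitely many, and linearly
  independent by the orthogonality required below) that have the same eigenvalue.
\<close>

definition lists_all_eigenpairs ::
  "'a::euclidean_space set \<Rightarrow> ('a \<Rightarrow> real) set \<Rightarrow> (nat \<Rightarrow> real) \<Rightarrow> (nat \<Rightarrow> 'a \<Rightarrow> real) \<Rightarrow> bool" where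
  "lists_all_eigenpairs \<Omega> X lam e \<longleftrightarrow>
     (\<forall>j. laplacian_eigenpair \<Omega> X (lam j) (e j)) \<and>
     (\<forall>\<mu> u. laplacian_eigenpair \<Omega> X \<mu> u \<longrightarrow> finite {j. lam j = \<mu>} \<and>
        (\<exists>c. AE x in lebesgue_on \<Omega>. u x = (\<Sum>j | lam j = \<mu>. c j * e j x)))"

definition dirichlet_eigendata ::
  "'a::euclidean_space set \<Rightarrow> (nat \<Rightarrow> real) \<Rightarrow> (nat \<Rightarrow> 'a \<Rightarrow> real) \<Rightarrow> bool" where
  "dirichlet_eigendata \<Omega> lam e \<longleftrightarrow>
     lists_all_eigenpairs \<Omega> (H10 \<Omega>) lam e \<and>
     (\<forall>j. 0 < lam j) \<and> filterlim lam at_top sequentially \<and>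
     orthonormal_basis (Lp (lebesgue_on \<Omega>) 2) (L2_inner (lebesgue_on \<Omega>)) e \<and>
     orthonormal_basis (H10 \<Omega>) (grad_inner \<Omega>) (\<lambda>j x. lam j powr (- 1 / 2) * e j x)"

definition neumann_eigendata ::
  "'a::euclidean_space set \<Rightarrow> (nat \<Rightarrow> real) \<Rightarrow> (nat \<Rightarrow> 'a \<Rightarrow> real) \<Rightarrow> bool" where
  "neumann_eigendata \<Omega> lam f \<longleftrightarrow>
     lists_all_eigenpairs \<Omega> (H1 \<Omega>) lam f \<and>
     (\<forall>k. 0 \<le> lam k) \<and> incseq lam \<and> filterlim lam at_top sequentially \<and>
     orthonormal_basis (H1 \<Omega>) (H1_inner \<Omega>) f"

abbreviation DNL_eigenpair ::
  "'a::euclidean_space set \<Rightarrow> 'b::euclidean_space set \<Rightarrow> real \<Rightarrow> ('a \<times> 'b \<Rightarrow> real) \<Rightarrow> bool" where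
  "DNL_eigenpair \<Omega>1 \<Omega>2 \<equiv> laplacian_eigenpair (\<Omega>1 \<times> \<Omega>2) (V_space \<Omega>1 \<Omega>2)"

end

theory Submission
  imports Defs
begin

text \<open>
  Separation of variables.  If \<open>u\<close> is a Dirichlet eigenfunction on the first factor and \<open>v\<close> a Neumann
  eigenfunction on the second, then \<open>\<nabla>(u \<otimes> v) = (\<nabla>u \<otimes> v, u \<otimes> \<nabla>v)\<close>, and for \<open>h = e \<otimes> f\<close> Fubini's theorem
  turns the energy form into
  \<open>\<langle>\<nabla>u, \<nabla>e\<rangle> \<langle>v, f\<rangle> + \<langle>u, e\<rangle> \<langle>\<nabla>v, \<nabla>f\<rangle>\<close>, which is the sum of the eigenvalues times \<open>\<langle>u \<otimes> v, e \<otimes> f\<rangle>\<close>.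
  Orthogonality in \<open>L\<^sup>2\<close> is inherited from the factors, and orthogonality for the energy form then
  follows by inserting one eigenfunction into the equation of another.

  Two points carry the work.  First, \<open>grad\<close> denotes an arbitrarily chosen weak gradient, so nothing can be
  computed before weak gradients are known to be unique almost everywhere (\<open>weak_gradient_unique\<close>).  This
  rests on the fundamental lemma of the calculus of variations, for which smooth compactly supported
  approximations to indicator functions of boxes are constructed.

  Second, the equation must hold for every \<open>h\<close> in the completed tensor product, and such an \<open>h\<close> is given
  only as an \<open>L\<^sup>2\<close>-convergent series with square-summable coefficients.  One has to show that it has a weak
  gradient at all, and that this is the limit of the gradients of the partial sums
  (\<open>V_space_L2_gradient\<close>).  The key estimate is that bounds on the synthesis operators of two families
  multiply under tensor products (\<open>L2_norm_tensor_lincomb_le\<close>).  For a family that is orthonormal in the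
  energy space of a factor, its derivatives obey such a bound by orthonormality; the undifferentiated
  Dirichlet functions need Poincare's inequality in addition.  The latter is read off the given
  eigenvalues, which have a positive lower bound (\<open>spectral_Poincare_inequality\<close>), by means of
  completeness of \<open>L\<^sup>2\<close>.
\<close>

section \<open>Smooth bump functions\<close>

text \<open>
  The recursion for \<open>Ck\<close> speaks of \<open>frechet_derivative\<close>; this form lets one exhibit the derivative
  explicitly, so that closure under products and compositions follows by induction on the order.
\<close>

lemma Ck_SucI:
  assumes "\<And>x. (f has_derivative f' x) (at x)" "\<And>i. i \<in> Basis \<Longrightarrow> Ck k (\<lambda>x. f' x i)"
  shows "Ck (Suc k) f"
proof -
  have "frechet_derivative f (at x) = f' x" for x
    using frechet_derivative_at[OF assms(1)] by simp
  then show ?thesis using assms by (auto simp: differentiable_def)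
qed

lemma Ck_Suc_imp_Ck: "Ck (Suc k) f \<Longrightarrow> Ck k f"
proof (induction k arbitrary: f)
  case 0
  then show ?case
    by (auto intro!: differentiable_imp_continuous_on simp: differentiable_on_def)
qed auto

lemma Ck_const: "Ck k (\<lambda>x. c)"
proof (induction k arbitrary: c)
  case (Suc k)
  show ?case by (rule Ck_SucI[where f'="\<lambda>x h. 0"]) (auto intro: Suc)
qed auto

lemma Ck_add: "Ck k f \<Longrightarrow> Ck k g \<Longrightarrow> Ck k (\<lambda>x. f x + g x)"
proof (induction k arbitrary: f g)
  case (Suc k)
  show ?case
    by (rule Ck_SucI[where f'="\<lambda>x h. frechet_derivative f (at x) h + frechet_derivative g (at x) h"])
      (use Suc in \<open>auto intro!: has_derivative_add simp: frechet_derivative_works[symmetric]\<close>)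
qed (auto intro: continuous_intros)

lemma Ck_mult: "Ck k f \<Longrightarrow> Ck k g \<Longrightarrow> Ck k (\<lambda>x. f x * g x)"
proof (induction k arbitrary: f g)
  case (Suc k)
  show ?case
    by (rule Ck_SucI[where
          f'="\<lambda>x h. f x * frechet_derivative g (at x) h + frechet_derivative f (at x) h * g x"])
      (use Suc Ck_Suc_imp_Ck[OF Suc.prems(1)] Ck_Suc_imp_Ck[OF Suc.prems(2)] in
        \<open>auto intro!: has_derivative_mult Ck_add simp: frechet_derivative_works[symmetric]\<close>)
qed (auto intro: continuous_intros)

lemma Ck_prod:
  assumes "finite I" "\<And>i. i \<in> I \<Longrightarrow> Ck k (f i)"
  shows "Ck k (\<lambda>x. \<Prod>i\<in>I. f i x)"
  using assms by (induction I rule: finite_induct) (auto intro: Ck_const Ck_mult)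

text \<open>
  Cauchy's flat function \<open>exp (- 1 / t)\<close>, extended by zero to \<open>t \<le> 0\<close>, together with a polynomial
  factor in \<open>1 / t\<close>.  With that factor the family is closed under differentiation, so one computation
  of a derivative yields smoothness.
\<close>

definition flat :: "real poly \<Rightarrow> real \<Rightarrow> real" where
  "flat p t = (if 0 < t then poly p (1 / t) * exp (- (1 / t)) else 0)"

lemma poly_times_exp_minus_tendsto_0:
  "((\<lambda>x. poly p x * exp (- x)) \<longlongrightarrow> (0::real)) at_top"
proof -
  have "((\<lambda>x. \<Sum>i\<le>degree p. coeff p i * (x ^ i / exp x)) \<longlongrightarrow> (\<Sum>i\<le>degree p. coeff p i * 0)) at_top"
    by (intro tendsto_intros tendsto_power_div_exp_0)
  then show ?thesis
    by (simp add: poly_altdef exp_minus sum_distrib_right divide_inverse mult.assoc)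
qed


text \<open>
  Away from the origin this is the chain rule.  At the origin the difference quotient from the right
  is again a polynomial in \<open>1 / t\<close> times \<open>exp (- 1 / t)\<close>, and the exponential wins.
\<close>

lemma flat_DERIV: "(flat p has_real_derivative flat ([:0, 0, 1:] * (p - pderiv p)) t) (at t)"
proof -
  consider "t > 0" | "t < 0" | "t = 0" by linarith
  then show ?thesis
  proof cases
    case 1
    have "((\<lambda>t. poly p (1 / t) * exp (- (1 / t))) has_real_derivative
        flat ([:0, 0, 1:] * (p - pderiv p)) t) (at t)"
      using 1 by (auto intro!: derivative_eq_intros DERIV_chain2[OF poly_DERIV]
          simp: flat_def field_simps power2_eq_square)
    then show ?thesis
      by (rule has_field_derivative_transform_within_open[where S="{0<..}"]) (use 1 in \<open>auto simp: flat_def\<close>)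
  next
    case 2
    have "((\<lambda>t. 0) has_real_derivative flat ([:0, 0, 1:] * (p - pderiv p)) t) (at t)"
      using 2 by (auto simp: flat_def)
    then show ?thesis
      by (rule has_field_derivative_transform_within_open[where S="{..<0}"]) (use 2 in \<open>auto simp: flat_def\<close>)
  next
    case 3
    have "((\<lambda>h. flat p h / h) \<longlongrightarrow> 0) (at_right 0)"
    proof -
      have "((\<lambda>x. poly (pCons 0 p) x * exp (- x)) \<longlongrightarrow> 0) at_top"
        by (rule poly_times_exp_minus_tendsto_0)
      then have "((\<lambda>h. poly (pCons 0 p) (inverse h) * exp (- inverse h)) \<longlongrightarrow> 0) (at_right 0)"
        by (simp add: filterlim_at_right_to_top)
      moreover have "\<forall>\<^sub>F h in at_right 0. poly (pCons 0 p) (inverse h) * exp (- inverse h) = flat p h / h"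
        using eventually_at_right_less[of 0] by eventually_elim (simp add: flat_def field_simps)
      ultimately show ?thesis by (rule Lim_transform_eventually)
    qed
    moreover have "((\<lambda>h. flat p h / h) \<longlongrightarrow> 0) (at_left 0)"
    proof -
      have "\<forall>\<^sub>F h in at_left 0. flat p h / h = 0"
        by (auto simp: eventually_at_filter flat_def)
      then show ?thesis by (rule tendsto_eventually)
    qed
    ultimately have "((\<lambda>h. flat p h / h) \<longlongrightarrow> 0) (at 0)"
      by (simp add: filterlim_split_at)
    then show ?thesis using 3 by (simp add: has_field_derivative_iff flat_def)
  qed
qed

lemma Ck_flat_affine: "Ck k (\<lambda>x. flat p (s * (x \<bullet> v) + c))"
proof (induction k arbitrary: p)
  case 0
  have "continuous_on UNIV (flat p)"
    by (meson flat_DERIV DERIV_isCont continuous_at_imp_continuous_on)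
  then have "continuous_on UNIV (flat p \<circ> (\<lambda>x. s * (x \<bullet> v) + c))"
    by (intro continuous_on_compose) (auto intro!: continuous_intros elim: continuous_on_subset)
  then show ?case by (simp add: o_def)
next
  case (Suc k)
  let ?q = "[:0, 0, 1:] * (p - pderiv p)"
  have "((\<lambda>x. flat p (s * (x \<bullet> v) + c)) has_derivative
      (\<lambda>h. (s * (h \<bullet> v)) * flat ?q (s * (x \<bullet> v) + c))) (at x)" for x
    by (rule DERIV_compose_FDERIV[OF flat_DERIV])
       (auto intro!: derivative_eq_intros)
  then show ?case
    by (rule Ck_SucI) (intro Ck_mult Ck_const Suc)
qed

text \<open>
  A smooth function that is positive exactly on the open box with corners \<open>a\<close> and \<open>b\<close>: each coordinate
  contributes one flat factor for its lower and one for its upper bound.  The steepness \<open>s\<close> drives the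
  function towards the indicator function of the box.
\<close>

definition bump :: "'a::euclidean_space \<Rightarrow> 'a \<Rightarrow> real \<Rightarrow> 'a \<Rightarrow> real" where
  "bump a b s x = (\<Prod>i\<in>Basis. flat 1 (s * (x \<bullet> i) + - (s * (a \<bullet> i))) * flat 1 (- s * (x \<bullet> i) + s * (b \<bullet> i)))"

lemma flat_1_bounds: "0 \<le> flat 1 t" "flat 1 t \<le> 1"
  by (auto simp: flat_def)

lemma bump_bounds: "0 \<le> bump a b s x" "bump a b s x \<le> 1"
  unfolding bump_def
  by (auto intro!: prod_nonneg prod_le_1 mult_nonneg_nonneg mult_le_one flat_1_bounds)

lemma bump_support: "0 < s \<Longrightarrow> {x. bump a b s x \<noteq> 0} = box a b"
  by (auto simp: bump_def flat_def box_def)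

lemma bump_tendsto_indicator: "(\<lambda>n. bump a b (real (Suc n)) x) \<longlonglongrightarrow> indicator (box a b) x"
proof (cases "x \<in> box a b")
  case True
  have lim: "(\<lambda>n. flat 1 (real (Suc n) * d)) \<longlonglongrightarrow> 1" if "d > 0" for d
  proof -
    have "(\<lambda>n. 1 / d * (1 / real (Suc n))) \<longlonglongrightarrow> 1 / d * 0"
      by (intro tendsto_intros LIMSEQ_Suc[OF lim_1_over_n])
    then have "(\<lambda>n. exp (- (1 / d * (1 / real (Suc n))))) \<longlonglongrightarrow> exp (- 0)"
      by (intro tendsto_intros) simp
    then show ?thesis using that by (simp add: flat_def field_simps del: of_nat_Suc)
  qed
  have "(\<lambda>n. \<Prod>i\<in>Basis. flat 1 (real (Suc n) * ((x - a) \<bullet> i)) * flat 1 (real (Suc n) * ((b - x) \<bullet> i)))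
      \<longlonglongrightarrow> (\<Prod>i\<in>(Basis::'a set). 1 * 1)"
    using True by (intro tendsto_intros lim) (auto simp: box_def inner_diff_left)
  then show ?thesis
    using True by (simp add: bump_def inner_diff_left algebra_simps del: of_nat_Suc)
next
  case False
  then have "bump a b (real (Suc n)) x = 0" for n
    using bump_support[of "real (Suc n)" a b] by auto
  with False show ?thesis by simp
qed

lemma test_function_bump:
  assumes "0 < s" "cbox a b \<subseteq> \<Omega>"
  shows "test_function \<Omega> (bump a b s)"
proof -
  have sub: "closure {x. bump a b s x \<noteq> 0} \<subseteq> cbox a b"
    using assms(1) closure_minimal[OF box_subset_cbox closed_cbox] by (simp add: bump_support)
  moreover have "compact (closure {x. bump a b s x \<noteq> 0})"
    using sub compact_cbox by (metis closed_closure compact_Int_closed inf.absorb_iff2)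
  moreover have "Ck k (bump a b s)" for k
    unfolding bump_def[abs_def] by (intro Ck_prod Ck_mult Ck_flat_affine) auto
  ultimately show ?thesis using assms(2) by (auto simp: test_function_def)
qed

section \<open>The fundamental lemma of the calculus of variations\<close>

lemma open_lebesgue_sets: "open S \<Longrightarrow> S \<in> sets lebesgue"
  by auto

lemma integral_lebesgue_on_eq:
  fixes f :: "'a::euclidean_space \<Rightarrow> real"
  assumes "S \<in> sets lebesgue"
  shows "(\<integral>x. f x \<partial>lebesgue_on S) = (\<integral>x. indicator S x * f x \<partial>lebesgue)"
  using assms by (subst integral_restrict_space) auto

text \<open>
  The indicator function of a box is the bounded pointwise limit of test functions, so dominated
  convergence carries the orthogonality over to it.
\<close>

lemma integral_box_eq_0_if_orthogonal_to_test_functions: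
  fixes f :: "'a::euclidean_space \<Rightarrow> real"
  assumes \<Omega>: "open \<Omega>" and sub: "cbox a b \<subseteq> \<Omega>"
    and int: "set_integrable lebesgue (cbox a b) f"
    and orth: "\<And>\<phi>. test_function \<Omega> \<phi> \<Longrightarrow> (\<integral>x. f x * \<phi> x \<partial>lebesgue_on \<Omega>) = 0"
  shows "(\<integral>x. indicator (box a b) x * f x \<partial>lebesgue) = 0"
proof -
  let ?F = "\<lambda>x. indicator (cbox a b) x * f x"
  let ?\<phi> = "\<lambda>n. bump a b (real (Suc n))"
  have F: "integrable lebesgue ?F" using int by (simp add: set_integrable_def)
  have supp: "x \<notin> cbox a b \<Longrightarrow> ?\<phi> n x = 0" for x n
    using bump_support[of "real (Suc n)" a b] box_subset_cbox[of a b] by auto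
  have cont: "continuous_on UNIV (?\<phi> n)" for n
  proof -
    have "Ck 0 (?\<phi> n)"
      using test_function_bump[OF _ sub, of "real (Suc n)"] unfolding test_function_def by simp
    then show ?thesis by simp
  qed
  have meas: "?\<phi> n \<in> borel_measurable lebesgue" for n
    by (intro measurable_completion) (use borel_measurable_continuous_onI[OF cont] in simp)
  have "(\<lambda>n. \<integral>x. ?F x * ?\<phi> n x \<partial>lebesgue) \<longlonglongrightarrow> (\<integral>x. ?F x * indicator (box a b) x \<partial>lebesgue)"
  proof (rule integral_dominated_convergence[where w="\<lambda>x. norm (?F x)"])
    show "integrable lebesgue (\<lambda>x. norm (?F x))" using F by (rule integrable_norm)
    show "AE x in lebesgue. (\<lambda>n. ?F x * ?\<phi> n x) \<longlonglongrightarrow> ?F x * indicator (box a b) x"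
      by (intro AE_I2 tendsto_intros bump_tendsto_indicator)
    show "AE x in lebesgue. norm (?F x * ?\<phi> n x) \<le> norm (?F x)" for n
      using bump_bounds[of a b "real (Suc n)"]
      by (intro AE_I2) (auto simp: abs_mult intro!: mult_left_le)
    show "(\<lambda>x. ?F x * ?\<phi> n x) \<in> borel_measurable lebesgue" for n
      by (rule borel_measurable_times[OF borel_measurable_integrable[OF F] meas])
    show "(\<lambda>x. ?F x * indicator (box a b) x) \<in> borel_measurable lebesgue"
      by (rule borel_measurable_times[OF borel_measurable_integrable[OF F]])
         (intro borel_measurable_indicator open_lebesgue_sets open_box)
  qed
  moreover have "(\<integral>x. ?F x * ?\<phi> n x \<partial>lebesgue) = 0" for n
  proof -
    have "(\<integral>x. ?F x * ?\<phi> n x \<partial>lebesgue) = (\<integral>x. indicator \<Omega> x * (f x * ?\<phi> n x) \<partial>lebesgue)"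
      using sub supp by (intro Bochner_Integration.integral_cong) (auto simp: indicator_def)
    also have "\<dots> = 0"
      using orth[OF test_function_bump[OF _ sub, of "real (Suc n)"]] \<Omega>
      by (simp add: integral_lebesgue_on_eq open_lebesgue_sets)
    finally show ?thesis .
  qed
  ultimately have "(\<integral>x. ?F x * indicator (box a b) x \<partial>lebesgue) = 0"
    by (simp add: LIMSEQ_const_iff)
  moreover have "?F x * indicator (box a b) x = indicator (box a b) x * f x" for x
    using box_subset_cbox[of a b] by (auto simp: indicator_def)
  ultimately show ?thesis by simp
qed

text \<open>
  Boxes form an intersection-stable generator of the Borel sets, so by Dynkin's theorem the integral
  of \<open>F\<close> vanishes over every Borel set.  Hence a Borel representative of \<open>F\<close> vanishes almost everywhere.
\<close>

lemma AE_eq_0_if_box_integrals_eq_0: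
  fixes F :: "'a::euclidean_space \<Rightarrow> real"
  assumes F: "integrable lebesgue F" and F0: "(\<integral>x. F x \<partial>lebesgue) = 0"
    and boxes: "\<And>a b. (\<integral>x. indicator (box a b) x * F x \<partial>lebesgue) = 0"
  shows "AE x in lebesgue. F x = 0"
proof -
  have int: "set_integrable lebesgue A F" if "A \<in> sets borel" for A
    using F that by (simp add: set_integrable_def integrable_mult_indicator del: real_scaleR_def)
  let ?G = "range (\<lambda>(a, b). box a b :: 'a set)"
  have borel: "sets (borel :: 'a measure) = sigma_sets UNIV ?G"
    by (simp add: borel_eq_box)
  have zero: "(LINT x:A|lebesgue. F x) = 0" if "A \<in> sets borel" for A
  proof -
    have "Int_stable ?G"
      by (auto simp: Int_stable_def box_Int_box)
    moreover have "?G \<subseteq> Pow UNIV" by simp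
    moreover have "A \<in> sigma_sets UNIV ?G" using that borel by simp
    ultimately show ?thesis
    proof (induction rule: sigma_sets_induct_disjoint)
      case (basic A)
      then show ?case using boxes by (auto simp: set_lebesgue_integral_def)
    next
      case empty
      show ?case by (simp add: set_lebesgue_integral_def)
    next
      case (compl A)
      then have A: "A \<in> sets borel" by (simp add: borel)
      have "(LINT x:UNIV - A|lebesgue. F x) = (\<integral>x. F x - indicator A x *\<^sub>R F x \<partial>lebesgue)"
        unfolding set_lebesgue_integral_def
        by (intro Bochner_Integration.integral_cong) (auto simp: indicator_def)
      also have "\<dots> = (\<integral>x. F x \<partial>lebesgue) - (LINT x:A|lebesgue. F x)"
        unfolding set_lebesgue_integral_def
        using F int[OF A] by (intro Bochner_Integration.integral_diff) (auto simp: set_integrable_def)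
      finally show ?case using compl F0 by simp
    next
      case (union A)
      then have A: "A i \<in> sets borel" for i by (auto simp: borel)
      have "(LINT x:(\<Union>i. A i)|lebesgue. F x) = (\<Sum>i. LINT x:A i|lebesgue. F x)"
        by (rule lebesgue_integral_countable_add)
           (use A union in \<open>auto simp: disjoint_family_on_def intro!: int\<close>)
      then show ?case using union by simp
    qed
  qed
  obtain F' where F': "F' \<in> borel_measurable lborel" "AE x in lborel. F x = F' x"
    using completion_ex_borel_measurable_real[of F lborel] F by auto
  have AE: "AE x in lebesgue. F x = F' x" using F'(2) by (rule AE_completion)
  have F'leb: "F' \<in> borel_measurable lebesgue" using F'(1) by (rule measurable_completion)
  have "AE x in lborel. F' x = 0"
  proof (rule sigma_finite_measure.density_zero[OF sigma_finite_lborel])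
    have "integrable lebesgue F'"
      using F AE F'leb by (subst integrable_cong_AE[where g=F]) auto
    then show "integrable lborel F'" using F'(1) by (simp add: integrable_completion)
    show "(LINT x:A|lborel. F' x) = 0" if "A \<in> sets lborel" for A
    proof -
      have A: "A \<in> sets borel" using that by simp
      have "(LINT x:A|lborel. F' x) = (LINT x:A|lebesgue. F' x)"
        unfolding set_lebesgue_integral_def using F'(1) A
        by (subst integral_completion) auto
      also have "\<dots> = (LINT x:A|lebesgue. F x)"
        unfolding set_lebesgue_integral_def using F'leb A AE borel_measurable_integrable[OF F]
        by (intro integral_cong_AE borel_measurable_scaleR borel_measurable_indicator) auto
      finally show ?thesis using zero[OF A] by simp
    qed
  qed
  then have "AE x in lebesgue. F' x = 0" by (rule AE_completion)
  with AE show ?thesis by eventually_elim simp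
qed

text \<open>
  This is what makes weak gradients unique.  An open set is a countable union of closed boxes, so it
  suffices to treat one box, where the function is integrable.
\<close>

lemma fundamental_lemma_of_calculus_of_variations:
  fixes f :: "'a::euclidean_space \<Rightarrow> real"
  assumes \<Omega>: "open \<Omega>"
    and int: "\<And>K. compact K \<Longrightarrow> K \<subseteq> \<Omega> \<Longrightarrow> set_integrable lebesgue K f"
    and orth: "\<And>\<phi>. test_function \<Omega> \<phi> \<Longrightarrow> (\<integral>x. f x * \<phi> x \<partial>lebesgue_on \<Omega>) = 0"
  shows "AE x in lebesgue_on \<Omega>. f x = 0"
proof -
  have cbox0: "AE x in lebesgue. x \<in> cbox c d \<longrightarrow> f x = 0" if sub: "cbox c d \<subseteq> \<Omega>" for c d
  proof -
    let ?F = "\<lambda>x. indicator (box c d) x * f x"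
    have box0: "(\<integral>x. indicator (box a b) x * ?F x \<partial>lebesgue) = 0" for a b
    proof -
      \<comment> \<open>The intersection of the two open boxes is the box with corners \<open>?p\<close> and \<open>?q\<close>.\<close>
      let ?p = "\<Sum>i\<in>Basis. max (a\<bullet>i) (c\<bullet>i) *\<^sub>R i" and ?q = "\<Sum>i\<in>Basis. min (b\<bullet>i) (d\<bullet>i) *\<^sub>R i"
      have "cbox ?p ?q \<subseteq> \<Omega>" using sub by (auto simp: mem_box)
      then have "(\<integral>x. indicator (box ?p ?q) x * f x \<partial>lebesgue) = 0"
        by (intro integral_box_eq_0_if_orthogonal_to_test_functions[OF \<Omega>] int orth) auto
      moreover have "indicator (box ?p ?q) x * f x = indicator (box a b) x * ?F x" for x
        by (simp flip: box_Int_box add: indicator_inter_arith)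
      ultimately show ?thesis by simp
    qed
    have "set_integrable lebesgue (box c d) f"
      by (rule set_integrable_subset[OF int[OF compact_cbox sub] open_lebesgue_sets[OF open_box] box_subset_cbox])
    then have F: "integrable lebesgue ?F" by (simp add: set_integrable_def)
    have "AE x in lebesgue. ?F x = 0"
    proof (rule AE_eq_0_if_box_integrals_eq_0[OF F _ box0])
      have "(\<lambda>x. indicator (box c d) x * ?F x) = ?F" by (auto simp: indicator_def)
      then show "integral\<^sup>L lebesgue ?F = 0" using box0[of c d] by simp
    qed
    \<comment> \<open>The open boxes above miss the frontier, which is a null set.\<close>
    moreover have "AE x in lebesgue. x \<notin> cbox c d - box c d"
      using negligible_frontier_interval[of c d] by (intro AE_not_in) (simp add: negligible_iff_null_sets)
    ultimately show ?thesis by eventually_elim (auto simp: indicator_def split: if_splits)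
  qed
  obtain C where C: "countable C" "C \<subseteq> Pow \<Omega>" "\<And>S. S \<in> C \<Longrightarrow> \<exists>a b. S = cbox a b" "\<Union>C = \<Omega>"
    using open_countable_Union_open_cbox[OF \<Omega>] by blast
  have "AE x in lebesgue. x \<in> S \<longrightarrow> f x = 0" if S: "S \<in> C" for S
  proof -
    obtain c d where "S = cbox c d" using C(3)[OF S] by blast
    then show ?thesis using cbox0 C(2) S by blast
  qed
  then have "AE x in lebesgue. \<forall>S\<in>C. x \<in> S \<longrightarrow> f x = 0"
    by (subst AE_ball_countable[OF C(1)]) blast
  then have "AE x in lebesgue. x \<in> \<Omega> \<longrightarrow> f x = 0"
    by eventually_elim (use C(4) in auto)
  then show ?thesis using \<Omega> by (subst AE_restrict_space_iff) auto
qed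

section \<open>Square-integrable functions\<close>

lemma Lp_2_iff: "f \<in> Lp M 2 \<longleftrightarrow> f \<in> borel_measurable M \<and> integrable M (\<lambda>x. (f x)\<^sup>2)"
  by (simp add: Lp_def)

lemma Lp_norm_2: "Lp_norm M 2 f = sqrt (L2_inner M f f)"
  by (simp add: Lp_norm_def L2_inner_def powr_half_sqrt power2_eq_square)

lemma Lp_2_measurable: "f \<in> Lp M 2 \<Longrightarrow> f \<in> borel_measurable M"
  by (simp add: Lp_2_iff)

lemma Lp_2_times_integrable:
  assumes "f \<in> Lp M 2" "g \<in> Lp M 2"
  shows "integrable M (\<lambda>x. f x * g x)"
proof (rule Bochner_Integration.integrable_bound)
  show "integrable M (\<lambda>x. (f x)\<^sup>2 + (g x)\<^sup>2)" using assms by (simp add: Lp_2_iff)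
  show "(\<lambda>x. f x * g x) \<in> borel_measurable M"
    using assms by (intro borel_measurable_times) (auto simp: Lp_2_iff)
  have "\<bar>a * b\<bar> \<le> a\<^sup>2 + b\<^sup>2" for a b :: real
    using sum_squares_bound[of "\<bar>a\<bar>" "\<bar>b\<bar>"] mult_nonneg_nonneg[of "\<bar>a\<bar>" "\<bar>b\<bar>"] unfolding abs_mult power2_abs by linarith
  then show "AE x in M. norm (f x * g x) \<le> norm ((f x)\<^sup>2 + (g x)\<^sup>2)" by simp
qed

lemma Lp_2_I:
  assumes "f \<in> borel_measurable M" "integrable M (\<lambda>x. f x * f x)"
  shows "f \<in> Lp M 2"
  using assms by (simp add: Lp_2_iff power2_eq_square)

lemma Lp_2_add:
  assumes "f \<in> Lp M 2" "g \<in> Lp M 2"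
  shows "(\<lambda>x. f x + g x) \<in> Lp M 2"
proof (rule Lp_2_I)
  have "integrable M (\<lambda>x. f x * f x + f x * g x + (f x * g x + g x * g x))"
    using assms by (intro Bochner_Integration.integrable_add Lp_2_times_integrable)
  then show "integrable M (\<lambda>x. (f x + g x) * (f x + g x))" by (simp add: algebra_simps)
qed (use assms in \<open>auto simp: Lp_2_iff intro!: borel_measurable_add\<close>)

lemma Lp_2_cmult: "f \<in> Lp M 2 \<Longrightarrow> (\<lambda>x. c * f x) \<in> Lp M 2"
  by (auto simp: Lp_2_iff power_mult_distrib intro!: borel_measurable_times)

lemma Lp_2_diff:
  assumes "f \<in> Lp M 2" "g \<in> Lp M 2"
  shows "(\<lambda>x. f x - g x) \<in> Lp M 2"
  using Lp_2_add[OF assms(1) Lp_2_cmult[OF assms(2), of "-1"]] by simp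

lemma Lp_2_lincomb:
  assumes "\<And>i. i \<in> I \<Longrightarrow> f i \<in> Lp M 2"
  shows "(\<lambda>x. \<Sum>i\<in>I. a i * f i x) \<in> Lp M 2"
  using assms
proof (induction I rule: infinite_finite_induct)
  case (insert i I)
  then show ?case by (auto intro!: Lp_2_add Lp_2_cmult)
qed (auto simp: Lp_2_iff)

lemma Lp_2_cong_AE:
  assumes "f \<in> Lp M 2" "g \<in> borel_measurable M" "AE x in M. f x = g x"
  shows "g \<in> Lp M 2"
proof (rule Lp_2_I)
  have "integrable M (\<lambda>x. f x * f x)" by (intro Lp_2_times_integrable assms)
  then show "integrable M (\<lambda>x. g x * g x)"
  proof (rule integrable_cong_AE_imp)
    show "AE x in M. f x * f x = g x * g x" using assms(3) by eventually_elim simp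
  qed (use assms(2) in \<open>auto intro!: borel_measurable_times\<close>)
qed (use assms in auto)

lemma L2_inner_commute: "L2_inner M f g = L2_inner M g f"
  by (simp add: L2_inner_def mult.commute)

lemma L2_inner_self_nonneg: "0 \<le> L2_inner M f f"
  by (simp add: L2_inner_def)

lemma L2_inner_cmult_left: "L2_inner M (\<lambda>x. c * f x) g = c * L2_inner M f g"
  by (simp add: L2_inner_def mult.assoc)

lemma L2_inner_cmult_right: "L2_inner M f (\<lambda>x. c * g x) = c * L2_inner M f g"
  using L2_inner_cmult_left L2_inner_commute by metis

lemma L2_inner_add_left:
  assumes "f \<in> Lp M 2" "g \<in> Lp M 2" "h \<in> Lp M 2"
  shows "L2_inner M (\<lambda>x. f x + g x) h = L2_inner M f h + L2_inner M g h"
  using assms by (simp add: L2_inner_def distrib_right Lp_2_times_integrable)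

lemma L2_inner_diff_left:
  assumes "f \<in> Lp M 2" "g \<in> Lp M 2" "h \<in> Lp M 2"
  shows "L2_inner M (\<lambda>x. f x - g x) h = L2_inner M f h - L2_inner M g h"
  using assms by (simp add: L2_inner_def left_diff_distrib Lp_2_times_integrable)

lemma L2_inner_diff_right:
  assumes "f \<in> Lp M 2" "g \<in> Lp M 2" "h \<in> Lp M 2"
  shows "L2_inner M h (\<lambda>x. f x - g x) = L2_inner M h f - L2_inner M h g"
  using L2_inner_diff_left[OF assms] by (simp add: L2_inner_commute)

lemma L2_inner_lincomb_left:
  assumes "\<And>i. i \<in> I \<Longrightarrow> f i \<in> Lp M 2" "g \<in> Lp M 2"
  shows "L2_inner M (\<lambda>x. \<Sum>i\<in>I. a i * f i x) g = (\<Sum>i\<in>I. a i * L2_inner M (f i) g)"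
  using assms(1)
proof (induction I rule: infinite_finite_induct)
  case (insert i I)
  then show ?case
    using assms(2) by (simp add: L2_inner_add_left Lp_2_lincomb Lp_2_cmult L2_inner_cmult_left)
qed (auto simp: L2_inner_def)

lemma L2_inner_lincomb_right:
  assumes "\<And>i. i \<in> I \<Longrightarrow> f i \<in> Lp M 2" "g \<in> Lp M 2"
  shows "L2_inner M g (\<lambda>x. \<Sum>i\<in>I. a i * f i x) = (\<Sum>i\<in>I. a i * L2_inner M g (f i))"
  using L2_inner_lincomb_left[OF assms] by (simp add: L2_inner_commute)

lemma L2_inner_lincomb_lincomb:
  assumes "\<And>i. i \<in> I \<Longrightarrow> f i \<in> Lp M 2" "\<And>j. j \<in> J \<Longrightarrow> g j \<in> Lp M 2"
  shows "L2_inner M (\<lambda>x. \<Sum>i\<in>I. a i * f i x) (\<lambda>x. \<Sum>j\<in>J. b j * g j x) =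
    (\<Sum>i\<in>I. \<Sum>j\<in>J. a i * b j * L2_inner M (f i) (g j))"
  using assms by (simp add: L2_inner_lincomb_left L2_inner_lincomb_right Lp_2_lincomb
      sum_distrib_left mult.assoc)

lemma L2_inner_cong_AE:
  assumes "f \<in> Lp M 2" "g \<in> Lp M 2" "f' \<in> borel_measurable M" "g' \<in> borel_measurable M"
    "AE x in M. f x = f' x" "AE x in M. g x = g' x"
  shows "L2_inner M f g = L2_inner M f' g'"
  unfolding L2_inner_def
proof (rule integral_cong_AE)
  show "AE x in M. f x * g x = f' x * g' x"
    using assms(5,6) by eventually_elim simp
qed (rule borel_measurable_times; use assms in \<open>simp add: Lp_2_measurable\<close>)+

lemma L2_Cauchy_Schwarz:
  assumes f: "f \<in> Lp M 2" and g: "g \<in> Lp M 2"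
  shows "(L2_inner M f g)\<^sup>2 \<le> L2_inner M f f * L2_inner M g g"
proof -
  let ?a = "L2_inner M f f" and ?b = "L2_inner M f g" and ?c = "L2_inner M g g"
  \<comment> \<open>The squared norm of \<open>f - t g\<close> is a nonnegative quadratic polynomial in \<open>t\<close>, so its
     discriminant is not positive.\<close>
  have quad: "0 \<le> ?a - 2 * t * ?b + t\<^sup>2 * ?c" for t
  proof -
    have d: "(\<lambda>x. f x - t * g x) \<in> Lp M 2" and tg: "(\<lambda>x. t * g x) \<in> Lp M 2"
      using f g by (auto intro: Lp_2_diff Lp_2_cmult)
    have "0 \<le> L2_inner M (\<lambda>x. f x - t * g x) (\<lambda>x. f x - t * g x)" by (rule L2_inner_self_nonneg)
    also have "\<dots> = ?a - t * ?b - (t * ?b - t * (t * ?c))"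
      by (simp only: L2_inner_diff_left[OF f tg d] L2_inner_diff_right[OF f tg f] L2_inner_diff_right[OF f tg tg]
          L2_inner_cmult_left L2_inner_cmult_right L2_inner_commute[of M g f]
          L2_inner_diff_right[OF f tg g] right_diff_distrib)
    also have "\<dots> = ?a - 2 * t * ?b + t\<^sup>2 * ?c"
      by (simp add: power2_eq_square algebra_simps)
    finally show ?thesis .
  qed
  show ?thesis
  proof (cases "?c = 0")
    case True
    have "?b = 0"
    proof (rule ccontr)
      assume "?b \<noteq> 0"
      then have "2 * ((?a + 1) / (2 * ?b)) * ?b = ?a + 1" by simp
      then show False using quad[of "(?a + 1) / (2 * ?b)"] True by simp
    qed
    then show ?thesis using True by simp
  next
    case False
    then have pos: "?c > 0" using L2_inner_self_nonneg[of M g] by linarith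
    have alg: "c * (a - 2 * (b / c) * b + (b / c)\<^sup>2 * c) = a * c - b\<^sup>2" if "c \<noteq> 0" for a b c :: real
      using that by (simp add: field_simps power2_eq_square)
    have "0 \<le> ?c * (?a - 2 * (?b / ?c) * ?b + (?b / ?c)\<^sup>2 * ?c)"
      using pos quad[of "?b / ?c"] by (intro mult_nonneg_nonneg) auto
    then show ?thesis unfolding alg[OF False] by simp
  qed
qed

lemma L2_inner_tendsto:
  assumes F: "\<And>n. F n \<in> Lp M 2" and f: "f \<in> Lp M 2" and g: "g \<in> Lp M 2"
    and lim: "(\<lambda>n. L2_inner M (\<lambda>x. F n x - f x) (\<lambda>x. F n x - f x)) \<longlonglongrightarrow> 0"
  shows "(\<lambda>n. L2_inner M (F n) g) \<longlonglongrightarrow> L2_inner M f g"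
proof -
  let ?d = "\<lambda>n. L2_inner M (\<lambda>x. F n x - f x) (\<lambda>x. F n x - f x)"
  have lim0: "(\<lambda>n. sqrt (?d n * L2_inner M g g)) \<longlonglongrightarrow> sqrt (0 * L2_inner M g g)"
    by (intro tendsto_intros lim)
  have bound: "norm (L2_inner M (F n) g - L2_inner M f g) \<le> sqrt (?d n * L2_inner M g g)" for n
  proof -
    have "(L2_inner M (F n) g - L2_inner M f g)\<^sup>2 \<le> ?d n * L2_inner M g g"
      using L2_Cauchy_Schwarz[OF Lp_2_diff[OF F[of n] f] g] F f g by (simp add: L2_inner_diff_left)
    then show ?thesis unfolding real_norm_def by (intro real_le_rsqrt) simp
  qed
  have "(\<lambda>n. L2_inner M (F n) g - L2_inner M f g) \<longlonglongrightarrow> 0"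
    by (rule Lim_null_comparison[OF always_eventually[OF allI[OF bound]]]) (use lim0 in simp)
  then show ?thesis by (rule LIM_zero_cancel)
qed

lemma Lp_2_imp_integrable:
  assumes "finite_measure M" "f \<in> Lp M 2"
  shows "integrable M f"
proof -
  have "(\<lambda>x. 1) \<in> Lp M 2" using assms(1) by (simp add: Lp_2_iff finite_measure.integrable_const)
  from Lp_2_times_integrable[OF assms(2) this] show ?thesis by simp
qed

lemma L1_norm_le_L2_norm:
  assumes M: "finite_measure M" and f: "f \<in> Lp M 2"
  shows "(\<integral>x. \<bar>f x\<bar> \<partial>M)\<^sup>2 \<le> L2_inner M f f * measure M (space M)"
proof -
  have "(\<lambda>x. 1) \<in> Lp M 2" using M by (simp add: Lp_2_iff finite_measure.integrable_const)
  moreover have "(\<lambda>x. \<bar>f x\<bar>) \<in> Lp M 2" using f by (auto simp: Lp_2_iff intro: borel_measurable_abs)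
  ultimately show ?thesis
    using L2_Cauchy_Schwarz[of "\<lambda>x. \<bar>f x\<bar>" M "\<lambda>x. 1"] by (simp add: L2_inner_def abs_mult[symmetric])
qed

text \<open>
  The Riesz--Fischer theorem.  On a finite measure space an \<open>L\<^sup>2\<close>-Cauchy sequence is also
  \<open>L\<^sup>1\<close>-Cauchy, hence converges almost everywhere along a subsequence; Fatou's lemma identifies the
  pointwise limit as the limit in \<open>L\<^sup>2\<close>.
\<close>

lemma L2_complete:
  fixes F :: "nat \<Rightarrow> 'a \<Rightarrow> real"
  assumes M: "finite_measure M" and F: "\<And>n. F n \<in> Lp M 2"
    and Cauchy: "\<And>\<epsilon>. 0 < \<epsilon> \<Longrightarrow>
      \<exists>N. \<forall>m\<ge>N. \<forall>n\<ge>N. L2_inner M (\<lambda>x. F m x - F n x) (\<lambda>x. F m x - F n x) < \<epsilon>"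
  obtains f where "f \<in> Lp M 2"
    "(\<lambda>n. L2_inner M (\<lambda>x. F n x - f x) (\<lambda>x. F n x - f x)) \<longlonglongrightarrow> 0"
proof -
  let ?c = "measure M (space M)"
  have meas [measurable]: "F n \<in> borel_measurable M" for n using F by (rule Lp_2_measurable)
  have L1: "\<exists>N. \<forall>m\<ge>N. \<forall>n\<ge>N. (\<integral>x. norm (F m x - F n x) \<partial>M) < \<epsilon>" if "0 < \<epsilon>" for \<epsilon>
  proof -
    \<comment> \<open>The summand \<open>1\<close> keeps the quotient meaningful on a null space.\<close>
    have pos: "0 < \<epsilon>\<^sup>2 / (?c + 1)" using that by (simp add: add_nonneg_pos)
    then obtain N where N: "\<And>m n. m \<ge> N \<Longrightarrow> n \<ge> N \<Longrightarrow>
        L2_inner M (\<lambda>x. F m x - F n x) (\<lambda>x. F m x - F n x) < \<epsilon>\<^sup>2 / (?c + 1)"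
      using Cauchy by metis
    have "(\<integral>x. norm (F m x - F n x) \<partial>M) < \<epsilon>" if mn: "m \<ge> N" "n \<ge> N" for m n
    proof -
      have "(\<integral>x. \<bar>F m x - F n x\<bar> \<partial>M)\<^sup>2 \<le>
          L2_inner M (\<lambda>x. F m x - F n x) (\<lambda>x. F m x - F n x) * ?c"
        by (intro L1_norm_le_L2_norm M Lp_2_diff F)
      also have "\<dots> \<le> \<epsilon>\<^sup>2 / (?c + 1) * ?c"
        using N[OF mn] by (intro mult_right_mono) auto
      also have "\<dots> < \<epsilon>\<^sup>2"
        using \<open>0 < \<epsilon>\<close> measure_nonneg[of M "space M"]
        by (simp add: pos_divide_less_eq add_nonneg_pos distrib_left)
      finally show ?thesis
        using \<open>0 < \<epsilon>\<close> by (simp add: power2_less_imp_less)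
    qed
    then show ?thesis by blast
  qed
  obtain r where r: "strict_mono r" and rC: "AE x in M. Cauchy (\<lambda>k. F (r k) x)"
    using cauchy_L1_AE_cauchy_subseq[OF Lp_2_imp_integrable[OF M F] L1] by blast
  define f where "f x = lim (\<lambda>k. F (r k) x)" for x
  have [measurable]: "f \<in> borel_measurable M" unfolding f_def by measurable
  have conv: "AE x in M. (\<lambda>k. F (r k) x) \<longlonglongrightarrow> f x"
    using rC by eventually_elim (simp add: f_def Cauchy_convergent_iff convergent_LIMSEQ_iff)
  have bound: "\<exists>N. \<forall>n\<ge>N. (\<integral>\<^sup>+x. ennreal ((F n x - f x)\<^sup>2) \<partial>M) \<le> ennreal \<epsilon>" if \<epsilon>: "0 < \<epsilon>" for \<epsilon>
  proof -
    obtain N where N: "\<And>m n. m \<ge> N \<Longrightarrow> n \<ge> N \<Longrightarrow>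
        L2_inner M (\<lambda>x. F m x - F n x) (\<lambda>x. F m x - F n x) < \<epsilon>"
      using Cauchy[OF \<epsilon>] by metis
    have "(\<integral>\<^sup>+x. ennreal ((F n x - f x)\<^sup>2) \<partial>M) \<le> ennreal \<epsilon>" if n: "n \<ge> N" for n
    proof -
      have "(\<integral>\<^sup>+x. ennreal ((F n x - f x)\<^sup>2) \<partial>M) =
          (\<integral>\<^sup>+x. liminf (\<lambda>k. ennreal ((F n x - F (r k) x)\<^sup>2)) \<partial>M)"
      proof (rule nn_integral_cong_AE)
        show "AE x in M. ennreal ((F n x - f x)\<^sup>2) = liminf (\<lambda>k. ennreal ((F n x - F (r k) x)\<^sup>2))"
          using conv
        proof eventually_elim
          case (elim x)
          have "(\<lambda>k. ennreal ((F n x - F (r k) x)\<^sup>2)) \<longlonglongrightarrow> ennreal ((F n x - f x)\<^sup>2)"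
            by (intro tendsto_ennrealI tendsto_intros elim)
          then show ?case by (rule lim_imp_Liminf[OF trivial_limit_sequentially, symmetric])
        qed
      qed
      also have "\<dots> \<le> liminf (\<lambda>k. \<integral>\<^sup>+x. ennreal ((F n x - F (r k) x)\<^sup>2) \<partial>M)"
        by (rule nn_integral_liminf) measurable
      also have "\<dots> \<le> ennreal \<epsilon>"
      proof (rule Liminf_le)
        show "\<forall>\<^sub>F k in sequentially. (\<integral>\<^sup>+x. ennreal ((F n x - F (r k) x)\<^sup>2) \<partial>M) \<le> ennreal \<epsilon>"
          using eventually_ge_at_top[of N]
        proof eventually_elim
          case (elim k)
          then have "r k \<ge> N" using seq_suble[OF r, of k] by linarith
          have d: "(\<lambda>x. F n x - F (r k) x) \<in> Lp M 2" by (intro Lp_2_diff F)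
          have "(\<integral>\<^sup>+x. ennreal ((F n x - F (r k) x)\<^sup>2) \<partial>M) =
              ennreal (L2_inner M (\<lambda>x. F n x - F (r k) x) (\<lambda>x. F n x - F (r k) x))"
            using d by (simp add: L2_inner_def Lp_2_iff nn_integral_eq_integral power2_eq_square)
          then show ?case using N[OF n \<open>r k \<ge> N\<close>] by (simp add: ennreal_leI)
        qed
      qed simp
      finally show ?thesis .
    qed
    then show ?thesis by blast
  qed
  have int: "(\<lambda>x. F n x - f x) \<in> Lp M 2 \<and> L2_inner M (\<lambda>x. F n x - f x) (\<lambda>x. F n x - f x) \<le> \<epsilon>"
    if b: "(\<integral>\<^sup>+x. ennreal ((F n x - f x)\<^sup>2) \<partial>M) \<le> ennreal \<epsilon>" and \<epsilon>: "0 < \<epsilon>" for n \<epsilon>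
  proof -
    have i: "integrable M (\<lambda>x. (F n x - f x)\<^sup>2)"
      by (rule integrableI_bounded) (use b in \<open>auto intro: le_less_trans\<close>)
    then have "ennreal (\<integral>x. (F n x - f x)\<^sup>2 \<partial>M) \<le> ennreal \<epsilon>"
      using b by (simp add: nn_integral_eq_integral)
    then show ?thesis
      using i \<epsilon> by (simp add: Lp_2_iff L2_inner_def power2_eq_square)
  qed
  show ?thesis
  proof
    obtain N where "(\<lambda>x. F N x - f x) \<in> Lp M 2" using bound[of 1] int[of _ 1] by auto
    from Lp_2_diff[OF F[of N] this] show "f \<in> Lp M 2" by simp
    show "(\<lambda>n. L2_inner M (\<lambda>x. F n x - f x) (\<lambda>x. F n x - f x)) \<longlonglongrightarrow> 0"
    proof (rule LIMSEQ_I)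
      fix \<epsilon> :: real assume \<epsilon>: "0 < \<epsilon>"
      then obtain N where N: "\<And>n. n \<ge> N \<Longrightarrow> (\<integral>\<^sup>+x. ennreal ((F n x - f x)\<^sup>2) \<partial>M) \<le> ennreal (\<epsilon> / 2)"
        using bound[of "\<epsilon> / 2"] by auto
      have "norm (L2_inner M (\<lambda>x. F n x - f x) (\<lambda>x. F n x - f x) - 0) < \<epsilon>" if "n \<ge> N" for n
        using int[OF N[OF that]] \<epsilon> L2_inner_self_nonneg[of M "\<lambda>x. F n x - f x"] by simp
      then show "\<exists>N. \<forall>n\<ge>N. norm (L2_inner M (\<lambda>x. F n x - f x) (\<lambda>x. F n x - f x) - 0) < \<epsilon>"
        by blast
    qed
  qed
qed

lemma L2_norm_eq_0_imp_AE:
  assumes "f \<in> Lp M 2" "L2_inner M f f = 0"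
  shows "AE x in M. f x = 0"
  using assms integral_nonneg_eq_0_iff_AE[of M "\<lambda>x. (f x)\<^sup>2"]
  by (simp add: Lp_2_iff L2_inner_def power2_eq_square)

text \<open>
  A maximal orthonormal family satisfies Parseval's identity: the Fourier series of \<open>v\<close> converges by
  completeness, and its limit has the same coefficients as \<open>v\<close>, so maximality forces the two to agree.
\<close>

lemma L2_norm_le_if_coefficients_bounded:
  assumes M: "finite_measure M"
    and e: "orthonormal_basis (Lp M 2) (L2_inner M) e"
    and v: "v \<in> Lp M 2"
    and bound: "\<And>n. (\<Sum>j<n. (L2_inner M v (e j))\<^sup>2) \<le> B"
  shows "L2_inner M v v \<le> B"
proof -
  let ?a = "\<lambda>j. L2_inner M v (e j)"
  define S where "S n x = (\<Sum>j<n. ?a j * e j x)" for n x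
  have eL: "e j \<in> Lp M 2" and orth: "L2_inner M (e i) (e j) = (if i = j then 1 else 0)" for i j
    using e by (auto simp: orthonormal_basis_def)
  have maximal: "L2_inner M w w = 0" if "w \<in> Lp M 2" "\<And>j. L2_inner M w (e j) = 0" for w
    using e that by (auto simp: orthonormal_basis_def)
  have SL: "S n \<in> Lp M 2" for n unfolding S_def[abs_def] by (intro Lp_2_lincomb eL)
  have lincomb: "L2_inner M (\<lambda>x. \<Sum>j\<in>J. b j * e j x) (\<lambda>x. \<Sum>j\<in>J. b j * e j x) = (\<Sum>j\<in>J. (b j)\<^sup>2)"
    if "finite J" for J and b :: "nat \<Rightarrow> real"
    using that by (simp add: L2_inner_lincomb_lincomb eL orth power2_eq_square if_distrib[where f="(*) _"] cong: if_cong)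
  have summ: "summable (\<lambda>j. (?a j)\<^sup>2)"
    by (rule bounded_imp_summable[where B="B"]) (auto intro: bound[of "Suc _", unfolded lessThan_Suc_atMost])
  have diff: "L2_inner M (\<lambda>x. S m x - S n x) (\<lambda>x. S m x - S n x) = (\<Sum>j\<in>{n..<m}. (?a j)\<^sup>2)" if "n \<le> m" for m n
  proof -
    have "S m x - S n x = (\<Sum>j\<in>{n..<m}. ?a j * e j x)" for x
      using that by (simp add: S_def lessThan_atLeast0 sum_diff_nat_ivl)
    then show ?thesis by (simp add: lincomb)
  qed
  have swap: "L2_inner M (\<lambda>x. S m x - S n x) (\<lambda>x. S m x - S n x) =
     L2_inner M (\<lambda>x. S n x - S m x) (\<lambda>x. S n x - S m x)" for m n
    unfolding L2_inner_def by (rule Bochner_Integration.integral_cong) (auto simp: algebra_simps)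
  have Cauchy: "\<exists>N. \<forall>m\<ge>N. \<forall>n\<ge>N. L2_inner M (\<lambda>x. S m x - S n x) (\<lambda>x. S m x - S n x) < \<epsilon>"
    if \<epsilon>: "0 < \<epsilon>" for \<epsilon>
  proof -
    obtain N where N: "\<And>m n. m \<ge> N \<Longrightarrow> norm (\<Sum>j\<in>{m..<n}. (?a j)\<^sup>2) < \<epsilon>"
      using summ \<epsilon> unfolding summable_Cauchy by meson
    have "L2_inner M (\<lambda>x. S m x - S n x) (\<lambda>x. S m x - S n x) < \<epsilon>" if "m \<ge> N" "n \<ge> N" for m n
      using N[OF that(1), of n] N[OF that(2), of m] diff[of n m] diff[of m n] swap[of m n]
      by (cases "n \<le> m") auto
    then show ?thesis by blast
  qed
  obtain f where f: "f \<in> Lp M 2"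
    and lim: "(\<lambda>n. L2_inner M (\<lambda>x. S n x - f x) (\<lambda>x. S n x - f x)) \<longlonglongrightarrow> 0"
    using L2_complete[OF M SL Cauchy] by blast
  have SeqS: "L2_inner M (S n) (e j) = (if j < n then ?a j else 0)" for n j
    unfolding S_def[abs_def] by (simp add: L2_inner_lincomb_left eL orth if_distrib cong: if_cong)
  have fe: "L2_inner M f (e j) = ?a j" for j
  proof (rule LIMSEQ_unique)
    show "(\<lambda>n. L2_inner M (S n) (e j)) \<longlonglongrightarrow> L2_inner M f (e j)"
      by (rule L2_inner_tendsto[OF SL f eL lim])
    show "(\<lambda>n. L2_inner M (S n) (e j)) \<longlonglongrightarrow> ?a j"
      by (rule tendsto_eventually) (use eventually_gt_at_top[of j] in eventually_elim, simp add: SeqS)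
  qed
  have d: "(\<lambda>x. v x - f x) \<in> Lp M 2" by (intro Lp_2_diff v f)
  have "L2_inner M (\<lambda>x. v x - f x) (\<lambda>x. v x - f x) = 0"
    by (rule maximal[OF d]) (simp add: L2_inner_diff_left v f eL fe)
  from L2_norm_eq_0_imp_AE[OF d this] have AE: "AE x in M. v x = f x"
    by eventually_elim simp
  have fS: "L2_inner M (S n) f = (\<Sum>j<n. (?a j)\<^sup>2)" for n
    unfolding S_def[abs_def]
    by (simp add: L2_inner_commute[of M _ f] L2_inner_lincomb_right eL f fe power2_eq_square)
  have "L2_inner M f f \<le> B"
  proof (rule LIMSEQ_le_const2)
    show "(\<lambda>n. L2_inner M (S n) f) \<longlonglongrightarrow> L2_inner M f f"
      by (rule L2_inner_tendsto[OF SL f f lim])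
    show "\<exists>N. \<forall>n\<ge>N. L2_inner M (S n) f \<le> B" by (simp add: fS bound)
  qed
  moreover have "L2_inner M v v = L2_inner M f f"
    by (rule L2_inner_cong_AE) (use AE v f in \<open>auto intro: Lp_2_measurable\<close>)
  ultimately show ?thesis by simp
qed

section \<open>Tensor products and Fubini's theorem\<close>

text \<open>
  The product theorems for measures concern product \<open>\<sigma>\<close>-algebras, whereas Lebesgue measure on a product
  space is the completion of the product measure.  Passing to Borel representatives bridges the gap.
\<close>

lemma borel_representative:
  fixes u :: "'a::euclidean_space \<Rightarrow> real"
  assumes A: "open A" and u: "u \<in> borel_measurable (lebesgue_on A)"
  obtains U where "U \<in> borel_measurable borel" "AE x in lebesgue. indicator A x * u x = U x"
proof -
  have "(\<lambda>x. if x \<in> A then u x else 0) \<in> borel_measurable lebesgue"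
    using u A by (subst borel_measurable_if) auto
  moreover have "(\<lambda>x. if x \<in> A then u x else 0) = (\<lambda>x. indicator A x * u x)"
    by auto
  ultimately obtain U where "U \<in> borel_measurable lborel" "AE x in lborel. indicator A x * u x = U x"
    using completion_ex_borel_measurable_real[of "\<lambda>x. indicator A x * u x" lborel] by auto
  then show ?thesis using AE_completion that by auto
qed

lemma AE_lebesgue_fst:
  assumes "AE x in lebesgue. P (x::'a::euclidean_space)"
  shows "AE z in lebesgue. P (fst (z::'a \<times> 'b::euclidean_space))"
proof -
  obtain N where N: "{x. \<not> P x} \<subseteq> N" "N \<in> null_sets lborel"
    using assms by (auto simp: AE_completion_iff elim!: AE_E simp: null_sets_def)
  then have [measurable]: "N \<in> sets borel" by auto
  have "AE z in lborel \<Otimes>\<^sub>M lborel. fst (z::'a \<times> 'b) \<notin> N"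
  proof (rule lborel_pair.AE_pair_measure)
    show "{z \<in> space (lborel \<Otimes>\<^sub>M lborel). fst z \<notin> N} \<in> sets (lborel \<Otimes>\<^sub>M (lborel :: 'b measure))"
      by measurable
    show "AE x in lborel. AE y in lborel. fst (x::'a, y::'b) \<notin> N"
      using AE_not_in[OF N(2)] by eventually_elim simp
  qed
  then have "AE z in lebesgue. fst (z::'a \<times> 'b) \<notin> N" unfolding lborel_prod by (rule AE_completion)
  then show ?thesis by eventually_elim (use N in auto)
qed

lemma AE_lebesgue_snd:
  assumes "AE y in lebesgue. P (y::'b::euclidean_space)"
  shows "AE z in lebesgue. P (snd (z::'a::euclidean_space \<times> 'b))"
proof -
  obtain N where N: "{x. \<not> P x} \<subseteq> N" "N \<in> null_sets lborel"
    using assms by (auto simp: AE_completion_iff elim!: AE_E simp: null_sets_def)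
  then have [measurable]: "N \<in> sets borel" by auto
  have "AE z in lborel \<Otimes>\<^sub>M lborel. snd (z::'a \<times> 'b) \<notin> N"
  proof (rule lborel_pair.AE_pair_measure)
    show "{z \<in> space (lborel \<Otimes>\<^sub>M lborel). snd z \<notin> N} \<in> sets ((lborel :: 'a measure) \<Otimes>\<^sub>M lborel)"
      by measurable
    show "AE x in lborel. AE y in lborel. snd (x::'a, y::'b) \<notin> N"
      using AE_not_in[OF N(2)] by simp
  qed
  then have "AE z in lebesgue. snd (z::'a \<times> 'b) \<notin> N" unfolding lborel_prod by (rule AE_completion)
  then show ?thesis by eventually_elim (use N in auto)
qed

text \<open>
  Replaces integrals over an open set for Lebesgue measure by integrals of Borel functions over the
  whole space, the form in which Fubini's theorem applies.
\<close>

lemma integral_via_borel_representative: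
  fixes u :: "'a::euclidean_space \<Rightarrow> real"
  assumes A: "open A" and U [measurable]: "U \<in> borel_measurable borel"
    and AE: "AE x in lebesgue. indicator A x * u x = U x"
  shows "integrable (lebesgue_on A) u \<longleftrightarrow> integrable lborel U"
    and "(\<integral>x. u x \<partial>lebesgue_on A) = (\<integral>x. U x \<partial>lborel)"
proof -
  have UL: "U \<in> borel_measurable lebesgue" by (rule measurable_completion) simp
  have iu: "(\<lambda>x. indicator A x * u x) \<in> borel_measurable lebesgue"
    using UL by (rule borel_measurable_AE) (use AE in eventually_elim, simp)
  have "integrable (lebesgue_on A) u \<longleftrightarrow> integrable lebesgue (\<lambda>x. indicator A x * u x)"
    using A by (subst integrable_restrict_space) auto
  also have "\<dots> \<longleftrightarrow> integrable lebesgue U"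
    using AE UL iu by (intro integrable_cong_AE) auto
  also have "\<dots> \<longleftrightarrow> integrable lborel U" by (simp add: integrable_completion)
  finally show "integrable (lebesgue_on A) u \<longleftrightarrow> integrable lborel U" .
  have "(\<integral>x. u x \<partial>lebesgue_on A) = (\<integral>x. indicator A x * u x \<partial>lebesgue)"
    using A by (simp add: integral_lebesgue_on_eq open_lebesgue_sets)
  also have "\<dots> = (\<integral>x. U x \<partial>lebesgue)" using AE UL iu by (intro integral_cong_AE) auto
  also have "\<dots> = (\<integral>x. U x \<partial>lborel)" by (simp add: integral_completion)
  finally show "(\<integral>x. u x \<partial>lebesgue_on A) = (\<integral>x. U x \<partial>lborel)" .
qed

lemma product_representative:
  fixes u :: "'a::euclidean_space \<Rightarrow> real" and v :: "'b::euclidean_space \<Rightarrow> real"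
  assumes U: "AE x in lebesgue. indicator A x * u x = U x"
    and V: "AE y in lebesgue. indicator B y * v y = V y"
  shows "AE z in lebesgue. indicator (A \<times> B) z * (u (fst z) * v (snd z) * p z) = U (fst z) * V (snd z) * p z"
  using AE_lebesgue_fst[OF U, where 'b='b] AE_lebesgue_snd[OF V, where 'a='a]
proof eventually_elim
  case (elim z)
  then show ?case by (simp add: elim[symmetric] indicator_times)
qed

lemma tensor_measurable:
  fixes u :: "'a::euclidean_space \<Rightarrow> real" and v :: "'b::euclidean_space \<Rightarrow> real"
  assumes A: "open A" and B: "open B"
    and u: "u \<in> borel_measurable (lebesgue_on A)" and v: "v \<in> borel_measurable (lebesgue_on B)"
  shows "(u \<otimes>\<^sub>f v) \<in> borel_measurable (lebesgue_on (A \<times> B))"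
proof -
  obtain U where U [measurable]: "U \<in> borel_measurable borel" "AE x in lebesgue. indicator A x * u x = U x"
    using borel_representative[OF A u] .
  obtain V where V [measurable]: "V \<in> borel_measurable borel" "AE x in lebesgue. indicator B x * v x = V x"
    using borel_representative[OF B v] .
  have AE: "AE z in lebesgue. U (fst z) * V (snd z) = indicator (A \<times> B) z * (u \<otimes>\<^sub>f v) z"
    using product_representative[OF U(2) V(2), of "\<lambda>z. 1"] by eventually_elim (auto simp: tensor_def case_prod_beta)
  have "(\<lambda>z. U (fst z) * V (snd z)) \<in> borel_measurable (lborel :: ('a \<times> 'b) measure)"
    unfolding lborel_prod[symmetric] by measurable
  then have "(\<lambda>z. U (fst z) * V (snd z)) \<in> borel_measurable (lebesgue :: ('a \<times> 'b) measure)"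
    by (rule measurable_completion)
  then have "(\<lambda>z. indicator (A \<times> B) z * (u \<otimes>\<^sub>f v) z) \<in> borel_measurable lebesgue"
    using AE by (rule borel_measurable_AE)
  moreover have "(\<lambda>z. indicator (A \<times> B) z * (u \<otimes>\<^sub>f v) z) = (\<lambda>z. if z \<in> A \<times> B then (u \<otimes>\<^sub>f v) z else 0)"
    by auto
  ultimately show ?thesis
    using borel_measurable_if_D[of "A \<times> B" "u \<otimes>\<^sub>f v"] by metis
qed

text \<open>
  Fubini's theorem for a product of two integrable functions of one variable each, weighted by a
  bounded Borel function of both.  The weight is a test function or one of its derivatives when weak
  gradients are computed, and the constant \<open>1\<close> when inner products of tensors are.
\<close>

lemma
  fixes u :: "'a::euclidean_space \<Rightarrow> real" and v :: "'b::euclidean_space \<Rightarrow> real"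
  assumes A: "open A" and B: "open B"
    and u: "integrable (lebesgue_on A) u" and v: "integrable (lebesgue_on B) v"
    and p [measurable]: "p \<in> borel_measurable borel" and bound: "\<And>z. \<bar>p z\<bar> \<le> C"
  shows integrable_tensor_times: "integrable (lebesgue_on (A \<times> B)) (\<lambda>z. u (fst z) * v (snd z) * p z)"
    and integral_tensor_times_fst: "(\<integral>z. u (fst z) * v (snd z) * p z \<partial>lebesgue_on (A \<times> B)) =
      (\<integral>x. u x * (\<integral>y. v y * p (x, y) \<partial>lebesgue_on B) \<partial>lebesgue_on A)"
    and integral_tensor_times_snd: "(\<integral>z. u (fst z) * v (snd z) * p z \<partial>lebesgue_on (A \<times> B)) =
      (\<integral>y. v y * (\<integral>x. u x * p (x, y) \<partial>lebesgue_on A) \<partial>lebesgue_on B)"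
proof -
  obtain U where U [measurable]: "U \<in> borel_measurable borel" "AE x in lebesgue. indicator A x * u x = U x"
    using borel_representative[OF A borel_measurable_integrable[OF u]] .
  obtain V where V [measurable]: "V \<in> borel_measurable borel" "AE x in lebesgue. indicator B x * v x = V x"
    using borel_representative[OF B borel_measurable_integrable[OF v]] .
  have Ui: "integrable lborel U" and Vi: "integrable lborel V"
    using u v integral_via_borel_representative[OF A U] integral_via_borel_representative[OF B V] by auto
  have pm [measurable]: "p \<in> borel_measurable (lborel \<Otimes>\<^sub>M lborel)" by (simp add: lborel_prod)
  let ?W = "\<lambda>z. U (fst z) * V (snd z) * p z"
  have Wm: "?W \<in> borel_measurable (lborel \<Otimes>\<^sub>M lborel)" by measurable
  then have Wb: "?W \<in> borel_measurable borel" by (simp add: lborel_prod)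
  have UV: "integrable (lborel \<Otimes>\<^sub>M lborel) (\<lambda>z. U (fst z) * V (snd z))"
    by (rule lborel_pair.Fubini_integrable) (use Ui Vi in \<open>auto simp: abs_mult\<close>)
  have W: "integrable (lborel \<Otimes>\<^sub>M lborel) ?W"
  proof (rule Bochner_Integration.integrable_bound)
    show "integrable (lborel \<Otimes>\<^sub>M lborel) (\<lambda>z. C * (U (fst z) * V (snd z)))" using UV by simp
    have "\<bar>U (fst z) * V (snd z)\<bar> * \<bar>p z\<bar> \<le> \<bar>U (fst z) * V (snd z)\<bar> * \<bar>C\<bar>" for z
      using bound[of z] by (intro mult_left_mono) auto
    then show "AE z in lborel \<Otimes>\<^sub>M lborel. norm (?W z) \<le> norm (C * (U (fst z) * V (snd z)))"
      by (simp add: abs_mult mult_ac)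
  qed (rule Wm)
  note AE = product_representative[OF U(2) V(2), of p]
  have AB: "open (A \<times> B)" using A B by (rule open_Times)
  show "integrable (lebesgue_on (A \<times> B)) (\<lambda>z. u (fst z) * v (snd z) * p z)"
    using integral_via_borel_representative(1)[OF AB Wb AE] W by (simp add: lborel_prod)
  have eq: "(\<integral>z. u (fst z) * v (snd z) * p z \<partial>lebesgue_on (A \<times> B)) = integral\<^sup>L (lborel \<Otimes>\<^sub>M lborel) ?W"
    using integral_via_borel_representative(2)[OF AB Wb AE] by (simp add: lborel_prod)
  have mult: "(\<integral>x. u x * q x \<partial>lebesgue_on A) = (\<integral>x. U x * q x \<partial>lborel)"
    if [measurable]: "q \<in> borel_measurable borel" for q
  proof (rule integral_via_borel_representative[OF A])
    show "AE x in lebesgue. indicator A x * (u x * q x) = U x * q x"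
      using U(2) by eventually_elim (simp flip: mult.assoc)
  qed measurable
  have mult': "(\<integral>x. v x * q x \<partial>lebesgue_on B) = (\<integral>x. V x * q x \<partial>lborel)"
    if [measurable]: "q \<in> borel_measurable borel" for q
  proof (rule integral_via_borel_representative[OF B])
    show "AE x in lebesgue. indicator B x * (v x * q x) = V x * q x"
      using V(2) by eventually_elim (simp flip: mult.assoc)
  qed measurable
  have p1 [measurable]: "(\<lambda>y. p (x, y)) \<in> borel_measurable borel" for x
    by (rule measurable_compose[OF _ pm, simplified]) measurable
  have p2 [measurable]: "(\<lambda>x. p (x, y)) \<in> borel_measurable borel" for y
    by (rule measurable_compose[OF _ pm, simplified]) measurable
  have "integral\<^sup>L (lborel \<Otimes>\<^sub>M lborel) ?W = (\<integral>x. \<integral>y. ?W (x, y) \<partial>lborel \<partial>lborel)"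
    using lborel_pair.integral_fst'[OF W] by simp
  also have "\<dots> = (\<integral>x. U x * (\<integral>y. V y * p (x, y) \<partial>lborel) \<partial>lborel)"
    by (simp add: mult.assoc)
  also have "\<dots> = (\<integral>x. u x * (\<integral>y. V y * p (x, y) \<partial>lborel) \<partial>lebesgue_on A)"
    by (rule mult[symmetric]) measurable
  also have "\<dots> = (\<integral>x. u x * (\<integral>y. v y * p (x, y) \<partial>lebesgue_on B) \<partial>lebesgue_on A)"
    by (simp add: mult'[OF p1])
  finally show "(\<integral>z. u (fst z) * v (snd z) * p z \<partial>lebesgue_on (A \<times> B)) =
      (\<integral>x. u x * (\<integral>y. v y * p (x, y) \<partial>lebesgue_on B) \<partial>lebesgue_on A)"
    using eq by simp
  have "integral\<^sup>L (lborel \<Otimes>\<^sub>M lborel) ?W = (\<integral>y. \<integral>x. ?W (x, y) \<partial>lborel \<partial>lborel)"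
    using lborel_pair.integral_snd[of "\<lambda>x y. ?W (x, y)"] W by (simp add: case_prod_unfold)
  also have "\<dots> = (\<integral>y. V y * (\<integral>x. U x * p (x, y) \<partial>lborel) \<partial>lborel)"
    by (simp add: mult_ac flip: integral_mult_right_zero)
  also have "\<dots> = (\<integral>y. v y * (\<integral>x. U x * p (x, y) \<partial>lborel) \<partial>lebesgue_on B)"
    by (rule mult'[symmetric]) measurable
  also have "\<dots> = (\<integral>y. v y * (\<integral>x. u x * p (x, y) \<partial>lebesgue_on A) \<partial>lebesgue_on B)"
    by (simp add: mult[OF p2])
  finally show "(\<integral>z. u (fst z) * v (snd z) * p z \<partial>lebesgue_on (A \<times> B)) =
      (\<integral>y. v y * (\<integral>x. u x * p (x, y) \<partial>lebesgue_on A) \<partial>lebesgue_on B)"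
    using eq by simp
qed

lemma
  fixes u :: "'a::euclidean_space \<Rightarrow> real" and v :: "'b::euclidean_space \<Rightarrow> real"
  assumes "open A" "open B" "integrable (lebesgue_on A) u" "integrable (lebesgue_on B) v"
  shows integrable_tensor: "integrable (lebesgue_on (A \<times> B)) (u \<otimes>\<^sub>f v)"
    and integral_tensor: "(\<integral>z. (u \<otimes>\<^sub>f v) z \<partial>lebesgue_on (A \<times> B)) =
      (\<integral>x. u x \<partial>lebesgue_on A) * (\<integral>y. v y \<partial>lebesgue_on B)"
  using integrable_tensor_times[OF assms, of "\<lambda>z. 1" 1] integral_tensor_times_fst[OF assms, of "\<lambda>z. 1" 1]
  by (simp_all add: tensor_def case_prod_unfold)

lemma tensor_Lp_2:
  assumes A: "open A" and B: "open B"
    and u: "u \<in> Lp (lebesgue_on A) 2" and v: "v \<in> Lp (lebesgue_on B) 2"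
  shows "(u \<otimes>\<^sub>f v) \<in> Lp (lebesgue_on (A \<times> B)) 2"
proof (rule Lp_2_I)
  have "(\<lambda>z. (u \<otimes>\<^sub>f v) z * (u \<otimes>\<^sub>f v) z) = ((\<lambda>x. u x * u x) \<otimes>\<^sub>f (\<lambda>y. v y * v y))"
    by (auto simp: tensor_def)
  then show "integrable (lebesgue_on (A \<times> B)) (\<lambda>z. (u \<otimes>\<^sub>f v) z * (u \<otimes>\<^sub>f v) z)"
    using integrable_tensor[OF A B Lp_2_times_integrable[OF u u] Lp_2_times_integrable[OF v v]] by simp
qed (intro tensor_measurable A B Lp_2_measurable u v)

lemma L2_inner_tensor:
  assumes A: "open A" and B: "open B"
    and u: "u \<in> Lp (lebesgue_on A) 2" "u' \<in> Lp (lebesgue_on A) 2"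
    and v: "v \<in> Lp (lebesgue_on B) 2" "v' \<in> Lp (lebesgue_on B) 2"
  shows "L2_inner (lebesgue_on (A \<times> B)) (u \<otimes>\<^sub>f v) (u' \<otimes>\<^sub>f v') =
    L2_inner (lebesgue_on A) u u' * L2_inner (lebesgue_on B) v v'"
proof -
  have "(\<lambda>z. (u \<otimes>\<^sub>f v) z * (u' \<otimes>\<^sub>f v') z) = ((\<lambda>x. u x * u' x) \<otimes>\<^sub>f (\<lambda>y. v y * v' y))"
    by (auto simp: tensor_def)
  then show ?thesis
    using integral_tensor[OF A B Lp_2_times_integrable[OF u] Lp_2_times_integrable[OF v]]
    by (simp add: L2_inner_def)
qed

section \<open>Derivatives and sections of test functions\<close>

lemma test_function_derivative:
  assumes \<phi>: "test_function \<Omega> \<phi>" and i: "i \<in> Basis"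
  shows "test_function \<Omega> (\<lambda>x. frechet_derivative \<phi> (at x) i)"
proof -
  let ?K = "closure {x. \<phi> x \<noteq> 0}"
  \<comment> \<open>Off its closed support the function vanishes identically near each point.\<close>
  have zero: "frechet_derivative \<phi> (at x) i = 0" if "x \<notin> ?K" for x
  proof -
    have "((\<lambda>x. 0) has_derivative (\<lambda>h. 0)) (at x)" by simp
    then have "(\<phi> has_derivative (\<lambda>h. 0)) (at x)"
      by (rule has_derivative_transform_within_open[where s="- ?K"])
         (use that closure_subset[of "{x. \<phi> x \<noteq> 0}"] in auto)
    from frechet_derivative_at[OF this] show ?thesis by (simp add: fun_eq_iff)
  qed
  then have "{x. frechet_derivative \<phi> (at x) i \<noteq> 0} \<subseteq> ?K" by blast
  then have sub: "closure {x. frechet_derivative \<phi> (at x) i \<noteq> 0} \<subseteq> ?K"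
    by (simp add: closure_minimal)
  moreover have "compact ?K" "?K \<subseteq> \<Omega>" using \<phi> by (auto simp: test_function_def)
  moreover have "Ck k (\<lambda>x. frechet_derivative \<phi> (at x) i)" for k
  proof -
    have "Ck (Suc k) \<phi>" using \<phi> unfolding test_function_def by blast
    then show ?thesis using i by simp
  qed
  ultimately show ?thesis
    using compact_Int_closed[of ?K "closure {x. frechet_derivative \<phi> (at x) i \<noteq> 0}"]
    by (simp add: test_function_def inf.absorb2)
qed

lemma test_function_borel:
  assumes "test_function \<Omega> \<phi>"
  shows "\<phi> \<in> borel_measurable borel"
proof -
  have "Ck 0 \<phi>" using assms unfolding test_function_def by blast
  then show ?thesis by (simp add: borel_measurable_continuous_onI)
qed

lemma test_function_bounded:
  assumes "test_function \<Omega> \<phi>"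
  obtains C where "\<And>x. \<bar>\<phi> x\<bar> \<le> C"
proof -
  let ?K = "closure {x. \<phi> x \<noteq> 0}"
  have "Ck 0 \<phi>" "compact ?K" using assms unfolding test_function_def by blast+
  then have "compact (\<phi> ` ?K)"
    by (intro compact_continuous_image) (auto intro: continuous_on_subset)
  then have "bounded (\<phi> ` ?K)" by (rule compact_imp_bounded)
  then obtain C where C: "\<forall>y\<in>\<phi> ` ?K. norm y \<le> C"
    unfolding bounded_iff by (rule exE)
  have "\<bar>\<phi> x\<bar> \<le> \<bar>C\<bar>" for x
  proof (cases "\<phi> x = 0")
    case False
    then have "x \<in> ?K" by (intro subsetD[OF closure_subset]) simp
    then have "\<bar>\<phi> x\<bar> \<le> C" using C by simp
    then show ?thesis by simp
  qed simp
  then show ?thesis by (rule that)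
qed

lemma borel_measurable_lebesgue_on:
  "f \<in> borel_measurable borel \<Longrightarrow> f \<in> borel_measurable (lebesgue_on S)"
  by (intro measurable_restrict_space1 measurable_completion) simp

lemma test_function_Lp_2:
  assumes "finite_measure (lebesgue_on \<Omega>)" "test_function S \<phi>"
  shows "\<phi> \<in> Lp (lebesgue_on \<Omega>) 2"
proof -
  obtain C where C: "\<And>x. \<bar>\<phi> x\<bar> \<le> C" using test_function_bounded[OF assms(2)] by blast
  have [measurable]: "\<phi> \<in> borel_measurable (lebesgue_on \<Omega>)"
    using test_function_borel[OF assms(2)] by (rule borel_measurable_lebesgue_on)
  have "norm ((\<phi> x)\<^sup>2) \<le> C\<^sup>2" for x using power_mono[OF C[of x], of 2] by simp
  then have "integrable (lebesgue_on \<Omega>) (\<lambda>x. (\<phi> x)\<^sup>2)"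
    by (intro finite_measure.integrable_const_bound[OF assms(1), of _ "C\<^sup>2"]) auto
  then show ?thesis by (simp add: Lp_2_iff)
qed


lemma section_has_derivative:
  fixes \<phi> :: "'a::euclidean_space \<times> 'b::euclidean_space \<Rightarrow> real"
  assumes "Ck (Suc k) \<phi>"
  shows "((\<lambda>x. \<phi> (x, y)) has_derivative (\<lambda>h. frechet_derivative \<phi> (at (x, y)) (h, 0))) (at x)"
    and "((\<lambda>y. \<phi> (x, y)) has_derivative (\<lambda>h. frechet_derivative \<phi> (at (x, y)) (0, h))) (at y)"
proof -
  have D: "(\<phi> has_derivative frechet_derivative \<phi> (at (x, y))) (at (x, y))"
  proof -
    have "\<forall>z. \<phi> differentiable (at z)" using iffD1[OF Ck.simps(2) assms] by (rule conjunct1)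
    then have "\<phi> differentiable (at (x, y))" by (rule spec)
    then show ?thesis by (rule iffD1[OF frechet_derivative_works])
  qed
  show "((\<lambda>x. \<phi> (x, y)) has_derivative (\<lambda>h. frechet_derivative \<phi> (at (x, y)) (h, 0))) (at x)"
    by (rule has_derivative_compose[where f="\<lambda>x. (x, y)", OF _ D])
      (intro has_derivative_Pair has_derivative_ident has_derivative_const)
  show "((\<lambda>y. \<phi> (x, y)) has_derivative (\<lambda>h. frechet_derivative \<phi> (at (x, y)) (0, h))) (at y)"
    by (rule has_derivative_compose[where f="\<lambda>y. (x, y)", OF _ D])
      (intro has_derivative_Pair has_derivative_ident has_derivative_const)
qed

lemma Ck_section:
  fixes \<phi> :: "'a::euclidean_space \<times> 'b::euclidean_space \<Rightarrow> real"
  assumes "Ck k \<phi>"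
  shows "Ck k (\<lambda>x. \<phi> (x, y))" and "Ck k (\<lambda>y. \<phi> (x, y))"
proof -
  have "Ck k (\<lambda>x. \<phi> (x, y)) \<and> Ck k (\<lambda>y. \<phi> (x, y))"
    using assms
  proof (induction k arbitrary: \<phi>)
    case 0
    then have "continuous_on UNIV \<phi>" by simp
    then have "continuous_on UNIV (\<lambda>x. \<phi> (x, y))" "continuous_on UNIV (\<lambda>y. \<phi> (x, y))"
      by (rule continuous_on_compose2[where g=\<phi> and t=UNIV]; auto intro!: continuous_intros)+
    then show ?case by simp
  next
    case (Suc k)
    have D: "Ck k (\<lambda>z. frechet_derivative \<phi> (at z) l)" if "l \<in> Basis" for l
      using conjunct2[OF iffD1[OF Ck.simps(2) Suc.prems]] that by (rule bspec)
    have "Ck (Suc k) (\<lambda>x. \<phi> (x, y))"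
      by (rule Ck_SucI[OF section_has_derivative(1)[OF Suc.prems]])
        (simp add: Suc.IH[OF D] Basis_prod_def)
    moreover have "Ck (Suc k) (\<lambda>y. \<phi> (x, y))"
      by (rule Ck_SucI[OF section_has_derivative(2)[OF Suc.prems]])
        (simp add: Suc.IH[OF D] Basis_prod_def)
    ultimately show ?case ..
  qed
  then show "Ck k (\<lambda>x. \<phi> (x, y))" "Ck k (\<lambda>y. \<phi> (x, y))" by auto
qed

text \<open>
  Freezing one variable of a test function on a product gives a test function on the other factor.
  This is why the weak gradient of a tensor product can be tested against all test functions directly,
  without approximating them by sums of products.
\<close>

lemma test_function_section:
  fixes \<phi> :: "'a::euclidean_space \<times> 'b::euclidean_space \<Rightarrow> real"
  assumes \<phi>: "test_function (A \<times> B) \<phi>"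
  shows "test_function A (\<lambda>x. \<phi> (x, y))" and "test_function B (\<lambda>y. \<phi> (x, y))"
proof -
  let ?K = "closure {z. \<phi> z \<noteq> 0}"
  have K: "compact ?K" "?K \<subseteq> A \<times> B" and Ck: "\<And>k. Ck k \<phi>"
    using \<phi> unfolding test_function_def by blast+
  let ?S = "closure {x. \<phi> (x, y) \<noteq> 0}" and ?T = "closure {y. \<phi> (x, y) \<noteq> 0}"
  have "closed ((\<lambda>x. (x, y)) -` ?K)" "closed ((\<lambda>y. (x, y)) -` ?K)"
    by (rule continuous_closed_vimage[OF closed_closure];
        intro isCont_Pair continuous_ident continuous_const)+
  moreover have "{x. \<phi> (x, y) \<noteq> 0} \<subseteq> (\<lambda>x. (x, y)) -` ?K" "{y. \<phi> (x, y) \<noteq> 0} \<subseteq> (\<lambda>y. (x, y)) -` ?K"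
    by (auto intro!: subsetD[OF closure_subset[of "{z. \<phi> z \<noteq> 0}"]])
  ultimately have S: "?S \<subseteq> (\<lambda>x. (x, y)) -` ?K" and T: "?T \<subseteq> (\<lambda>y. (x, y)) -` ?K"
    by (simp_all only: closure_minimal)
  have "compact (fst ` ?K)" "compact (snd ` ?K)"
    by (rule compact_continuous_image[OF _ K(1)];
        intro continuous_on_fst continuous_on_snd continuous_on_id)+
  moreover have "?S \<subseteq> fst ` ?K"
  proof
    fix x assume "x \<in> ?S"
    then have "(x, y) \<in> ?K" using S by blast
    then show "x \<in> fst ` ?K" by (rule rev_image_eqI) simp
  qed
  moreover have "?T \<subseteq> snd ` ?K"
  proof
    fix y assume "y \<in> ?T"
    then have "(x, y) \<in> ?K" using T by blast
    then show "y \<in> snd ` ?K" by (rule rev_image_eqI) simp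
  qed
  ultimately have "compact ?S" "compact ?T"
    using compact_Int_closed[of "fst ` ?K" ?S] compact_Int_closed[of "snd ` ?K" ?T]
    by (simp_all only: inf.absorb2 closed_closure)
  moreover have "?S \<subseteq> A" "?T \<subseteq> B" using S T K(2) by blast+
  ultimately show "test_function A (\<lambda>x. \<phi> (x, y))" "test_function B (\<lambda>y. \<phi> (x, y))"
    using Ck_section[OF Ck] unfolding test_function_def by blast+
qed

section \<open>Square-integrable weak gradients\<close>

lemma borel_measurable_lebesgue_on_AE:
  fixes f g :: "'a::euclidean_space \<Rightarrow> real"
  assumes S: "open S" and f: "f \<in> borel_measurable (lebesgue_on S)"
    and AE: "AE x in lebesgue_on S. f x = g x"
  shows "g \<in> borel_measurable (lebesgue_on S)"
proof -
  have S': "S \<in> sets lebesgue" using S by simp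
  have "AE x in lebesgue. x \<in> S \<longrightarrow> f x = g x"
    using AE S' by (simp add: AE_restrict_space_iff)
  then have "AE x in lebesgue. (if x \<in> S then f x else 0) = (if x \<in> S then g x else 0)"
    by eventually_elim simp
  then have "(\<lambda>x. if x \<in> S then g x else 0) \<in> borel_measurable lebesgue"
    by (rule borel_measurable_AE[OF borel_measurable_if_I[OF f S']])
  then show ?thesis by (rule borel_measurable_if_D)
qed

lemma test_function_times_integrable:
  fixes f :: "'a::euclidean_space \<Rightarrow> real"
  assumes \<Omega>: "open \<Omega>" and f: "\<And>K. compact K \<Longrightarrow> K \<subseteq> \<Omega> \<Longrightarrow> set_integrable lebesgue K f"
    and \<phi>: "test_function \<Omega> \<phi>"
  shows "integrable (lebesgue_on \<Omega>) (\<lambda>x. f x * \<phi> x)"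
proof -
  let ?K = "closure {x. \<phi> x \<noteq> 0}"
  have K: "compact ?K" "?K \<subseteq> \<Omega>" using \<phi> unfolding test_function_def by blast+
  obtain C where C: "\<And>x. \<bar>\<phi> x\<bar> \<le> C" using test_function_bounded[OF \<phi>] by blast
  have \<phi>m: "\<phi> \<in> borel_measurable lebesgue"
    by (rule measurable_completion) (use test_function_borel[OF \<phi>] in simp)
  have fK: "integrable lebesgue (\<lambda>x. indicator ?K x * f x)"
    using f[OF K] by (simp add: set_integrable_def)
  have "integrable lebesgue (\<lambda>x. (indicator ?K x * f x) * \<phi> x)"
  proof (rule Bochner_Integration.integrable_bound)
    show "integrable lebesgue (\<lambda>x. C * (indicator ?K x * f x))" using fK by simp
    show "(\<lambda>x. (indicator ?K x * f x) * \<phi> x) \<in> borel_measurable lebesgue"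
      by (rule borel_measurable_times[OF borel_measurable_integrable[OF fK] \<phi>m])
    have "\<bar>\<phi> x\<bar> \<le> \<bar>C\<bar>" for x using C[of x] by linarith
    then have "\<bar>t\<bar> * \<bar>\<phi> x\<bar> \<le> \<bar>C\<bar> * \<bar>t\<bar>" for t x
      by (subst mult.commute) (rule mult_right_mono, simp_all)
    then show "AE x in lebesgue. norm ((indicator ?K x * f x) * \<phi> x) \<le> norm (C * (indicator ?K x * f x))"
      unfolding real_norm_def abs_mult[of "_ * _"] abs_mult[of C] by (intro AE_I2)
  qed
  moreover have "(\<lambda>x. (indicator ?K x * f x) * \<phi> x) = (\<lambda>x. indicator \<Omega> x *\<^sub>R (f x * \<phi> x))"
  proof
    fix x
    have "\<phi> x \<noteq> 0 \<Longrightarrow> x \<in> ?K" by (intro subsetD[OF closure_subset]) simp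
    then show "(indicator ?K x * f x) * \<phi> x = indicator \<Omega> x *\<^sub>R (f x * \<phi> x)"
      using K(2) by (cases "\<phi> x = 0") (auto simp: indicator_def)
  qed
  ultimately show ?thesis using \<Omega> by (simp add: integrable_restrict_space open_lebesgue_sets)
qed

text \<open>
  The choice made by \<open>grad\<close> becomes computable through this lemma: any weak gradient that can be
  exhibited agrees with it almost everywhere.
\<close>

lemma weak_gradient_unique:
  fixes u :: "'a::euclidean_space \<Rightarrow> real"
  assumes \<Omega>: "open \<Omega>" and g: "weak_gradient \<Omega> u g" and g': "weak_gradient \<Omega> u g'"
  shows "AE x in lebesgue_on \<Omega>. g x = g' x"
proof -
  have comp: "AE x in lebesgue_on \<Omega>. g x \<bullet> i - g' x \<bullet> i = 0" if i: "i \<in> Basis" for i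
  proof (rule fundamental_lemma_of_calculus_of_variations[OF \<Omega>])
    have int: "set_integrable lebesgue K (\<lambda>x. h x \<bullet> i)"
      if "compact K" "K \<subseteq> \<Omega>" "weak_gradient \<Omega> u h" for K h
    proof -
      have "set_integrable lebesgue K h" using that unfolding weak_gradient_def by blast
      then have "integrable lebesgue (\<lambda>x. (indicator K x *\<^sub>R h x) \<bullet> i)"
        unfolding set_integrable_def by (rule integrable_inner_left)
      then show ?thesis unfolding set_integrable_def by simp
    qed
    show "set_integrable lebesgue K (\<lambda>x. g x \<bullet> i - g' x \<bullet> i)" if "compact K" "K \<subseteq> \<Omega>" for K
      using int[OF that g] int[OF that g'] by (rule set_integral_diff)
    show "(\<integral>x. (g x \<bullet> i - g' x \<bullet> i) * \<phi> x \<partial>lebesgue_on \<Omega>) = 0" if \<phi>: "test_function \<Omega> \<phi>" for \<phi>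
    proof -
      have "(\<integral>x. (g x \<bullet> i - g' x \<bullet> i) * \<phi> x \<partial>lebesgue_on \<Omega>) =
          (\<integral>x. g x \<bullet> i * \<phi> x \<partial>lebesgue_on \<Omega>) - (\<integral>x. g' x \<bullet> i * \<phi> x \<partial>lebesgue_on \<Omega>)"
        unfolding left_diff_distrib
        by (intro Bochner_Integration.integral_diff test_function_times_integrable[OF \<Omega> _ \<phi>] int g g')
      moreover have "- (\<integral>x. g x \<bullet> i * \<phi> x \<partial>lebesgue_on \<Omega>) = - (\<integral>x. g' x \<bullet> i * \<phi> x \<partial>lebesgue_on \<Omega>)"
        using g g' \<phi> i unfolding weak_gradient_def by (metis (no_types, lifting))
      ultimately show ?thesis by simp
    qed
  qed
  then have "AE x in lebesgue_on \<Omega>. \<forall>i\<in>Basis. g x \<bullet> i - g' x \<bullet> i = 0"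
    by (subst AE_finite_all) auto
  then show ?thesis by eventually_elim (auto intro: euclidean_eqI)
qed

text \<open>
  A weak gradient with square-integrable components, the integration by parts formula being phrased
  through the \<open>L\<^sup>2\<close> inner product.  On bounded open sets this is stronger than \<open>weak_gradient\<close>, and it
  is preserved by linear combinations, by limits and by tensor products.
\<close>

definition L2_gradient :: "'a::euclidean_space set \<Rightarrow> ('a \<Rightarrow> real) \<Rightarrow> ('a \<Rightarrow> 'a) \<Rightarrow> bool" where
  "L2_gradient \<Omega> u g \<longleftrightarrow> u \<in> Lp (lebesgue_on \<Omega>) 2 \<and> (\<forall>i\<in>Basis. (\<lambda>x. g x \<bullet> i) \<in> Lp (lebesgue_on \<Omega>) 2) \<and>
    (\<forall>\<phi> i. test_function \<Omega> \<phi> \<longrightarrow> i \<in> Basis \<longrightarrow>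
      L2_inner (lebesgue_on \<Omega>) u (\<lambda>x. frechet_derivative \<phi> (at x) i) =
      - L2_inner (lebesgue_on \<Omega>) (\<lambda>x. g x \<bullet> i) \<phi>)"

lemma L2_gradient_Lp_2: "L2_gradient \<Omega> u g \<Longrightarrow> u \<in> Lp (lebesgue_on \<Omega>) 2"
  and L2_gradient_component_Lp_2:
    "L2_gradient \<Omega> u g \<Longrightarrow> i \<in> Basis \<Longrightarrow> (\<lambda>x. g x \<bullet> i) \<in> Lp (lebesgue_on \<Omega>) 2"
  and L2_gradient_by_parts: "L2_gradient \<Omega> u g \<Longrightarrow> test_function \<Omega> \<phi> \<Longrightarrow> i \<in> Basis \<Longrightarrow>
    L2_inner (lebesgue_on \<Omega>) u (\<lambda>x. frechet_derivative \<phi> (at x) i) =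
    - L2_inner (lebesgue_on \<Omega>) (\<lambda>x. g x \<bullet> i) \<phi>"
  by (auto simp: L2_gradient_def)

lemma finite_measure_bounded_open:
  fixes \<Omega> :: "'a::euclidean_space set"
  assumes "open \<Omega>" "bounded \<Omega>"
  shows "finite_measure (lebesgue_on \<Omega>)"
  using assms by (intro finite_measure_lebesgue_on lmeasurable_open)

lemma Lp_2_set_integrable:
  fixes f :: "'a::euclidean_space \<Rightarrow> real"
  assumes \<Omega>: "open \<Omega>" "bounded \<Omega>" and f: "f \<in> Lp (lebesgue_on \<Omega>) 2" and K: "compact K" "K \<subseteq> \<Omega>"
  shows "set_integrable lebesgue K f"
proof -
  have "integrable (lebesgue_on \<Omega>) f"
    by (rule Lp_2_imp_integrable[OF finite_measure_bounded_open[OF \<Omega>] f])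
  then have "set_integrable lebesgue \<Omega> f"
    using \<Omega>(1) by (simp add: integrable_restrict_space set_integrable_def open_lebesgue_sets)
  moreover have "K \<in> sets lebesgue" using K(1) by (simp add: compact_imp_closed)
  ultimately show ?thesis using K(2) by (rule set_integrable_subset)
qed

lemma L2_gradient_imp_weak_gradient:
  assumes \<Omega>: "open \<Omega>" "bounded \<Omega>" and g: "L2_gradient \<Omega> u g"
  shows "weak_gradient \<Omega> u g"
  unfolding weak_gradient_def
proof (intro conjI allI impI ballI)
  fix K assume K: "compact K \<and> K \<subseteq> \<Omega>"
  show "set_integrable lebesgue K u"
    using Lp_2_set_integrable[OF \<Omega> L2_gradient_Lp_2[OF g]] K by blast
  have "integrable lebesgue (\<lambda>x. \<Sum>i\<in>Basis. (indicator K x *\<^sub>R (g x \<bullet> i)) *\<^sub>R i)"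
    using Lp_2_set_integrable[OF \<Omega> L2_gradient_component_Lp_2[OF g]] K
    by (intro Bochner_Integration.integrable_sum integrable_scaleR_left) (auto simp: set_integrable_def)
  moreover have "(\<Sum>i\<in>Basis. (indicator K x *\<^sub>R (g x \<bullet> i)) *\<^sub>R i) = indicator K x *\<^sub>R g x" for x
    by (simp add: euclidean_representation flip: scaleR_scaleR scaleR_sum_right)
  ultimately show "set_integrable lebesgue K g"
    by (simp add: set_integrable_def)
next
  fix \<phi> :: "'a \<Rightarrow> real" and i :: 'a assume "test_function \<Omega> \<phi>" "i \<in> Basis"
  then show "(\<integral>x. u x * frechet_derivative \<phi> (at x) i \<partial>lebesgue_on \<Omega>) =
      - (\<integral>x. (g x \<bullet> i) * \<phi> x \<partial>lebesgue_on \<Omega>)"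
    using L2_gradient_by_parts[OF g] by (simp add: L2_inner_def)
qed

lemma L2_gradient_cong_AE:
  assumes \<Omega>: "open \<Omega>" "bounded \<Omega>" and g: "L2_gradient \<Omega> u g"
    and AE: "AE x in lebesgue_on \<Omega>. g x = g' x"
  shows "L2_gradient \<Omega> u g'"
  unfolding L2_gradient_def
proof (intro conjI ballI allI impI)
  show "u \<in> Lp (lebesgue_on \<Omega>) 2" using g by (rule L2_gradient_Lp_2)
  have AEi: "AE x in lebesgue_on \<Omega>. g x \<bullet> i = g' x \<bullet> i" for i
    using AE by eventually_elim simp
  have meas: "(\<lambda>x. g' x \<bullet> i) \<in> borel_measurable (lebesgue_on \<Omega>)" if "i \<in> Basis" for i
    by (rule borel_measurable_lebesgue_on_AE[OF \<Omega>(1) Lp_2_measurable[OF L2_gradient_component_Lp_2[OF g that]] AEi])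
  show "(\<lambda>x. g' x \<bullet> i) \<in> Lp (lebesgue_on \<Omega>) 2" if "i \<in> Basis" for i
    using Lp_2_cong_AE[OF L2_gradient_component_Lp_2[OF g that] meas[OF that] AEi] .
  fix \<phi> i assume \<phi>: "test_function \<Omega> \<phi>" and i: "i \<in> (Basis :: 'a set)"
  have \<phi>2: "\<phi> \<in> Lp (lebesgue_on \<Omega>) 2"
    by (rule test_function_Lp_2[OF finite_measure_bounded_open[OF \<Omega>] \<phi>])
  have "L2_inner (lebesgue_on \<Omega>) (\<lambda>x. g x \<bullet> i) \<phi> = L2_inner (lebesgue_on \<Omega>) (\<lambda>x. g' x \<bullet> i) \<phi>"
    by (rule L2_inner_cong_AE[OF L2_gradient_component_Lp_2[OF g i] \<phi>2 meas[OF i] Lp_2_measurable[OF \<phi>2] AEi]) simp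
  then show "L2_inner (lebesgue_on \<Omega>) u (\<lambda>x. frechet_derivative \<phi> (at x) i) =
      - L2_inner (lebesgue_on \<Omega>) (\<lambda>x. g' x \<bullet> i) \<phi>"
    using L2_gradient_by_parts[OF g \<phi> i] by simp
qed

lemma grad_eq_AE:
  assumes \<Omega>: "open \<Omega>" "bounded \<Omega>" and g: "L2_gradient \<Omega> u g"
  shows "AE x in lebesgue_on \<Omega>. g x = grad \<Omega> u x"
proof -
  have "weak_gradient \<Omega> u g" by (rule L2_gradient_imp_weak_gradient[OF \<Omega> g])
  moreover from this have "weak_gradient \<Omega> u (grad \<Omega> u)"
    unfolding grad_def by (rule someI[where P="weak_gradient \<Omega> u"])
  ultimately show ?thesis by (rule weak_gradient_unique[OF \<Omega>(1)])
qed

lemma L2_gradient_grad: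
  assumes \<Omega>: "open \<Omega>" "bounded \<Omega>" and g: "L2_gradient \<Omega> u g"
  shows "L2_gradient \<Omega> u (grad \<Omega> u)"
  by (rule L2_gradient_cong_AE[OF \<Omega> g grad_eq_AE[OF \<Omega> g]])

lemma H1_L2_gradient_grad:
  assumes \<Omega>: "open \<Omega>" "bounded \<Omega>" and u: "u \<in> H1 \<Omega>"
  shows "L2_gradient \<Omega> u (grad \<Omega> u)"
proof -
  obtain g where "weak_gradient \<Omega> u g" "\<forall>i\<in>Basis. (\<lambda>x. g x \<bullet> i) \<in> Lp (lebesgue_on \<Omega>) 2"
    and "u \<in> Lp (lebesgue_on \<Omega>) 2"
    using u by (auto simp: H1_def)
  then have "L2_gradient \<Omega> u g"
    by (simp add: L2_gradient_def weak_gradient_def L2_inner_def)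
  then show ?thesis by (rule L2_gradient_grad[OF \<Omega>])
qed

lemma integral_grad_inner_grad:
  assumes \<Omega>: "open \<Omega>" "bounded \<Omega>" and g: "L2_gradient \<Omega> u g" and h: "L2_gradient \<Omega> v h"
  shows "integrable (lebesgue_on \<Omega>) (\<lambda>x. grad \<Omega> u x \<bullet> grad \<Omega> v x)"
    and "(\<integral>x. grad \<Omega> u x \<bullet> grad \<Omega> v x \<partial>lebesgue_on \<Omega>) =
      (\<Sum>i\<in>Basis. L2_inner (lebesgue_on \<Omega>) (\<lambda>x. g x \<bullet> i) (\<lambda>x. h x \<bullet> i))"
proof -
  note u' = L2_gradient_component_Lp_2[OF L2_gradient_grad[OF \<Omega> g]]
  note v' = L2_gradient_component_Lp_2[OF L2_gradient_grad[OF \<Omega> h]]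
  have sum: "(\<lambda>x. grad \<Omega> u x \<bullet> grad \<Omega> v x) = (\<lambda>x. \<Sum>i\<in>Basis. (grad \<Omega> u x \<bullet> i) * (grad \<Omega> v x \<bullet> i))"
    by (simp add: euclidean_inner[symmetric])
  have int: "integrable (lebesgue_on \<Omega>) (\<lambda>x. (grad \<Omega> u x \<bullet> i) * (grad \<Omega> v x \<bullet> i))" if "i \<in> Basis" for i
    by (rule Lp_2_times_integrable[OF u'[OF that] v'[OF that]])
  show "integrable (lebesgue_on \<Omega>) (\<lambda>x. grad \<Omega> u x \<bullet> grad \<Omega> v x)"
    unfolding sum by (rule Bochner_Integration.integrable_sum[OF int])
  have "(\<integral>x. grad \<Omega> u x \<bullet> grad \<Omega> v x \<partial>lebesgue_on \<Omega>) =
      (\<Sum>i\<in>Basis. L2_inner (lebesgue_on \<Omega>) (\<lambda>x. grad \<Omega> u x \<bullet> i) (\<lambda>x. grad \<Omega> v x \<bullet> i))"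
    unfolding sum L2_inner_def by (rule Bochner_Integration.integral_sum[OF int])
  also have "\<dots> = (\<Sum>i\<in>Basis. L2_inner (lebesgue_on \<Omega>) (\<lambda>x. g x \<bullet> i) (\<lambda>x. h x \<bullet> i))"
  proof (rule sum.cong[OF refl])
    fix i :: 'a assume i: "i \<in> Basis"
    show "L2_inner (lebesgue_on \<Omega>) (\<lambda>x. grad \<Omega> u x \<bullet> i) (\<lambda>x. grad \<Omega> v x \<bullet> i) =
        L2_inner (lebesgue_on \<Omega>) (\<lambda>x. g x \<bullet> i) (\<lambda>x. h x \<bullet> i)"
    proof (rule sym, rule L2_inner_cong_AE)
      show "AE x in lebesgue_on \<Omega>. g x \<bullet> i = grad \<Omega> u x \<bullet> i"
        using grad_eq_AE[OF \<Omega> g] by eventually_elim simp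
      show "AE x in lebesgue_on \<Omega>. h x \<bullet> i = grad \<Omega> v x \<bullet> i"
        using grad_eq_AE[OF \<Omega> h] by eventually_elim simp
    qed (intro Lp_2_measurable u' v' i L2_gradient_component_Lp_2[OF g] L2_gradient_component_Lp_2[OF h])+
  qed
  finally show "(\<integral>x. grad \<Omega> u x \<bullet> grad \<Omega> v x \<partial>lebesgue_on \<Omega>) =
      (\<Sum>i\<in>Basis. L2_inner (lebesgue_on \<Omega>) (\<lambda>x. g x \<bullet> i) (\<lambda>x. h x \<bullet> i))" .
qed

lemma L2_gradient_lincomb:
  assumes \<Omega>: "open \<Omega>" "bounded \<Omega>" and g: "\<And>j. j \<in> J \<Longrightarrow> L2_gradient \<Omega> (u j) (g j)"
  shows "L2_gradient \<Omega> (\<lambda>x. \<Sum>j\<in>J. a j * u j x) (\<lambda>x. \<Sum>j\<in>J. a j *\<^sub>R g j x)"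
proof -
  have comp: "(\<lambda>x. (\<Sum>j\<in>J. a j *\<^sub>R g j x) \<bullet> i) = (\<lambda>x. \<Sum>j\<in>J. a j * (g j x \<bullet> i))" for i
    by (simp add: inner_sum_left)
  note u2 = L2_gradient_Lp_2[OF g] and g2 = L2_gradient_component_Lp_2[OF g]
  note fin = finite_measure_bounded_open[OF \<Omega>]
  show ?thesis
    unfolding L2_gradient_def comp
  proof (intro conjI ballI allI impI)
    show "(\<lambda>x. \<Sum>j\<in>J. a j * u j x) \<in> Lp (lebesgue_on \<Omega>) 2" by (rule Lp_2_lincomb[OF u2])
    show "(\<lambda>x. \<Sum>j\<in>J. a j * (g j x \<bullet> i)) \<in> Lp (lebesgue_on \<Omega>) 2" if "i \<in> Basis" for i
      by (rule Lp_2_lincomb[OF g2[OF _ that]])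
    fix \<phi> i assume \<phi>: "test_function \<Omega> \<phi>" and i: "i \<in> (Basis :: 'a set)"
    have \<phi>2: "\<phi> \<in> Lp (lebesgue_on \<Omega>) 2" "(\<lambda>x. frechet_derivative \<phi> (at x) i) \<in> Lp (lebesgue_on \<Omega>) 2"
      by (rule test_function_Lp_2[OF fin \<phi>], rule test_function_Lp_2[OF fin test_function_derivative[OF \<phi> i]])
    show "L2_inner (lebesgue_on \<Omega>) (\<lambda>x. \<Sum>j\<in>J. a j * u j x) (\<lambda>x. frechet_derivative \<phi> (at x) i) =
        - L2_inner (lebesgue_on \<Omega>) (\<lambda>x. \<Sum>j\<in>J. a j * (g j x \<bullet> i)) \<phi>"
      using L2_gradient_by_parts[OF g \<phi> i] L2_inner_lincomb_left[of J u, OF u2 \<phi>2(2)]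
        L2_inner_lincomb_left[of J "\<lambda>j x. g j x \<bullet> i", OF g2[OF _ i] \<phi>2(1)]
      by (simp add: sum_negf[symmetric])
  qed
qed

text \<open>
  The weak gradient is a closed operator, because both sides of the integration by parts formula are
  \<open>L\<^sup>2\<close>-continuous for a fixed test function.
\<close>

lemma L2_gradient_limit:
  assumes \<Omega>: "open \<Omega>" "bounded \<Omega>" and g: "\<And>n. L2_gradient \<Omega> (u n) (g n)"
    and v: "v \<in> Lp (lebesgue_on \<Omega>) 2" and h: "\<And>i. i \<in> Basis \<Longrightarrow> (\<lambda>x. h x \<bullet> i) \<in> Lp (lebesgue_on \<Omega>) 2"
    and limu: "(\<lambda>n. L2_inner (lebesgue_on \<Omega>) (\<lambda>x. u n x - v x) (\<lambda>x. u n x - v x)) \<longlonglongrightarrow> 0"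
    and limg: "\<And>i. i \<in> Basis \<Longrightarrow> (\<lambda>n. L2_inner (lebesgue_on \<Omega>)
      (\<lambda>x. g n x \<bullet> i - h x \<bullet> i) (\<lambda>x. g n x \<bullet> i - h x \<bullet> i)) \<longlonglongrightarrow> 0"
  shows "L2_gradient \<Omega> v h"
  unfolding L2_gradient_def
proof (intro conjI ballI allI impI v h)
  note u2 = L2_gradient_Lp_2[OF g] and g2 = L2_gradient_component_Lp_2[OF g]
  note fin = finite_measure_bounded_open[OF \<Omega>]
  fix \<phi> i assume \<phi>: "test_function \<Omega> \<phi>" and i: "i \<in> (Basis :: 'a set)"
  let ?\<psi> = "\<lambda>x. frechet_derivative \<phi> (at x) i"
  have \<phi>2: "\<phi> \<in> Lp (lebesgue_on \<Omega>) 2" "?\<psi> \<in> Lp (lebesgue_on \<Omega>) 2"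
    by (rule test_function_Lp_2[OF fin \<phi>], rule test_function_Lp_2[OF fin test_function_derivative[OF \<phi> i]])
  have "(\<lambda>n. L2_inner (lebesgue_on \<Omega>) (u n) ?\<psi>) \<longlonglongrightarrow> L2_inner (lebesgue_on \<Omega>) v ?\<psi>"
    by (rule L2_inner_tendsto[OF u2 v \<phi>2(2) limu])
  moreover have "(\<lambda>n. - L2_inner (lebesgue_on \<Omega>) (\<lambda>x. g n x \<bullet> i) \<phi>) \<longlonglongrightarrow>
      - L2_inner (lebesgue_on \<Omega>) (\<lambda>x. h x \<bullet> i) \<phi>"
    by (intro tendsto_minus L2_inner_tendsto[OF g2[OF i] h[OF i] \<phi>2(1) limg[OF i]])
  ultimately show "L2_inner (lebesgue_on \<Omega>) v ?\<psi> = - L2_inner (lebesgue_on \<Omega>) (\<lambda>x. h x \<bullet> i) \<phi>"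
    using L2_gradient_by_parts[OF g \<phi> i] LIMSEQ_unique by simp
qed

definition tensor_gradient ::
  "('a::euclidean_space \<Rightarrow> real) \<Rightarrow> ('a \<Rightarrow> 'a) \<Rightarrow> ('b::euclidean_space \<Rightarrow> real) \<Rightarrow> ('b \<Rightarrow> 'b) \<Rightarrow> 'a \<times> 'b \<Rightarrow> 'a \<times> 'b" where
  "tensor_gradient u g v h = (\<lambda>(x, y). (v y *\<^sub>R g x, u x *\<^sub>R h y))"

lemma tensor_gradient_fst: "(\<lambda>z. tensor_gradient u g v h z \<bullet> (i, 0)) = (\<lambda>x. g x \<bullet> i) \<otimes>\<^sub>f v"
  and tensor_gradient_snd: "(\<lambda>z. tensor_gradient u g v h z \<bullet> (0, j)) = u \<otimes>\<^sub>f (\<lambda>y. h y \<bullet> j)"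
  by (auto simp: tensor_gradient_def tensor_def)

text \<open>
  By Fubini's theorem, integration by parts in a direction of one factor can be carried out on that
  factor alone, with the variable of the other factor frozen.
\<close>

lemma L2_gradient_tensor:
  fixes u :: "'a::euclidean_space \<Rightarrow> real" and v :: "'b::euclidean_space \<Rightarrow> real"
  assumes A: "open A" "bounded A" and B: "open B" "bounded B"
    and g: "L2_gradient A u g" and h: "L2_gradient B v h"
  shows "L2_gradient (A \<times> B) (u \<otimes>\<^sub>f v) (tensor_gradient u g v h)"
proof -
  note u2 = L2_gradient_Lp_2[OF g] and v2 = L2_gradient_Lp_2[OF h]
  note g2 = L2_gradient_component_Lp_2[OF g] and h2 = L2_gradient_component_Lp_2[OF h]
  note intA = Lp_2_imp_integrable[OF finite_measure_bounded_open[OF A]]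
  note intB = Lp_2_imp_integrable[OF finite_measure_bounded_open[OF B]]
  note fst = tensor_gradient_fst and snd = tensor_gradient_snd
  have Basis: "i \<in> Basis \<longleftrightarrow> (\<exists>j\<in>Basis. i = (j, 0)) \<or> (\<exists>j\<in>Basis. i = (0, j))" for i :: "'a \<times> 'b"
    by (auto simp: Basis_prod_def)
  have tensor: "(\<lambda>z. (p \<otimes>\<^sub>f q) z * \<phi> z) = (\<lambda>z. p (fst z) * q (snd z) * \<phi> z)"
    for p :: "'a \<Rightarrow> real" and q :: "'b \<Rightarrow> real" and \<phi>
    by (auto simp: tensor_def)
  show ?thesis
    unfolding L2_gradient_def
  proof (intro conjI ballI allI impI)
    show "(u \<otimes>\<^sub>f v) \<in> Lp (lebesgue_on (A \<times> B)) 2" by (rule tensor_Lp_2[OF A(1) B(1) u2 v2])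
    show "(\<lambda>z. tensor_gradient u g v h z \<bullet> i) \<in> Lp (lebesgue_on (A \<times> B)) 2"
      if "i \<in> Basis" for i
      using that unfolding Basis
      by (auto simp only: fst snd intro!: tensor_Lp_2[OF A(1) B(1)] u2 v2 g2 h2)
    fix \<phi> i assume \<phi>: "test_function (A \<times> B) \<phi>" and i: "i \<in> (Basis :: ('a \<times> 'b) set)"
    let ?\<psi> = "\<lambda>z. frechet_derivative \<phi> (at z) i"
    have \<psi>: "test_function (A \<times> B) ?\<psi>" by (rule test_function_derivative[OF \<phi> i])
    obtain C where C: "\<And>z. \<bar>\<phi> z\<bar> \<le> C" using test_function_bounded[OF \<phi>] by blast
    obtain C' where C': "\<And>z. \<bar>?\<psi> z\<bar> \<le> C'" using test_function_bounded[OF \<psi>] by blast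
    have Ck: "Ck (Suc 0) \<phi>" using \<phi> unfolding test_function_def by blast
    consider j where "j \<in> Basis" "i = (j, 0)" | j where "j \<in> Basis" "i = (0, j)"
      using i unfolding Basis by blast
    then show "L2_inner (lebesgue_on (A \<times> B)) (u \<otimes>\<^sub>f v) ?\<psi> =
        - L2_inner (lebesgue_on (A \<times> B)) (\<lambda>z. tensor_gradient u g v h z \<bullet> i) \<phi>"
    proof cases
      case 1
      have D: "frechet_derivative (\<lambda>x. \<phi> (x, y)) (at x) j = ?\<psi> (x, y)" for x y
        using frechet_derivative_at[OF section_has_derivative(1)[OF Ck]] 1(2) by metis
      have inner: "(\<integral>x. u x * ?\<psi> (x, y) \<partial>lebesgue_on A) = - (\<integral>x. (g x \<bullet> j) * \<phi> (x, y) \<partial>lebesgue_on A)" for y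
        using L2_gradient_by_parts[OF g test_function_section(1)[OF \<phi>, of y] 1(1)]
        unfolding D L2_inner_def .
      show ?thesis
        unfolding 1(2) fst L2_inner_def tensor
        using integral_tensor_times_snd[OF A(1) B(1) intA[OF u2] intB[OF v2] test_function_borel[OF \<psi>] C']
          integral_tensor_times_snd[OF A(1) B(1) intA[OF g2[OF 1(1)]] intB[OF v2] test_function_borel[OF \<phi>] C]
        by (simp add: inner[unfolded 1(2)] 1(2))
    next
      case 2
      have D: "frechet_derivative (\<lambda>y. \<phi> (x, y)) (at y) j = ?\<psi> (x, y)" for x y
        using frechet_derivative_at[OF section_has_derivative(2)[OF Ck]] 2(2) by metis
      have inner: "(\<integral>y. v y * ?\<psi> (x, y) \<partial>lebesgue_on B) = - (\<integral>y. (h y \<bullet> j) * \<phi> (x, y) \<partial>lebesgue_on B)" for x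
        using L2_gradient_by_parts[OF h test_function_section(2)[OF \<phi>, of x] 2(1)]
        unfolding D L2_inner_def .
      show ?thesis
        unfolding 2(2) snd L2_inner_def tensor
        using integral_tensor_times_fst[OF A(1) B(1) intA[OF u2] intB[OF v2] test_function_borel[OF \<psi>] C']
          integral_tensor_times_fst[OF A(1) B(1) intA[OF u2] intB[OF h2[OF 2(1)]] test_function_borel[OF \<phi>] C]
        by (simp add: inner[unfolded 2(2)] 2(2))
    qed
  qed
qed

section \<open>Convergence of tensor series\<close>

text \<open>
  Norm bounds for the synthesis operators \<open>b \<mapsto> \<Sum> b\<^sub>j p\<^sub>j\<close> and \<open>b \<mapsto> \<Sum> b\<^sub>k q\<^sub>k\<close> multiply when passing
  to the family \<open>p\<^sub>j \<otimes> q\<^sub>k\<close>, even when neither family is orthogonal.  Writing the double sum as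
  \<open>\<Sum>\<^sub>j p\<^sub>j \<otimes> w\<^sub>j\<close> with \<open>w\<^sub>j = \<Sum>\<^sub>k a\<^sub>j\<^sub>k q\<^sub>k\<close>, the first bound is applied for each fixed value
  of the second variable and the second bound to each \<open>w\<^sub>j\<close>.
\<close>

lemma L2_norm_tensor_lincomb_le:
  fixes p :: "nat \<Rightarrow> 'a::euclidean_space \<Rightarrow> real" and q :: "nat \<Rightarrow> 'b::euclidean_space \<Rightarrow> real"
  assumes A: "open A" and B: "open B"
    and p: "\<And>j. p j \<in> Lp (lebesgue_on A) 2" and q: "\<And>k. q k \<in> Lp (lebesgue_on B) 2"
    and P: "\<And>b. L2_inner (lebesgue_on A) (\<lambda>x. \<Sum>j\<in>J. b j * p j x) (\<lambda>x. \<Sum>j\<in>J. b j * p j x) \<le> C * (\<Sum>j\<in>J. (b j)\<^sup>2)"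
    and Q: "\<And>b. L2_inner (lebesgue_on B) (\<lambda>y. \<Sum>k\<in>K. b k * q k y) (\<lambda>y. \<Sum>k\<in>K. b k * q k y) \<le> D * (\<Sum>k\<in>K. (b k)\<^sup>2)"
    and C: "0 \<le> C"
  shows "L2_inner (lebesgue_on (A \<times> B)) (\<lambda>z. \<Sum>jk\<in>J \<times> K. a jk * (p (fst jk) \<otimes>\<^sub>f q (snd jk)) z)
      (\<lambda>z. \<Sum>jk\<in>J \<times> K. a jk * (p (fst jk) \<otimes>\<^sub>f q (snd jk)) z) \<le> C * D * (\<Sum>jk\<in>J \<times> K. (a jk)\<^sup>2)"
proof -
  let ?P = "\<lambda>j j'. L2_inner (lebesgue_on A) (p j) (p j')"
  let ?Q = "\<lambda>k k'. L2_inner (lebesgue_on B) (q k) (q k')"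
  \<comment> \<open>The coefficient of \<open>p j\<close>, as a function of the second variable.\<close>
  define w where "w j y = (\<Sum>k\<in>K. a (j, k) * q k y)" for j y
  have w2: "w j \<in> Lp (lebesgue_on B) 2" for j
    unfolding w_def[abs_def] by (rule Lp_2_lincomb[OF q])
  have ww: "L2_inner (lebesgue_on B) (w j) (w j') = (\<Sum>k\<in>K. \<Sum>k'\<in>K. a (j, k) * a (j', k') * ?Q k k')" for j j'
    unfolding w_def[abs_def] by (rule L2_inner_lincomb_lincomb[OF q q])
  have int: "integrable (lebesgue_on B) (\<lambda>y. w j y * w j' y)" for j j'
    by (rule Lp_2_times_integrable[OF w2 w2])
  have "L2_inner (lebesgue_on (A \<times> B)) (\<lambda>z. \<Sum>jk\<in>J \<times> K. a jk * (p (fst jk) \<otimes>\<^sub>f q (snd jk)) z)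
      (\<lambda>z. \<Sum>jk\<in>J \<times> K. a jk * (p (fst jk) \<otimes>\<^sub>f q (snd jk)) z) =
      (\<Sum>jk\<in>J \<times> K. \<Sum>jk'\<in>J \<times> K. a jk * a jk' * (?P (fst jk) (fst jk') * ?Q (snd jk) (snd jk')))"
    by (subst L2_inner_lincomb_lincomb)
       (simp_all add: tensor_Lp_2[OF A B p q] L2_inner_tensor[OF A B p p q q])
  also have "\<dots> = (\<Sum>j\<in>J. \<Sum>k\<in>K. \<Sum>j'\<in>J. \<Sum>k'\<in>K. a (j, k) * a (j', k') * (?P j j' * ?Q k k'))"
    by (simp add: sum.cartesian_product')
  also have "\<dots> = (\<Sum>j\<in>J. \<Sum>j'\<in>J. \<Sum>k\<in>K. \<Sum>k'\<in>K. a (j, k) * a (j', k') * (?P j j' * ?Q k k'))"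
    by (intro sum.cong refl sum.swap)
  also have "\<dots> = (\<Sum>j\<in>J. \<Sum>j'\<in>J. ?P j j' * L2_inner (lebesgue_on B) (w j) (w j'))"
    by (simp add: ww sum_distrib_left mult_ac)
  also have "\<dots> = (\<integral>y. (\<Sum>j\<in>J. \<Sum>j'\<in>J. ?P j j' * (w j y * w j' y)) \<partial>lebesgue_on B)"
    by (simp add: L2_inner_def int)
  also have "\<dots> \<le> (\<integral>y. C * (\<Sum>j\<in>J. w j y * w j y) \<partial>lebesgue_on B)"
  proof (rule integral_mono)
    fix y
    have "(\<Sum>j\<in>J. \<Sum>j'\<in>J. ?P j j' * (w j y * w j' y)) =
        L2_inner (lebesgue_on A) (\<lambda>x. \<Sum>j\<in>J. w j y * p j x) (\<lambda>x. \<Sum>j\<in>J. w j y * p j x)"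
      by (subst L2_inner_lincomb_lincomb[OF p p]) (simp add: mult_ac)
    also have "\<dots> \<le> C * (\<Sum>j\<in>J. w j y * w j y)"
      using P[of "\<lambda>j. w j y"] by (simp add: power2_eq_square)
    finally show "(\<Sum>j\<in>J. \<Sum>j'\<in>J. ?P j j' * (w j y * w j' y)) \<le> C * (\<Sum>j\<in>J. w j y * w j y)" .
  qed (intro Bochner_Integration.integrable_sum integrable_mult_right int)+
  also have "\<dots> = C * (\<Sum>j\<in>J. L2_inner (lebesgue_on B) (w j) (w j))"
    by (simp add: L2_inner_def int)
  also have "\<dots> \<le> C * (\<Sum>j\<in>J. D * (\<Sum>k\<in>K. (a (j, k))\<^sup>2))"
    unfolding w_def[abs_def] by (intro mult_left_mono[OF _ C] sum_mono Q)
  also have "\<dots> = C * D * (\<Sum>jk\<in>J \<times> K. (a jk)\<^sup>2)"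
    by (simp add: sum.cartesian_product' sum_distrib_left mult.assoc)
  finally show ?thesis .
qed

lemma filterlim_square_finite_subsets_at_top:
  "filterlim (\<lambda>n::nat. {..<n} \<times> {..<n}) (finite_subsets_at_top UNIV) sequentially"
  unfolding filterlim_finite_subsets_at_top
proof (intro allI impI)
  fix X :: "(nat \<times> nat) set" assume X: "finite X \<and> X \<subseteq> UNIV"
  define N where "N = Suc (Max (insert 0 (fst ` X \<union> snd ` X)))"
  have N: "fst z < N \<and> snd z < N" if "z \<in> X" for z
    unfolding N_def less_Suc_eq_le using X that by (intro conjI Max_ge) auto
  show "\<forall>\<^sub>F n in sequentially. finite ({..<n} \<times> {..<n}) \<and> X \<subseteq> {..<n} \<times> {..<n} \<and> {..<n} \<times> {..<n} \<subseteq> (UNIV :: (nat \<times> nat) set)"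
    using eventually_ge_at_top[of N]
  proof eventually_elim
    case (elim n)
    have "X \<subseteq> {..<n} \<times> {..<n}"
    proof
      fix z assume "z \<in> X"
      from N[OF this] elim show "z \<in> {..<n} \<times> {..<n}" by (cases z) auto
    qed
    then show ?case by simp
  qed
qed

text \<open>
  The bound for finite tensor sums controls the differences of the square partial sums by tails of the
  series of squared coefficients, so completeness supplies the limit.
\<close>

lemma tensor_series_converges:
  fixes p :: "nat \<Rightarrow> 'a::euclidean_space \<Rightarrow> real" and q :: "nat \<Rightarrow> 'b::euclidean_space \<Rightarrow> real"
  assumes A: "open A" "bounded A" and B: "open B" "bounded B"
    and p: "\<And>j. p j \<in> Lp (lebesgue_on A) 2" and q: "\<And>k. q k \<in> Lp (lebesgue_on B) 2"
    and P: "\<And>J b. finite J \<Longrightarrow>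
      L2_inner (lebesgue_on A) (\<lambda>x. \<Sum>j\<in>J. b j * p j x) (\<lambda>x. \<Sum>j\<in>J. b j * p j x) \<le> C * (\<Sum>j\<in>J. (b j)\<^sup>2)"
    and Q: "\<And>K b. finite K \<Longrightarrow>
      L2_inner (lebesgue_on B) (\<lambda>y. \<Sum>k\<in>K. b k * q k y) (\<lambda>y. \<Sum>k\<in>K. b k * q k y) \<le> D * (\<Sum>k\<in>K. (b k)\<^sup>2)"
    and C: "0 \<le> C" and D: "0 \<le> D"
    and c: "(\<lambda>jk. (c jk)\<^sup>2) summable_on UNIV"
  obtains w where "w \<in> Lp (lebesgue_on (A \<times> B)) 2"
    "(\<lambda>n. L2_inner (lebesgue_on (A \<times> B))
      (\<lambda>z. (\<Sum>jk\<in>{..<n} \<times> {..<n}. c jk * (p (fst jk) \<otimes>\<^sub>f q (snd jk)) z) - w z)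
      (\<lambda>z. (\<Sum>jk\<in>{..<n} \<times> {..<n}. c jk * (p (fst jk) \<otimes>\<^sub>f q (snd jk)) z) - w z)) \<longlonglongrightarrow> 0"
proof -
  let ?M = "lebesgue_on (A \<times> B)"
  define S where "S n z = (\<Sum>jk\<in>{..<n} \<times> {..<n}. c jk * (p (fst jk) \<otimes>\<^sub>f q (snd jk)) z)" for n z
  define T where "T n = (\<Sum>jk\<in>{..<n} \<times> {..<n}. (c jk)\<^sup>2)" for n :: nat
  have S2: "S n \<in> Lp ?M 2" for n
    unfolding S_def[abs_def] by (rule Lp_2_lincomb[OF tensor_Lp_2[OF A(1) B(1) p q]])
  have fin: "finite_measure ?M"
    by (rule finite_measure_bounded_open[OF open_Times[OF A(1) B(1)] bounded_Times[OF A(2) B(2)]])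
  have swap: "L2_inner ?M (\<lambda>z. S m z - S n z) (\<lambda>z. S m z - S n z) =
     L2_inner ?M (\<lambda>z. S n z - S m z) (\<lambda>z. S n z - S m z)" for m n
    unfolding L2_inner_def by (rule Bochner_Integration.integral_cong) (auto simp: algebra_simps)
  have diff: "L2_inner ?M (\<lambda>z. S m z - S n z) (\<lambda>z. S m z - S n z) \<le> C * D * (T m - T n)"
    if "n \<le> m" for m n
  proof -
    let ?I = "\<lambda>n::nat. {..<n} \<times> {..<n}"
    have sub: "?I n \<subseteq> ?I m" using that by auto
    \<comment> \<open>Erasing the coefficients of the smaller square turns the difference of partial sums into
       a sum over the larger square.\<close>
    define a where "a jk = (if jk \<in> ?I n then 0 else c jk)" for jk
    have tail: "(\<Sum>jk\<in>?I m. f jk) - (\<Sum>jk\<in>?I n. f jk) = (\<Sum>jk\<in>?I m. if jk \<in> ?I n then 0 else f jk)"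
      for f :: "nat \<times> nat \<Rightarrow> real"
      using sum_diff[OF _ sub, of f] sum.mono_neutral_cong_right[of "?I m" "?I m - ?I n" "\<lambda>jk. if jk \<in> ?I n then 0 else f jk" f]
      by auto
    have "S m z - S n z = (\<Sum>jk\<in>?I m. a jk * (p (fst jk) \<otimes>\<^sub>f q (snd jk)) z)" for z
      unfolding S_def tail a_def by (intro sum.cong) auto
    moreover have "T m - T n = (\<Sum>jk\<in>?I m. (a jk)\<^sup>2)"
      unfolding T_def tail a_def by (intro sum.cong) auto
    ultimately show ?thesis
      using L2_norm_tensor_lincomb_le[OF A(1) B(1) p q P Q C, of "{..<m}" "{..<m}" a] by simp
  qed
  have "(sum (\<lambda>jk. (c jk)\<^sup>2) \<longlongrightarrow> infsum (\<lambda>jk. (c jk)\<^sup>2) UNIV) (finite_subsets_at_top UNIV)"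
    using has_sum_infsum[OF c] unfolding has_sum_def .
  from filterlim_compose[OF this filterlim_square_finite_subsets_at_top]
  have TC: "Cauchy T" unfolding T_def[abs_def] by (rule LIMSEQ_imp_Cauchy)
  have Cauchy: "\<exists>N. \<forall>m\<ge>N. \<forall>n\<ge>N. L2_inner ?M (\<lambda>z. S m z - S n z) (\<lambda>z. S m z - S n z) < \<epsilon>"
    if \<epsilon>: "0 < \<epsilon>" for \<epsilon>
  proof -
    \<comment> \<open>The summand \<open>1\<close> covers the case \<open>C * D = 0\<close>.\<close>
    have pos: "0 < \<epsilon> / (C * D + 1)" using \<epsilon> C D by (simp add: add_nonneg_pos)
    obtain N where N: "\<And>m n. m \<ge> N \<Longrightarrow> n \<ge> N \<Longrightarrow> \<bar>T m - T n\<bar> < \<epsilon> / (C * D + 1)"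
      using metric_CauchyD[OF TC pos] unfolding dist_real_def by blast
    have step: "C * D * (T m - T n) < \<epsilon>" if "m \<ge> N" "n \<ge> N" for m n
    proof -
      have "C * D * (T m - T n) \<le> C * D * (\<epsilon> / (C * D + 1))"
        using N[OF that] C D by (intro mult_left_mono) auto
      also have "\<dots> < \<epsilon>"
        using \<epsilon> C D by (simp add: pos_divide_less_eq add_nonneg_pos distrib_left)
      finally show ?thesis .
    qed
    have "L2_inner ?M (\<lambda>z. S m z - S n z) (\<lambda>z. S m z - S n z) < \<epsilon>" if "m \<ge> N" "n \<ge> N" for m n
      using diff[of n m] diff[of m n] step[OF that] step[OF that(2) that(1)] swap[of m n]
      by (cases "n \<le> m") auto
    then show ?thesis by blast
  qed
  show ?thesis
    using L2_complete[OF fin S2 Cauchy] that unfolding S_def by blast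
qed

lemma sum_L2_norm_lincomb_if_orthonormal:
  assumes r: "\<And>l j. l \<in> L \<Longrightarrow> r l j \<in> Lp M 2" and J: "finite J"
    and orth: "\<And>i j. (\<Sum>l\<in>L. L2_inner M (r l i) (r l j)) = (if i = j then 1 else 0)"
  shows "(\<Sum>l\<in>L. L2_inner M (\<lambda>x. \<Sum>j\<in>J. b j * r l j x) (\<lambda>x. \<Sum>j\<in>J. b j * r l j x)) = (\<Sum>j\<in>J. (b j)\<^sup>2)"
proof -
  have "(\<Sum>l\<in>L. L2_inner M (\<lambda>x. \<Sum>j\<in>J. b j * r l j x) (\<lambda>x. \<Sum>j\<in>J. b j * r l j x)) =
      (\<Sum>l\<in>L. \<Sum>i\<in>J. \<Sum>j\<in>J. b i * b j * L2_inner M (r l i) (r l j))"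
    by (intro sum.cong refl L2_inner_lincomb_lincomb r)
  also have "\<dots> = (\<Sum>i\<in>J. \<Sum>l\<in>L. \<Sum>j\<in>J. b i * b j * L2_inner M (r l i) (r l j))"
    by (rule sum.swap)
  also have "\<dots> = (\<Sum>i\<in>J. \<Sum>j\<in>J. b i * b j * (\<Sum>l\<in>L. L2_inner M (r l i) (r l j)))"
    unfolding sum_distrib_left by (intro sum.cong refl sum.swap)
  also have "\<dots> = (\<Sum>j\<in>J. (b j)\<^sup>2)"
    using J by (simp add: orth if_distrib[where f="(*) _"] power2_eq_square cong: if_cong)
  finally show ?thesis .
qed

text \<open>
  A family that is orthonormal for a sum of several inner products is, for each summand by itself, still
  bounded by the sum of the squared coefficients.  This covers the gradient inner product (one summand
  per direction) and the standard inner product of \<open>H1\<close> (one more summand, for the function itself).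
  The factor \<open>1\<close> is the constant expected by \<open>tensor_series_converges\<close>.
\<close>

lemma L2_norm_lincomb_le_if_orthonormal:
  assumes r: "\<And>l j. l \<in> L \<Longrightarrow> r l j \<in> Lp M 2" and L: "finite L" "l \<in> L" and J: "finite J"
    and orth: "\<And>i j. (\<Sum>l\<in>L. L2_inner M (r l i) (r l j)) = (if i = j then 1 else 0)"
  shows "L2_inner M (\<lambda>x. \<Sum>j\<in>J. b j * r l j x) (\<lambda>x. \<Sum>j\<in>J. b j * r l j x) \<le> 1 * (\<Sum>j\<in>J. (b j)\<^sup>2)"
proof -
  let ?s = "\<lambda>l. L2_inner M (\<lambda>x. \<Sum>j\<in>J. b j * r l j x) (\<lambda>x. \<Sum>j\<in>J. b j * r l j x)"
  have "?s l \<le> (\<Sum>l\<in>L. ?s l)"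
    by (rule member_le_sum[OF L(2) _ L(1)]) (simp add: L2_inner_self_nonneg)
  then show ?thesis using sum_L2_norm_lincomb_if_orthonormal[of L r M J b, OF r J orth] by simp
qed

section \<open>Energy estimates on the two factors\<close>

lemma grad_inner_eq:
  assumes \<Omega>: "open \<Omega>" "bounded \<Omega>" and u: "u \<in> H1 \<Omega>" and v: "v \<in> H1 \<Omega>"
  shows "grad_inner \<Omega> u v =
    (\<Sum>i\<in>Basis. L2_inner (lebesgue_on \<Omega>) (\<lambda>x. grad \<Omega> u x \<bullet> i) (\<lambda>x. grad \<Omega> v x \<bullet> i))"
  unfolding grad_inner_def
  by (rule integral_grad_inner_grad(2)[OF \<Omega> H1_L2_gradient_grad[OF \<Omega> u] H1_L2_gradient_grad[OF \<Omega> v]])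

lemma H1_inner_eq:
  assumes \<Omega>: "open \<Omega>" "bounded \<Omega>" and u: "u \<in> H1 \<Omega>" and v: "v \<in> H1 \<Omega>"
  shows "H1_inner \<Omega> u v = L2_inner (lebesgue_on \<Omega>) u v + grad_inner \<Omega> u v"
proof -
  note gu = H1_L2_gradient_grad[OF \<Omega> u] and gv = H1_L2_gradient_grad[OF \<Omega> v]
  show ?thesis
    unfolding H1_inner_def L2_inner_def grad_inner_def
    by (rule Bochner_Integration.integral_add[OF Lp_2_times_integrable[OF L2_gradient_Lp_2[OF gu] L2_gradient_Lp_2[OF gv]]
          integral_grad_inner_grad(1)[OF \<Omega> gu gv]])
qed

lemma H1_Lp_2: "u \<in> H1 \<Omega> \<Longrightarrow> u \<in> Lp (lebesgue_on \<Omega>) 2"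
  by (simp add: H1_def)

lemma H10_H1: "u \<in> H10 \<Omega> \<Longrightarrow> u \<in> H1 \<Omega>"
  by (simp add: H10_def)

lemma grad_component_Lp_2:
  assumes "open \<Omega>" "bounded \<Omega>" "u \<in> H1 \<Omega>" "i \<in> Basis"
  shows "(\<lambda>x. grad \<Omega> u x \<bullet> i) \<in> Lp (lebesgue_on \<Omega>) 2"
  by (rule L2_gradient_component_Lp_2[OF H1_L2_gradient_grad[OF assms(1-3)] assms(4)])

lemma positive_lower_bound_if_tends_to_infinity:
  fixes lam :: "nat \<Rightarrow> real"
  assumes pos: "\<And>k. 0 < lam k" and lim: "filterlim lam at_top sequentially"
  obtains \<mu> where "0 < \<mu>" "\<And>k. \<mu> \<le> lam k"
proof -
  obtain N where N: "\<And>k. k \<ge> N \<Longrightarrow> 1 \<le> lam k"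
    using lim unfolding filterlim_at_top eventually_sequentially by blast
  \<comment> \<open>Only finitely many terms lie below \<open>1\<close>.\<close>
  define \<mu> where "\<mu> = Min (insert 1 (lam ` {..<N}))"
  have "0 < \<mu>" using pos by (simp add: \<mu>_def)
  moreover have "\<mu> \<le> lam k" for k
  proof (cases "k < N")
    case True
    then show ?thesis unfolding \<mu>_def by (intro Min_le) auto
  next
    case False
    have "\<mu> \<le> 1" unfolding \<mu>_def by (intro Min_le) auto
    then show ?thesis using N[of k] False by simp
  qed
  ultimately show ?thesis by (rule that)
qed

text \<open>
  Here \<open>e\<close> are eigenfunctions with derivatives \<open>d\<close>, and \<open>g\<close> are the derivatives of \<open>v\<close>.  Bessel's
  inequality in the energy space reads \<open>\<Sum>\<^sub>k \<lambda>\<^sub>k \<langle>v, e\<^sub>k\<rangle>\<^sup>2 \<le> \<Sum>\<^sub>i \<langle>g\<^sub>i, g\<^sub>i\<rangle>\<close>, and \<open>\<lambda>\<^sub>k \<ge> \<mu>\<close>; Parseval's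
  inequality in \<open>L\<^sup>2\<close> then bounds the norm of \<open>v\<close>.  The energy identities enter as hypotheses, so that the
  inequality applies to linear combinations of functions whose gradients are known.
\<close>

lemma spectral_Poincare_inequality:
  assumes M: "finite_measure M"
    and e: "orthonormal_basis (Lp M 2) (L2_inner M) e"
    and d: "\<And>i k. i \<in> I \<Longrightarrow> d i k \<in> Lp M 2"
    and de: "\<And>k l. (\<Sum>i\<in>I. L2_inner M (d i k) (d i l)) = lam k * L2_inner M (e k) (e l)"
    and v: "v \<in> Lp M 2" and g: "\<And>i. i \<in> I \<Longrightarrow> g i \<in> Lp M 2"
    and dg: "\<And>k. (\<Sum>i\<in>I. L2_inner M (d i k) (g i)) = lam k * L2_inner M (e k) v"
    and \<mu>: "0 < \<mu>" "\<And>k. \<mu> \<le> lam k"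
  shows "L2_inner M v v \<le> (\<Sum>i\<in>I. L2_inner M (g i) (g i)) / \<mu>"
proof (rule L2_norm_le_if_coefficients_bounded[OF M e v])
  fix n
  let ?a = "\<lambda>k. L2_inner M v (e k)" and ?E = "\<Sum>i\<in>I. L2_inner M (g i) (g i)"
  have orth: "L2_inner M (e k) (e l) = (if k = l then 1 else 0)" for k l
    using e by (simp add: orthonormal_basis_def)
  define S where "S i x = (\<Sum>k<n. ?a k * d i k x)" for i x
  have S2: "S i \<in> Lp M 2" if "i \<in> I" for i
    unfolding S_def[abs_def] by (rule Lp_2_lincomb[OF d[OF that]])
  have SS: "(\<Sum>i\<in>I. L2_inner M (S i) (S i)) = (\<Sum>k<n. lam k * (?a k)\<^sup>2)"
  proof -
    have "(\<Sum>i\<in>I. L2_inner M (S i) (S i)) = (\<Sum>i\<in>I. \<Sum>k<n. \<Sum>l<n. ?a k * ?a l * L2_inner M (d i k) (d i l))"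
      unfolding S_def[abs_def] by (intro sum.cong refl L2_inner_lincomb_lincomb d)
    also have "\<dots> = (\<Sum>k<n. \<Sum>i\<in>I. \<Sum>l<n. ?a k * ?a l * L2_inner M (d i k) (d i l))"
      by (rule sum.swap)
    also have "\<dots> = (\<Sum>k<n. \<Sum>l<n. ?a k * ?a l * (\<Sum>i\<in>I. L2_inner M (d i k) (d i l)))"
      unfolding sum_distrib_left by (intro sum.cong refl sum.swap)
    also have "\<dots> = (\<Sum>k<n. \<Sum>l<n. if k = l then lam k * (?a k)\<^sup>2 else 0)"
      unfolding de orth by (intro sum.cong refl) (simp add: power2_eq_square)
    finally show ?thesis by simp
  qed
  have Sg: "(\<Sum>i\<in>I. L2_inner M (S i) (g i)) = (\<Sum>k<n. lam k * (?a k)\<^sup>2)"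
  proof -
    have "(\<Sum>i\<in>I. L2_inner M (S i) (g i)) = (\<Sum>i\<in>I. \<Sum>k<n. ?a k * L2_inner M (d i k) (g i))"
      unfolding S_def[abs_def] by (intro sum.cong refl L2_inner_lincomb_left d g)
    also have "\<dots> = (\<Sum>k<n. ?a k * (\<Sum>i\<in>I. L2_inner M (d i k) (g i)))"
      unfolding sum_distrib_left by (rule sum.swap)
    also have "\<dots> = (\<Sum>k<n. lam k * (?a k)\<^sup>2)"
      unfolding dg by (simp add: L2_inner_commute[of M v] power2_eq_square mult_ac)
    finally show ?thesis .
  qed
  \<comment> \<open>Bessel's inequality: expand the energy of \<open>v\<close> minus a partial sum of its expansion.\<close>
  have "0 \<le> (\<Sum>i\<in>I. L2_inner M (\<lambda>x. g i x - S i x) (\<lambda>x. g i x - S i x))"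
    by (intro sum_nonneg L2_inner_self_nonneg)
  also have "\<dots> = (\<Sum>i\<in>I. L2_inner M (g i) (g i) - 2 * L2_inner M (S i) (g i) + L2_inner M (S i) (S i))"
  proof (rule sum.cong[OF refl])
    fix i assume i: "i \<in> I"
    note gi = g[OF i] and Si = S2[OF i]
    show "L2_inner M (\<lambda>x. g i x - S i x) (\<lambda>x. g i x - S i x) =
        L2_inner M (g i) (g i) - 2 * L2_inner M (S i) (g i) + L2_inner M (S i) (S i)"
      using L2_inner_diff_left[OF gi Si Lp_2_diff[OF gi Si]] L2_inner_diff_right[OF gi Si gi]
        L2_inner_diff_right[OF gi Si Si] L2_inner_commute[of M "g i" "S i"] by simp
  qed
  also have "\<dots> = ?E - (\<Sum>k<n. lam k * (?a k)\<^sup>2)"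
    by (simp add: sum.distrib sum_subtractf sum_distrib_left[symmetric] SS Sg)
  finally have "(\<Sum>k<n. lam k * (?a k)\<^sup>2) \<le> ?E" by simp
  moreover have "\<mu> * (\<Sum>k<n. (?a k)\<^sup>2) \<le> (\<Sum>k<n. lam k * (?a k)\<^sup>2)"
    unfolding sum_distrib_left by (intro sum_mono mult_right_mono \<mu>(2)) simp
  ultimately show "(\<Sum>k<n. (?a k)\<^sup>2) \<le> ?E / \<mu>"
    using \<mu>(1) by (simp add: pos_le_divide_eq mult.commute)
qed


lemma gradient_lincomb_le:
  assumes \<Omega>: "open \<Omega>" "bounded \<Omega>" and e: "\<And>j. e j \<in> H1 \<Omega>"
    and orth: "\<And>i j. grad_inner \<Omega> (e i) (e j) = (if i = j then 1 else 0)"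
    and J: "finite J" and i: "i \<in> Basis"
  shows "L2_inner (lebesgue_on \<Omega>) (\<lambda>x. \<Sum>j\<in>J. b j * (grad \<Omega> (e j) x \<bullet> i))
      (\<lambda>x. \<Sum>j\<in>J. b j * (grad \<Omega> (e j) x \<bullet> i)) \<le> 1 * (\<Sum>j\<in>J. (b j)\<^sup>2)"
  by (rule L2_norm_lincomb_le_if_orthonormal[where r="\<lambda>i j x. grad \<Omega> (e j) x \<bullet> i" and L=Basis])
    (simp_all add: J i grad_component_Lp_2[OF \<Omega> e] orth flip: grad_inner_eq[OF \<Omega> e e])

text \<open>
  Both the functions and their partial derivatives are controlled, since the standard inner product of
  \<open>H1\<close> is the sum of the \<open>L\<^sup>2\<close> inner products of all of these.
\<close>

lemma H1_lincomb_le: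
  assumes \<Omega>: "open \<Omega>" "bounded \<Omega>" and f: "\<And>k. f k \<in> H1 \<Omega>"
    and orth: "\<And>k l. H1_inner \<Omega> (f k) (f l) = (if k = l then 1 else 0)"
    and K: "finite K"
  shows "L2_inner (lebesgue_on \<Omega>) (\<lambda>x. \<Sum>k\<in>K. b k * f k x) (\<lambda>x. \<Sum>k\<in>K. b k * f k x) \<le> 1 * (\<Sum>k\<in>K. (b k)\<^sup>2)"
    and "i \<in> Basis \<Longrightarrow> L2_inner (lebesgue_on \<Omega>) (\<lambda>x. \<Sum>k\<in>K. b k * (grad \<Omega> (f k) x \<bullet> i))
      (\<lambda>x. \<Sum>k\<in>K. b k * (grad \<Omega> (f k) x \<bullet> i)) \<le> 1 * (\<Sum>k\<in>K. (b k)\<^sup>2)"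
proof -
  \<comment> \<open>The index \<open>None\<close> stands for the function itself, \<open>Some i\<close> for its derivative in direction \<open>i\<close>.\<close>
  define r where "r l k = (case l of None \<Rightarrow> f k | Some i \<Rightarrow> (\<lambda>x. grad \<Omega> (f k) x \<bullet> i))" for l k
  let ?L = "insert None (Some ` (Basis :: 'a set))"
  have r2: "r l k \<in> Lp (lebesgue_on \<Omega>) 2" if "l \<in> ?L" for l k
    using that by (auto simp: r_def H1_Lp_2[OF f] grad_component_Lp_2[OF \<Omega> f])
  have "(\<Sum>l\<in>?L. L2_inner (lebesgue_on \<Omega>) (r l k) (r l m)) = H1_inner \<Omega> (f k) (f m)" for k m
    unfolding H1_inner_eq[OF \<Omega> f f] grad_inner_eq[OF \<Omega> f f]
    by (subst sum.insert) (auto simp: r_def sum.reindex)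
  then have ro: "(\<Sum>l\<in>?L. L2_inner (lebesgue_on \<Omega>) (r l k) (r l m)) = (if k = m then 1 else 0)" for k m
    by (simp only: orth)
  note le = L2_norm_lincomb_le_if_orthonormal[where L="?L" and r=r, OF r2 _ _ K ro]
  show "L2_inner (lebesgue_on \<Omega>) (\<lambda>x. \<Sum>k\<in>K. b k * f k x) (\<lambda>x. \<Sum>k\<in>K. b k * f k x) \<le> 1 * (\<Sum>k\<in>K. (b k)\<^sup>2)"
    using le[of None b] by (simp add: r_def)
  show "L2_inner (lebesgue_on \<Omega>) (\<lambda>x. \<Sum>k\<in>K. b k * (grad \<Omega> (f k) x \<bullet> i))
      (\<lambda>x. \<Sum>k\<in>K. b k * (grad \<Omega> (f k) x \<bullet> i)) \<le> 1 * (\<Sum>k\<in>K. (b k)\<^sup>2)" if "i \<in> Basis"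
    using le[of "Some i" b] that by (simp add: r_def)
qed

lemma eigenpair_grad_inner:
  assumes "laplacian_eigenpair \<Omega> X lam u" "h \<in> X"
  shows "grad_inner \<Omega> u h = lam * L2_inner (lebesgue_on \<Omega>) u h"
  using assms by (simp add: laplacian_eigenpair_def grad_inner_def L2_inner_def)

text \<open>
  Poincare's inequality for finite sums over a family that is orthonormal for the gradient inner
  product.  It bounds the synthesis operator of such a family in \<open>L\<^sup>2\<close>, which is needed for the derivatives
  in the directions of the second factor, where the Dirichlet functions appear undifferentiated.
\<close>

lemma Dirichlet_lincomb_le:
  assumes \<Omega>: "open \<Omega>" "bounded \<Omega>" and eig: "dirichlet_eigendata \<Omega> lam e"
    and \<mu>: "0 < \<mu>" "\<And>k. \<mu> \<le> lam k"
    and v: "\<And>j. v j \<in> H10 \<Omega>" and orth: "\<And>i j. grad_inner \<Omega> (v i) (v j) = (if i = j then 1 else 0)"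
    and J: "finite J"
  shows "L2_inner (lebesgue_on \<Omega>) (\<lambda>x. \<Sum>j\<in>J. b j * v j x) (\<lambda>x. \<Sum>j\<in>J. b j * v j x) \<le> (1 / \<mu>) * (\<Sum>j\<in>J. (b j)\<^sup>2)"
proof -
  let ?M = "lebesgue_on \<Omega>"
  have pair: "laplacian_eigenpair \<Omega> (H10 \<Omega>) (lam k) (e k)" for k
    using eig by (simp add: dirichlet_eigendata_def lists_all_eigenpairs_def)
  have basis: "orthonormal_basis (Lp ?M 2) (L2_inner ?M) e"
    using eig by (simp add: dirichlet_eigendata_def)
  have e: "e k \<in> H10 \<Omega>" for k using pair by (simp add: laplacian_eigenpair_def)
  note eH = H10_H1[OF e] and vH = H10_H1[OF v]
  note gv = grad_component_Lp_2[OF \<Omega> vH] and ge = grad_component_Lp_2[OF \<Omega> eH]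
  have "L2_inner ?M (\<lambda>x. \<Sum>j\<in>J. b j * v j x) (\<lambda>x. \<Sum>j\<in>J. b j * v j x) \<le>
    (\<Sum>i\<in>Basis. L2_inner ?M (\<lambda>x. \<Sum>j\<in>J. b j * (grad \<Omega> (v j) x \<bullet> i)) (\<lambda>x. \<Sum>j\<in>J. b j * (grad \<Omega> (v j) x \<bullet> i))) / \<mu>"
  proof (rule spectral_Poincare_inequality[OF finite_measure_bounded_open[OF \<Omega>] basis, where
        d="\<lambda>i k x. grad \<Omega> (e k) x \<bullet> i" and lam=lam])
    show "(\<Sum>i\<in>Basis. L2_inner ?M (\<lambda>x. grad \<Omega> (e k) x \<bullet> i) (\<lambda>x. grad \<Omega> (e l) x \<bullet> i)) =
        lam k * L2_inner ?M (e k) (e l)" for k l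
      using eigenpair_grad_inner[OF pair e] by (simp add: grad_inner_eq[OF \<Omega> eH eH])
    show "(\<Sum>i\<in>Basis. L2_inner ?M (\<lambda>x. grad \<Omega> (e k) x \<bullet> i) (\<lambda>x. \<Sum>j\<in>J. b j * (grad \<Omega> (v j) x \<bullet> i))) =
        lam k * L2_inner ?M (e k) (\<lambda>x. \<Sum>j\<in>J. b j * v j x)" for k
    proof -
      have "(\<Sum>i\<in>Basis. L2_inner ?M (\<lambda>x. grad \<Omega> (e k) x \<bullet> i) (\<lambda>x. \<Sum>j\<in>J. b j * (grad \<Omega> (v j) x \<bullet> i))) =
          (\<Sum>i\<in>Basis. \<Sum>j\<in>J. b j * L2_inner ?M (\<lambda>x. grad \<Omega> (e k) x \<bullet> i) (\<lambda>x. grad \<Omega> (v j) x \<bullet> i))"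
        by (intro sum.cong refl L2_inner_lincomb_right gv ge)
      also have "\<dots> = (\<Sum>j\<in>J. b j * grad_inner \<Omega> (e k) (v j))"
        unfolding grad_inner_eq[OF \<Omega> eH vH] sum_distrib_left by (rule sum.swap)
      also have "\<dots> = lam k * (\<Sum>j\<in>J. b j * L2_inner ?M (e k) (v j))"
        by (simp add: eigenpair_grad_inner[OF pair v] sum_distrib_left mult_ac)
      also have "\<dots> = lam k * L2_inner ?M (e k) (\<lambda>x. \<Sum>j\<in>J. b j * v j x)"
        by (simp add: L2_inner_lincomb_right H1_Lp_2[OF vH] H1_Lp_2[OF eH])
      finally show ?thesis .
    qed
  qed (intro Lp_2_lincomb H1_Lp_2 vH gv ge \<mu>; assumption)+
  also have "\<dots> = (1 / \<mu>) * (\<Sum>j\<in>J. (b j)\<^sup>2)"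
    by (subst sum_L2_norm_lincomb_if_orthonormal[where r="\<lambda>i j x. grad \<Omega> (v j) x \<bullet> i"])
      (simp_all add: J gv orth flip: grad_inner_eq[OF \<Omega> vH vH])
  finally show ?thesis .
qed

section \<open>Weak gradients in the tensor product space\<close>

lemma sum_Basis_prod:
  fixes F :: "'a::euclidean_space \<times> 'b::euclidean_space \<Rightarrow> real"
  shows "(\<Sum>i\<in>Basis. F i) = (\<Sum>i\<in>Basis. F (i, 0)) + (\<Sum>j\<in>Basis. F (0, j))"
  unfolding Basis_prod_def
  by (subst sum.union_disjoint) (auto simp: sum.reindex inj_on_def)

text \<open>
  The energy inner product of two tensor products separates into a term with the derivatives in the first
  factor and a term with the derivatives in the second; this is where the two eigenvalues get added.
\<close>

lemma L2_inner_tensor_gradient: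
  fixes u u' :: "'a::euclidean_space \<Rightarrow> real" and v v' :: "'b::euclidean_space \<Rightarrow> real"
  assumes A: "open A" and B: "open B"
    and g: "L2_gradient A u g" and h: "L2_gradient B v h"
    and g': "L2_gradient A u' g'" and h': "L2_gradient B v' h'"
  shows "(\<Sum>i\<in>Basis. L2_inner (lebesgue_on (A \<times> B))
      (\<lambda>z. tensor_gradient u g v h z \<bullet> i) (\<lambda>z. tensor_gradient u' g' v' h' z \<bullet> i)) =
    (\<Sum>i\<in>Basis. L2_inner (lebesgue_on A) (\<lambda>x. g x \<bullet> i) (\<lambda>x. g' x \<bullet> i)) * L2_inner (lebesgue_on B) v v' +
    L2_inner (lebesgue_on A) u u' * (\<Sum>j\<in>Basis. L2_inner (lebesgue_on B) (\<lambda>y. h y \<bullet> j) (\<lambda>y. h' y \<bullet> j))"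
proof -
  have 1: "L2_inner (lebesgue_on (A \<times> B)) ((\<lambda>x. g x \<bullet> i) \<otimes>\<^sub>f v) ((\<lambda>x. g' x \<bullet> i) \<otimes>\<^sub>f v') =
      L2_inner (lebesgue_on A) (\<lambda>x. g x \<bullet> i) (\<lambda>x. g' x \<bullet> i) * L2_inner (lebesgue_on B) v v'" if "i \<in> Basis" for i
    by (intro L2_inner_tensor[OF A B] L2_gradient_component_Lp_2[OF g that] L2_gradient_component_Lp_2[OF g' that]
        L2_gradient_Lp_2[OF h] L2_gradient_Lp_2[OF h'])
  have 2: "L2_inner (lebesgue_on (A \<times> B)) (u \<otimes>\<^sub>f (\<lambda>y. h y \<bullet> j)) (u' \<otimes>\<^sub>f (\<lambda>y. h' y \<bullet> j)) =
      L2_inner (lebesgue_on A) u u' * L2_inner (lebesgue_on B) (\<lambda>y. h y \<bullet> j) (\<lambda>y. h' y \<bullet> j)" if "j \<in> Basis" for j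
    by (intro L2_inner_tensor[OF A B] L2_gradient_component_Lp_2[OF h that] L2_gradient_component_Lp_2[OF h' that]
        L2_gradient_Lp_2[OF g] L2_gradient_Lp_2[OF g'])
  show ?thesis
    unfolding sum_Basis_prod tensor_gradient_fst tensor_gradient_snd
    by (simp add: 1 2 sum_distrib_left sum_distrib_right)
qed

text \<open>
  Elements of \<open>V_space\<close> are defined by an expansion that converges only in \<open>L\<^sup>2\<close>.  Square-summability of
  the coefficients makes the termwise gradients converge as well: in a direction of the first factor
  the relevant families are the derivatives of \<open>e\<close> and the functions \<open>f\<close>, both bounded by orthonormality;
  in a direction of the second factor they are \<open>e\<close>, bounded by Poincare's inequality, and the derivatives
  of \<open>f\<close>.  Closedness of the weak gradient identifies the limit with the gradient of \<open>h\<close>.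
\<close>

lemma V_space_L2_gradient:
  fixes A :: "'a::euclidean_space set" and B :: "'b::euclidean_space set"
  assumes A: "open A" "bounded A" and B: "open B" "bounded B"
    and eig: "dirichlet_eigendata A lam e1" and h: "h \<in> V_space A B"
  obtains e f c H where "\<And>j. e j \<in> H10 A" "\<And>k. f k \<in> H1 B" "L2_gradient (A \<times> B) h H"
    "(\<lambda>n. L2_inner (lebesgue_on (A \<times> B))
      (\<lambda>z. (\<Sum>jk\<in>{..<n} \<times> {..<n}. c jk * (e (fst jk) \<otimes>\<^sub>f f (snd jk)) z) - h z)
      (\<lambda>z. (\<Sum>jk\<in>{..<n} \<times> {..<n}. c jk * (e (fst jk) \<otimes>\<^sub>f f (snd jk)) z) - h z)) \<longlonglongrightarrow> 0"
    "\<And>i. i \<in> Basis \<Longrightarrow> (\<lambda>n. L2_inner (lebesgue_on (A \<times> B))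
      (\<lambda>z. (\<Sum>jk\<in>{..<n} \<times> {..<n}. c jk * (tensor_gradient (e (fst jk)) (grad A (e (fst jk)))
        (f (snd jk)) (grad B (f (snd jk))) z \<bullet> i)) - H z \<bullet> i)
      (\<lambda>z. (\<Sum>jk\<in>{..<n} \<times> {..<n}. c jk * (tensor_gradient (e (fst jk)) (grad A (e (fst jk)))
        (f (snd jk)) (grad B (f (snd jk))) z \<bullet> i)) - H z \<bullet> i)) \<longlonglongrightarrow> 0"
proof -
  let ?M = "lebesgue_on (A \<times> B)" and ?I = "\<lambda>n::nat. {..<n} \<times> {..<n}"
  have AB: "open (A \<times> B)" "bounded (A \<times> B)"
    using A B by (auto intro: open_Times bounded_Times)
  obtain e f c where e: "orthonormal_basis (H10 A) (grad_inner A) e"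
    and f: "orthonormal_basis (H1 B) (H1_inner B) f"
    and c: "(\<lambda>jk. (c jk)\<^sup>2) summable_on UNIV"
    and lim: "((\<lambda>F. Lp_norm ?M 2 (\<lambda>z. h z - (\<Sum>(j, k)\<in>F. c (j, k) * (e j \<otimes>\<^sub>f f k) z))) \<longlongrightarrow> 0)
      (finite_subsets_at_top UNIV)"
    and h2: "h \<in> Lp ?M 2"
    using h unfolding V_space_def hilbert_tensor_def by blast
  have eX: "e j \<in> H10 A" and fX: "f k \<in> H1 B"
    and eo: "grad_inner A (e i) (e j) = (if i = j then 1 else 0)"
    and fo: "H1_inner B (f k) (f l) = (if k = l then 1 else 0)" for i j k l
    using e f by (auto simp: orthonormal_basis_def)
  note eH = H10_H1[OF eX]
  note ge = H1_L2_gradient_grad[OF A eH] and gf = H1_L2_gradient_grad[OF B fX]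
  define G where "G jk = tensor_gradient (e (fst jk)) (grad A (e (fst jk))) (f (snd jk)) (grad B (f (snd jk)))" for jk
  define S where "S n z = (\<Sum>jk\<in>?I n. c jk * (e (fst jk) \<otimes>\<^sub>f f (snd jk)) z)" for n z
  have SG: "L2_gradient (A \<times> B) (S n) (\<lambda>z. \<Sum>jk\<in>?I n. c jk *\<^sub>R G jk z)" for n
    unfolding S_def[abs_def] G_def
    by (rule L2_gradient_lincomb[OF AB]) (rule L2_gradient_tensor[OF A B ge gf])
  have Sh: "(\<lambda>n. L2_inner ?M (\<lambda>z. S n z - h z) (\<lambda>z. S n z - h z)) \<longlonglongrightarrow> 0"
  proof -
    have "(\<lambda>n. Lp_norm ?M 2 (\<lambda>z. h z - (\<Sum>(j, k)\<in>?I n. c (j, k) * (e j \<otimes>\<^sub>f f k) z))) \<longlonglongrightarrow> 0"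
      by (rule filterlim_compose[OF lim filterlim_square_finite_subsets_at_top])
    then have "(\<lambda>n. sqrt (L2_inner ?M (\<lambda>z. h z - S n z) (\<lambda>z. h z - S n z))) \<longlonglongrightarrow> 0"
      by (simp add: Lp_norm_2 S_def case_prod_unfold)
    then have "(\<lambda>n. (sqrt (L2_inner ?M (\<lambda>z. h z - S n z) (\<lambda>z. h z - S n z)))\<^sup>2) \<longlonglongrightarrow> 0\<^sup>2"
      by (rule tendsto_power)
    moreover have "(sqrt (L2_inner ?M (\<lambda>z. h z - S n z) (\<lambda>z. h z - S n z)))\<^sup>2 =
        L2_inner ?M (\<lambda>z. S n z - h z) (\<lambda>z. S n z - h z)" for n
    proof -
      have "L2_inner ?M (\<lambda>z. h z - S n z) (\<lambda>z. h z - S n z) = L2_inner ?M (\<lambda>z. S n z - h z) (\<lambda>z. S n z - h z)"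
        unfolding L2_inner_def by (rule Bochner_Integration.integral_cong) (auto simp: algebra_simps)
      then show ?thesis by (simp add: L2_inner_self_nonneg)
    qed
    ultimately show ?thesis by simp
  qed
  have lam: "\<And>k. 0 < lam k" "filterlim lam at_top sequentially"
    using eig by (auto simp: dirichlet_eigendata_def)
  obtain \<mu> where \<mu>: "0 < \<mu>" "\<And>k. \<mu> \<le> lam k"
    by (rule positive_lower_bound_if_tends_to_infinity[OF lam]) (rule that)
  then have \<mu>0: "0 \<le> 1 / \<mu>" by simp
  have "\<forall>i\<in>Basis. \<exists>w. w \<in> Lp ?M 2 \<and> (\<lambda>n. L2_inner ?M (\<lambda>z. (\<Sum>jk\<in>?I n. c jk * (G jk z \<bullet> i)) - w z)
      (\<lambda>z. (\<Sum>jk\<in>?I n. c jk * (G jk z \<bullet> i)) - w z)) \<longlonglongrightarrow> 0"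
  proof (rule ballI)
    fix i :: "'a \<times> 'b" assume i: "i \<in> Basis"
    consider j where "j \<in> Basis" "i = (j, 0)" | j where "j \<in> Basis" "i = (0, j)"
      using i unfolding Basis_prod_def by blast
    then show "\<exists>w. w \<in> Lp ?M 2 \<and> (\<lambda>n. L2_inner ?M (\<lambda>z. (\<Sum>jk\<in>?I n. c jk * (G jk z \<bullet> i)) - w z)
      (\<lambda>z. (\<Sum>jk\<in>?I n. c jk * (G jk z \<bullet> i)) - w z)) \<longlonglongrightarrow> 0"
    proof cases
      case 1
      have comp: "G jk z \<bullet> i = ((\<lambda>x. grad A (e (fst jk)) x \<bullet> j) \<otimes>\<^sub>f f (snd jk)) z" for jk z
        unfolding G_def 1(2) by (rule fun_cong[OF tensor_gradient_fst])
      show ?thesis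
        unfolding comp
        by (rule tensor_series_converges[OF A B grad_component_Lp_2[OF A eH 1(1)] H1_Lp_2[OF fX]
              gradient_lincomb_le[OF A eH eo _ 1(1)] H1_lincomb_le(1)[OF B fX fo] zero_le_one zero_le_one c])
          (assumption | intro exI conjI)+
    next
      case 2
      have comp: "G jk z \<bullet> i = (e (fst jk) \<otimes>\<^sub>f (\<lambda>y. grad B (f (snd jk)) y \<bullet> j)) z" for jk z
        unfolding G_def 2(2) by (rule fun_cong[OF tensor_gradient_snd])
      show ?thesis
        unfolding comp
        by (rule tensor_series_converges[OF A B H1_Lp_2[OF eH] grad_component_Lp_2[OF B fX 2(1)]
              Dirichlet_lincomb_le[OF A eig \<mu> eX eo] H1_lincomb_le(2)[OF B fX fo _ 2(1)] \<mu>0 zero_le_one c])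
          (assumption | intro exI conjI)+
    qed
  qed
  from bchoice[OF this] obtain w where w': "\<forall>i\<in>Basis. w i \<in> Lp ?M 2 \<and> (\<lambda>n. L2_inner ?M (\<lambda>z. (\<Sum>jk\<in>?I n. c jk * (G jk z \<bullet> i)) - w i z)
      (\<lambda>z. (\<Sum>jk\<in>?I n. c jk * (G jk z \<bullet> i)) - w i z)) \<longlonglongrightarrow> 0"
    by (rule exE)
  note w = bspec[OF w', THEN conjunct1] bspec[OF w', THEN conjunct2]
  define H where "H z = (\<Sum>i\<in>Basis. w i z *\<^sub>R i)" for z
  have Hi: "H z \<bullet> i = w i z" if "i \<in> Basis" for z i
    using that by (simp add: H_def)
  have "L2_gradient (A \<times> B) h H"
  proof (rule L2_gradient_limit[OF AB SG h2 _ Sh])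
    show "(\<lambda>x. H x \<bullet> i) \<in> Lp ?M 2" if "i \<in> Basis" for i
      using w(1)[OF that] by (simp add: Hi[OF that])
    show "(\<lambda>n. L2_inner ?M (\<lambda>z. (\<Sum>jk\<in>?I n. c jk *\<^sub>R G jk z) \<bullet> i - H z \<bullet> i)
        (\<lambda>z. (\<Sum>jk\<in>?I n. c jk *\<^sub>R G jk z) \<bullet> i - H z \<bullet> i)) \<longlonglongrightarrow> 0" if "i \<in> Basis" for i
      using w(2)[OF that] by (simp add: Hi[OF that] inner_sum_left)
  qed
  moreover have "(\<lambda>n. L2_inner ?M (\<lambda>z. (\<Sum>jk\<in>?I n. c jk * (G jk z \<bullet> i)) - H z \<bullet> i)
      (\<lambda>z. (\<Sum>jk\<in>?I n. c jk * (G jk z \<bullet> i)) - H z \<bullet> i)) \<longlonglongrightarrow> 0" if "i \<in> Basis" for i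
    unfolding Hi[OF that] by (rule w(2)[OF that])
  ultimately show ?thesis
    by (rule that[where e=e and f=f and c=c and H=H, OF eX fX _ Sh[unfolded S_def], unfolded G_def[symmetric]])
qed

section \<open>The Dirichlet--Neumann eigenproblem on the product\<close>

text \<open>
  For \<open>h = e \<otimes> f\<close> the energy inner product separates, and the two one-factor equations give
  \<open>l \<langle>u, e\<rangle> \<langle>v, f\<rangle> + \<langle>u, e\<rangle> m \<langle>v, f\<rangle>\<close>.  Linearity and passage to the limit along the expansion extend
  the equation to all of \<open>V_space\<close>.
\<close>

lemma DNL_weak_equation:
  fixes A :: "'a::euclidean_space set" and B :: "'b::euclidean_space set"
  assumes A: "open A" "bounded A" and B: "open B" "bounded B"
    and eig: "dirichlet_eigendata A lam1 e1"
    and u: "laplacian_eigenpair A (H10 A) l u" and v: "laplacian_eigenpair B (H1 B) m v"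
    and h: "h \<in> V_space A B"
  shows "(\<integral>z. grad (A \<times> B) (u \<otimes>\<^sub>f v) z \<bullet> grad (A \<times> B) h z \<partial>lebesgue_on (A \<times> B)) =
    (l + m) * (\<integral>z. (u \<otimes>\<^sub>f v) z * h z \<partial>lebesgue_on (A \<times> B))"
proof -
  let ?M = "lebesgue_on (A \<times> B)" and ?I = "\<lambda>n::nat. {..<n} \<times> {..<n}"
  have AB: "open (A \<times> B)" "bounded (A \<times> B)"
    using A B by (auto intro: open_Times bounded_Times)
  obtain e f c H where e: "\<And>j. e j \<in> H10 A" and f: "\<And>k. f k \<in> H1 B" and H: "L2_gradient (A \<times> B) h H"
    and limh: "(\<lambda>n. L2_inner ?M (\<lambda>z. (\<Sum>jk\<in>?I n. c jk * (e (fst jk) \<otimes>\<^sub>f f (snd jk)) z) - h z)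
      (\<lambda>z. (\<Sum>jk\<in>?I n. c jk * (e (fst jk) \<otimes>\<^sub>f f (snd jk)) z) - h z)) \<longlonglongrightarrow> 0"
    and limH: "\<And>i. i \<in> Basis \<Longrightarrow> (\<lambda>n. L2_inner ?M
      (\<lambda>z. (\<Sum>jk\<in>?I n. c jk * (tensor_gradient (e (fst jk)) (grad A (e (fst jk)))
        (f (snd jk)) (grad B (f (snd jk))) z \<bullet> i)) - H z \<bullet> i)
      (\<lambda>z. (\<Sum>jk\<in>?I n. c jk * (tensor_gradient (e (fst jk)) (grad A (e (fst jk)))
        (f (snd jk)) (grad B (f (snd jk))) z \<bullet> i)) - H z \<bullet> i)) \<longlonglongrightarrow> 0"
    by (rule V_space_L2_gradient[OF A B eig h]) (rule that)
  define E where "E jk = e (fst jk) \<otimes>\<^sub>f f (snd jk)" for jk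
  define G where "G jk = tensor_gradient (e (fst jk)) (grad A (e (fst jk))) (f (snd jk)) (grad B (f (snd jk)))" for jk
  define U where "U = tensor_gradient u (grad A u) v (grad B v)"
  have uX: "u \<in> H10 A" and vX: "v \<in> H1 B"
    using u v by (auto simp: laplacian_eigenpair_def)
  note uH = H10_H1[OF uX] and eH = H10_H1[OF e]
  note gu = H1_L2_gradient_grad[OF A uH] and gv = H1_L2_gradient_grad[OF B vX]
    and ge = H1_L2_gradient_grad[OF A eH] and gf = H1_L2_gradient_grad[OF B f]
  have gU: "L2_gradient (A \<times> B) (u \<otimes>\<^sub>f v) U"
    unfolding U_def by (rule L2_gradient_tensor[OF A B gu gv])
  have gG: "L2_gradient (A \<times> B) (E jk) (G jk)" for jk
    unfolding E_def G_def by (rule L2_gradient_tensor[OF A B ge gf])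
  note U2 = L2_gradient_component_Lp_2[OF gU] and G2 = L2_gradient_component_Lp_2[OF gG]
    and H2 = L2_gradient_component_Lp_2[OF H]
    and uv2 = L2_gradient_Lp_2[OF gU] and E2 = L2_gradient_Lp_2[OF gG] and h2 = L2_gradient_Lp_2[OF H]
  have single: "(\<Sum>i\<in>Basis. L2_inner ?M (\<lambda>z. G jk z \<bullet> i) (\<lambda>z. U z \<bullet> i)) = (l + m) * L2_inner ?M (E jk) (u \<otimes>\<^sub>f v)" for jk
  proof -
    have "(\<Sum>i\<in>Basis. L2_inner ?M (\<lambda>z. G jk z \<bullet> i) (\<lambda>z. U z \<bullet> i)) =
        (\<Sum>i\<in>Basis. L2_inner ?M (\<lambda>z. U z \<bullet> i) (\<lambda>z. G jk z \<bullet> i))"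
      by (intro sum.cong refl L2_inner_commute)
    also have "\<dots> = grad_inner A u (e (fst jk)) * L2_inner (lebesgue_on B) v (f (snd jk)) +
        L2_inner (lebesgue_on A) u (e (fst jk)) * grad_inner B v (f (snd jk))"
      unfolding U_def G_def L2_inner_tensor_gradient[OF A(1) B(1) gu gv ge gf]
        grad_inner_eq[OF A uH eH] grad_inner_eq[OF B vX f] ..
    also have "\<dots> = (l + m) * (L2_inner (lebesgue_on A) u (e (fst jk)) * L2_inner (lebesgue_on B) v (f (snd jk)))"
      unfolding eigenpair_grad_inner[OF u e] eigenpair_grad_inner[OF v f] by (simp add: algebra_simps)
    also have "\<dots> = (l + m) * L2_inner ?M (E jk) (u \<otimes>\<^sub>f v)"
      unfolding E_def L2_inner_commute[of ?M _ "u \<otimes>\<^sub>f v"]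
      by (subst L2_inner_tensor[OF A(1) B(1)]) (simp_all add: H1_Lp_2 uH vX eH f)
    finally show ?thesis .
  qed
  have lhs: "(\<lambda>n. \<Sum>i\<in>Basis. L2_inner ?M (\<lambda>z. \<Sum>jk\<in>?I n. c jk * (G jk z \<bullet> i)) (\<lambda>z. U z \<bullet> i)) \<longlonglongrightarrow>
      (\<Sum>i\<in>Basis. L2_inner ?M (\<lambda>z. H z \<bullet> i) (\<lambda>z. U z \<bullet> i))"
    by (intro tendsto_sum L2_inner_tendsto[OF Lp_2_lincomb[OF G2] H2 U2 limH[folded G_def]])
  have rhs: "(\<lambda>n. (l + m) * L2_inner ?M (\<lambda>z. \<Sum>jk\<in>?I n. c jk * E jk z) (u \<otimes>\<^sub>f v)) \<longlonglongrightarrow>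
      (l + m) * L2_inner ?M h (u \<otimes>\<^sub>f v)"
    by (intro tendsto_mult_left L2_inner_tendsto[OF Lp_2_lincomb[OF E2] h2 uv2 limh[folded E_def]])
  have "(\<Sum>i\<in>Basis. L2_inner ?M (\<lambda>z. \<Sum>jk\<in>?I n. c jk * (G jk z \<bullet> i)) (\<lambda>z. U z \<bullet> i)) =
      (l + m) * L2_inner ?M (\<lambda>z. \<Sum>jk\<in>?I n. c jk * E jk z) (u \<otimes>\<^sub>f v)" for n
  proof -
    have "(\<Sum>i\<in>Basis. L2_inner ?M (\<lambda>z. \<Sum>jk\<in>?I n. c jk * (G jk z \<bullet> i)) (\<lambda>z. U z \<bullet> i)) =
        (\<Sum>i\<in>Basis. \<Sum>jk\<in>?I n. c jk * L2_inner ?M (\<lambda>z. G jk z \<bullet> i) (\<lambda>z. U z \<bullet> i))"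
      by (intro sum.cong refl L2_inner_lincomb_left G2 U2)
    also have "\<dots> = (\<Sum>jk\<in>?I n. c jk * (\<Sum>i\<in>Basis. L2_inner ?M (\<lambda>z. G jk z \<bullet> i) (\<lambda>z. U z \<bullet> i)))"
      unfolding sum_distrib_left by (rule sum.swap)
    also have "\<dots> = (\<Sum>jk\<in>?I n. (l + m) * (c jk * L2_inner ?M (E jk) (u \<otimes>\<^sub>f v)))"
      unfolding single by (intro sum.cong refl) (simp only: mult_ac)
    also have "\<dots> = (l + m) * L2_inner ?M (\<lambda>z. \<Sum>jk\<in>?I n. c jk * E jk z) (u \<otimes>\<^sub>f v)"
      unfolding sum_distrib_left[symmetric] by (subst L2_inner_lincomb_left) (simp_all add: E2 uv2)
    finally show ?thesis .
  qed
  with lhs rhs have "(\<Sum>i\<in>Basis. L2_inner ?M (\<lambda>z. H z \<bullet> i) (\<lambda>z. U z \<bullet> i)) = (l + m) * L2_inner ?M h (u \<otimes>\<^sub>f v)"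
    using LIMSEQ_unique by simp
  then show ?thesis
    unfolding integral_grad_inner_grad(2)[OF AB gU H] L2_inner_commute[of ?M "\<lambda>z. U z \<bullet> _"]
    by (simp add: L2_inner_def mult.commute)
qed

text \<open>
  The eigenfunctions are, up to normalisation of the first factor, elements of orthonormal bases of the
  two spaces, so the expansion has a single term.
\<close>

lemma Dirichlet_Neumann_tensor_in_V_space:
  fixes A :: "'a::euclidean_space set" and B :: "'b::euclidean_space set"
  assumes A: "open A" "bounded A" and B: "open B" "bounded B"
    and eig1: "dirichlet_eigendata A lam1 e1" and eig2: "neumann_eigendata B lam2 f2"
  shows "e1 j \<otimes>\<^sub>f f2 k \<in> V_space A B"
proof -
  let ?M = "lebesgue_on (A \<times> B)"
  define e where "e j x = lam1 j powr (- 1 / 2) * e1 j x" for j x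
  \<comment> \<open>The coefficient undoes the normalisation of \<open>e\<close>.\<close>
  define c where "c jk = (if jk = (j, k) then lam1 j powr (1 / 2) else 0)" for jk
  have pos: "0 < lam1 j" and e: "orthonormal_basis (H10 A) (grad_inner A) e"
    and eL: "e1 j \<in> Lp (lebesgue_on A) 2"
    using eig1 unfolding e_def[abs_def] dirichlet_eigendata_def orthonormal_basis_def[of "Lp _ 2"] by blast+
  have f: "orthonormal_basis (H1 B) (H1_inner B) f2"
    using eig2 by (simp add: neumann_eigendata_def)
  then have fL: "f2 k \<in> Lp (lebesgue_on B) 2" by (simp add: orthonormal_basis_def H1_Lp_2)
  have c2: "(\<lambda>jk. (c jk)\<^sup>2) summable_on UNIV"
    by (rule finite_nonzero_values_imp_summable_on) (simp add: c_def)
  have eq: "(\<Sum>(j', k')\<in>F. c (j', k') * (e j' \<otimes>\<^sub>f f2 k') z) = (e1 j \<otimes>\<^sub>f f2 k) z"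
    if F: "finite F" "(j, k) \<in> F" for F z
  proof -
    have "(\<Sum>(j', k')\<in>F. c (j', k') * (e j' \<otimes>\<^sub>f f2 k') z) =
        (\<Sum>jk\<in>F. if jk = (j, k) then lam1 j powr (1 / 2) * (e j \<otimes>\<^sub>f f2 k) z else 0)"
      by (intro sum.cong refl) (auto simp: c_def split: if_splits)
    also have "\<dots> = lam1 j powr (1 / 2) * (e j \<otimes>\<^sub>f f2 k) z" using F by simp
    also have "\<dots> = (lam1 j powr (1 / 2) * lam1 j powr (- 1 / 2)) * (e1 j \<otimes>\<^sub>f f2 k) z"
      by (simp add: tensor_def e_def case_prod_unfold)
    also have "lam1 j powr (1 / 2) * lam1 j powr (- 1 / 2) = 1"
      using pos by (simp flip: powr_add)
    finally show ?thesis by simp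
  qed
  have "((\<lambda>F. Lp_norm ?M 2 (\<lambda>z. (e1 j \<otimes>\<^sub>f f2 k) z - (\<Sum>(j', k')\<in>F. c (j', k') * (e j' \<otimes>\<^sub>f f2 k') z))) \<longlongrightarrow> 0)
      (finite_subsets_at_top UNIV)"
  proof (rule tendsto_eventually)
    have "\<forall>\<^sub>F F in finite_subsets_at_top UNIV. finite F \<and> {(j, k)} \<subseteq> F \<and> F \<subseteq> UNIV"
      unfolding eventually_finite_subsets_at_top by (intro exI[of _ "{(j, k)}"]) auto
    then show "\<forall>\<^sub>F F in finite_subsets_at_top UNIV.
        Lp_norm ?M 2 (\<lambda>z. (e1 j \<otimes>\<^sub>f f2 k) z - (\<Sum>(j', k')\<in>F. c (j', k') * (e j' \<otimes>\<^sub>f f2 k') z)) = 0"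
      by eventually_elim (simp add: eq Lp_norm_def)
  qed
  moreover have "e1 j \<otimes>\<^sub>f f2 k \<in> Lp ?M 2" by (rule tensor_Lp_2[OF A(1) B(1) eL fL])
  ultimately show ?thesis
    unfolding V_space_def hilbert_tensor_def using e f c2 by blast
qed

text \<open>
  Orthonormality in \<open>H1\<close> together with the eigenvalue equation determines the \<open>L\<^sup>2\<close> inner products.
\<close>

lemma Neumann_L2_inner:
  assumes \<Omega>: "open \<Omega>" "bounded \<Omega>" and eig: "neumann_eigendata \<Omega> lam f"
  shows "(1 + lam k) * L2_inner (lebesgue_on \<Omega>) (f k) (f l) = (if k = l then 1 else 0)"
proof -
  have pair: "laplacian_eigenpair \<Omega> (H1 \<Omega>) (lam k) (f k)" for k
    using eig by (simp add: neumann_eigendata_def lists_all_eigenpairs_def)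
  then have f: "f k \<in> H1 \<Omega>" for k by (simp add: laplacian_eigenpair_def)
  have "H1_inner \<Omega> (f k) (f l) = (if k = l then 1 else 0)"
    using eig by (simp add: neumann_eigendata_def orthonormal_basis_def)
  then show ?thesis
    by (simp add: H1_inner_eq[OF \<Omega> f f] eigenpair_grad_inner[OF pair f] algebra_simps)
qed

theorem theorem8p1:
  fixes \<Omega>1 :: "(real ^ 'n) set" and \<Omega>2 :: "(real ^ 'm) set"
    and lam1 lam2 :: "nat \<Rightarrow> real"
    and e1 :: "nat \<Rightarrow> real ^ 'n \<Rightarrow> real" and f2 :: "nat \<Rightarrow> real ^ 'm \<Rightarrow> real"
    and u :: "nat \<times> nat \<Rightarrow> (real ^ 'n) \<times> (real ^ 'm) \<Rightarrow> real"
  assumes "region \<Omega>1" "cond_B1 \<Omega>1" "cond_B2 \<Omega>1"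
    and "region \<Omega>2" "cond_B1 \<Omega>2" "cond_B2 \<Omega>2"
    and "dirichlet_eigendata \<Omega>1 lam1 e1"
    and "neumann_eigendata \<Omega>2 lam2 f2"
    and u_def: "\<And>j k. u (j, k) = e1 j \<otimes>\<^sub>f f2 k"
  shows "(\<forall>j k. DNL_eigenpair \<Omega>1 \<Omega>2 (lam1 j + lam2 k) (u (j, k))) \<and>
    orthogonal_family (V_space \<Omega>1 \<Omega>2) (product_grad_inner \<Omega>1 \<Omega>2) u \<and>
    orthogonal_family (Lp (lebesgue_on (\<Omega>1 \<times> \<Omega>2)) 2) (L2_inner (lebesgue_on (\<Omega>1 \<times> \<Omega>2))) u"
proof -
  let ?M = "lebesgue_on (\<Omega>1 \<times> \<Omega>2)"
  have A: "open \<Omega>1" "bounded \<Omega>1" and B: "open \<Omega>2" "bounded \<Omega>2"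
    using assms(1,2,4,5) by (auto simp: region_def cond_B1_def)
  note eig1 = assms(7) and eig2 = assms(8)
  have pair1: "laplacian_eigenpair \<Omega>1 (H10 \<Omega>1) (lam1 j) (e1 j)" for j
    using eig1 by (simp add: dirichlet_eigendata_def lists_all_eigenpairs_def)
  have pair2: "laplacian_eigenpair \<Omega>2 (H1 \<Omega>2) (lam2 k) (f2 k)" for k
    using eig2 by (simp add: neumann_eigendata_def lists_all_eigenpairs_def)
  have e2: "e1 j \<in> Lp (lebesgue_on \<Omega>1) 2" and f2: "f2 k \<in> Lp (lebesgue_on \<Omega>2) 2" for j k
    using pair1 pair2 by (auto simp: laplacian_eigenpair_def intro: H1_Lp_2 H10_H1)
  have uV: "u jk \<in> V_space \<Omega>1 \<Omega>2" for jk
    using Dirichlet_Neumann_tensor_in_V_space[OF A B eig1 eig2] u_def by (cases jk) simp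
  have uL: "u jk \<in> Lp ?M 2" for jk
    using tensor_Lp_2[OF A(1) B(1) e2 f2] u_def by (cases jk) simp
  have inner: "L2_inner ?M (u (j, k)) (u (j', k')) =
      (if j = j' then 1 else 0) * L2_inner (lebesgue_on \<Omega>2) (f2 k) (f2 k')" for j k j' k'
    using eig1 by (simp add: u_def L2_inner_tensor[OF A(1) B(1) e2 e2 f2 f2]
        dirichlet_eigendata_def orthonormal_basis_def)
  have Neumann: "(1 + lam2 k) * L2_inner (lebesgue_on \<Omega>2) (f2 k) (f2 l) = (if k = l then 1 else 0)" for k l
    by (rule Neumann_L2_inner[OF B eig2])
  have eigen: "DNL_eigenpair \<Omega>1 \<Omega>2 (lam1 j + lam2 k) (u (j, k))" for j k
    unfolding laplacian_eigenpair_def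
  proof (intro conjI ballI)
    show "u (j, k) \<in> V_space \<Omega>1 \<Omega>2" by (rule uV)
    \<comment> \<open>The \<open>L\<^sup>2\<close> norms of \<open>u (j, k)\<close> and \<open>f2 k\<close> agree, and the latter is positive.\<close>
    show "\<not> (AE z in ?M. u (j, k) z = 0)"
    proof
      assume "AE z in ?M. u (j, k) z = 0"
      then have "AE z in ?M. u (j, k) z * u (j, k) z = 0" by eventually_elim simp
      then have "L2_inner ?M (u (j, k)) (u (j, k)) = 0"
        unfolding L2_inner_def by (rule integral_eq_zero_AE)
      then show False using Neumann[of k k] by (simp add: inner)
    qed
    show "(\<integral>z. grad (\<Omega>1 \<times> \<Omega>2) (u (j, k)) z \<bullet> grad (\<Omega>1 \<times> \<Omega>2) h z \<partial>?M) =
        (lam1 j + lam2 k) * (\<integral>z. u (j, k) z * h z \<partial>?M)" if "h \<in> V_space \<Omega>1 \<Omega>2" for h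
      unfolding u_def by (rule DNL_weak_equation[OF A B eig1 pair1 pair2 that])
  qed
  have lam2_pos: "0 < 1 + lam2 k" for k
    using eig2 by (simp add: neumann_eigendata_def add_pos_nonneg)
  have orth: "L2_inner ?M (u jk) (u jk') = 0" if "jk \<noteq> jk'" for jk jk'
  proof -
    obtain j k j' k' where jk: "jk = (j, k)" "jk' = (j', k')" by (metis surj_pair)
    show ?thesis
    proof (cases "j = j'")
      case True
      then have "k \<noteq> k'" using that jk by simp
      then have "L2_inner (lebesgue_on \<Omega>2) (f2 k) (f2 k') = 0"
        using Neumann[of k k'] lam2_pos[of k] by simp
      then show ?thesis by (simp add: jk inner)
    qed (simp add: jk inner)
  qed
  \<comment> \<open>Testing the weak equation with another eigenfunction reduces energy orthogonality to
     \<open>L\<^sup>2\<close> orthogonality.\<close>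
  have "product_grad_inner \<Omega>1 \<Omega>2 (u jk) (u jk') = 0" if "jk \<noteq> jk'" for jk jk'
  proof -
    have "product_grad_inner \<Omega>1 \<Omega>2 (u jk) (u jk') =
        (\<integral>z. grad (\<Omega>1 \<times> \<Omega>2) (u jk) z \<bullet> grad (\<Omega>1 \<times> \<Omega>2) (u jk') z \<partial>?M)"
      by (simp add: product_grad_inner_def inner_prod_def)
    also have "\<dots> = (lam1 (fst jk) + lam2 (snd jk)) * L2_inner ?M (u jk) (u jk')"
      using eigen[of "fst jk" "snd jk"] uV[of jk'] by (simp add: laplacian_eigenpair_def L2_inner_def)
    finally show ?thesis by (simp add: orth[OF that])
  qed
  then show ?thesis
    using eigen uV uL orth by (simp add: orthogonal_family_def)
qed

end
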